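(* Let $-A$ be the generator of a bounded $C_0$-semigroup $(e^{-tA})_{t\ge 0}$ on a complex Banach space $X$, and let $(g_t)_{t>0}$ be a family of completely monotone functions such that for every $t>0$, $$g_t(0)=1,\qquad g_t'(0)=-1,\qquad g_t''(0)<\infty .$$ Let $M:=\sup_{t\ge 0}\|e^{-tA}\|$. Then for all $n\in\mathbb N$ and $t>0$, $$\|g_t^n(tA/n)x-e^{-tA}x\|\le M\,\frac{g_t''(0)-1}{2}\,\frac{t^2}{n}\,\|A^2x\|,\qquad x\in \mathrm{dom}(A^2),$$ $$\|g_t^n(tA/n)x-e^{-tA}x\|\le M\,(g_t''(0)-1)^{1/2}\,\frac{t}{\sqrt n}\,\|Ax\|,\qquad x\in \mathrm{dom}(A),$$ and, if $\alpha\in(0,2)$, $$\|g_t^n(tA/n)x-e^{-tA}x\|\le 4M\left((g_t''(0)-1)\frac{t^2}{n}\right)^{\alpha/2}\|A^\alpha x\|,\qquad x\in \mathrm{dom}(A^\alpha).$$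
   Context: A function $g\in C^\infty(0,\infty)$, $g\ge 0$, is completely monotone if $(-1)^k g^{(k)}(z)\ge 0$ for all $k\in\mathbb N$, $z>0$; by Bernstein's theorem $g(z)=\int_{[0,\infty)}e^{-zs}\,\nu(ds)$, $z>0$, for a unique positive Borel measure $\nu$ on $[0,\infty)$. One writes $g^{(k)}(0):=\lim_{z\to0+}g^{(k)}(z)$ (possibly infinite). If $g$ is bounded (equivalently $g(0)<\infty$, $\nu$ finite) and $-A$ generates a bounded $C_0$-semigroup, then $g(A)$ is defined by the Hille–Phillips calculus: $g(A)x=\int_{[0,\infty)}e^{-sA}x\,\nu(ds)$, $x\in X$ (strong integral). The operator $g_t^n(tA/n)$ is the one obtained by applying this to the bounded completely monotone function $z\mapsto (g_t(tz/n))^n$; it equals the $n$-th power of $g_t(tA/n)=\int_{[0,\infty)}e^{-s(t/n)A}\,\nu_t(ds)$, where $\nu_t$ is the representing measure of $g_t$. $A^\alpha$ denotes the usual fractional power of the (sectorial) operator $A$. *)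

theory Defs
  imports "HOL-Analysis.Analysis"
begin

section \<open>Complex Banach spaces\<close>

text \<open>The distribution only has real Banach spaces; the norm and the metric are those
  of the underlying real space.\<close>

class complex_banach = banach +
  fixes scaleC :: "complex \<Rightarrow> 'a \<Rightarrow> 'a"
  assumes scaleC_add_right: "scaleC c (x + y) = scaleC c x + scaleC c y"
    and scaleC_add_left: "scaleC (c + d) x = scaleC c x + scaleC d x"
    and scaleC_scaleC: "scaleC c (scaleC d x) = scaleC (c * d) x"
    and scaleC_of_real: "scaleC (complex_of_real r) x = r *\<^sub>R x"
    and norm_scaleC: "norm (scaleC c x) = cmod c * norm x"

section \<open>Semigroups and their generators\<close>

text \<open>Semigroups are indexed by all reals; only the values at \<open>t \<ge> 0\<close> are ever used.\<close>

definition C0_semigroup :: "(real \<Rightarrow> 'a::complex_banach \<Rightarrow> 'a) \<Rightarrow> bool" where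
  "C0_semigroup T \<longleftrightarrow>
     (\<forall>t\<ge>0. bounded_linear (T t) \<and> (\<forall>c x. T t (scaleC c x) = scaleC c (T t x))) \<and>
     (\<forall>x. T 0 x = x) \<and>
     (\<forall>s\<ge>0. \<forall>t\<ge>0. \<forall>x. T (s + t) x = T s (T t x)) \<and>
     (\<forall>x. ((\<lambda>t. T t x) \<longlongrightarrow> x) (at_right 0))"

definition bounded_C0_semigroup :: "(real \<Rightarrow> 'a::complex_banach \<Rightarrow> 'a) \<Rightarrow> bool" where
  "bounded_C0_semigroup T \<longleftrightarrow> C0_semigroup T \<and> bdd_above ((\<lambda>t. onorm (T t)) ` {0..})"

text \<open>An unbounded operator is given by its domain \<open>D\<close> and a function whose values
  outside \<open>D\<close> are irrelevant. \<open>is_generator T D B\<close> says that the operator \<open>B\<close> with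
  domain \<open>D\<close> is the generator of \<open>T\<close>.\<close>

definition is_generator ::
    "(real \<Rightarrow> 'a::complex_banach \<Rightarrow> 'a) \<Rightarrow> 'a set \<Rightarrow> ('a \<Rightarrow> 'a) \<Rightarrow> bool" where
  "is_generator T D B \<longleftrightarrow>
     D = {x. \<exists>y. ((\<lambda>h. (T h x - x) /\<^sub>R h) \<longlongrightarrow> y) (at_right 0)} \<and>
     (\<forall>x\<in>D. ((\<lambda>h. (T h x - x) /\<^sub>R h) \<longlongrightarrow> B x) (at_right 0))"

text \<open>The domain of the \<open>n\<close>-th power; the power itself is \<open>A ^^ n\<close>.\<close>

definition dom_pow :: "'a set \<Rightarrow> ('a \<Rightarrow> 'a) \<Rightarrow> nat \<Rightarrow> 'a set" where
  "dom_pow D A n = {x. \<forall>k<n. (A ^^ k) x \<in> D}"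

section \<open>Fractional powers\<close>

text \<open>The operator \<open>(\<lambda> + A)\<^sup>-\<^sup>1\<close>.\<close>

definition resolvent_neg :: "'a::real_vector set \<Rightarrow> ('a \<Rightarrow> 'a) \<Rightarrow> real \<Rightarrow> 'a \<Rightarrow> 'a" where
  "resolvent_neg D A l = inv_into D (\<lambda>x. l *\<^sub>R x + A x)"

definition frac_order :: "real \<Rightarrow> nat" where
  "frac_order \<alpha> = nat \<lfloor>\<alpha>\<rfloor> + 1"

text \<open>The Balakrishnan--Komatsu operator on \<open>dom (A\<^sup>n)\<close>, with \<open>n\<close> the least integer
  above \<open>\<alpha> > 0\<close>:
  \<open>\<Gamma>(n) / (\<Gamma>(\<alpha>) \<Gamma>(n - \<alpha>)) \<integral>\<^sub>0\<^sup>\<infinity> \<lambda>\<^sup>\<alpha>\<^sup>-\<^sup>1 (A (\<lambda> + A)\<^sup>-\<^sup>1)\<^sup>n x d\<lambda>\<close>.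
  For \<open>0 < \<alpha> < 1\<close> the constant is \<open>sin (\<pi>\<alpha>) / \<pi>\<close>.\<close>

definition balakrishnan :: "'a::banach set \<Rightarrow> ('a \<Rightarrow> 'a) \<Rightarrow> real \<Rightarrow> 'a \<Rightarrow> 'a" where
  "balakrishnan D A \<alpha> x =
     (Gamma (real (frac_order \<alpha>)) / (Gamma \<alpha> * Gamma (real (frac_order \<alpha>) - \<alpha>))) *\<^sub>R
     integral {0<..}
       (\<lambda>l. (l powr (\<alpha> - 1)) *\<^sub>R (((\<lambda>y. A (resolvent_neg D A l y)) ^^ frac_order \<alpha>) x))"

text \<open>For a densely defined sectorial operator \<open>A\<close> (not necessarily injective) the
  fractional power \<open>A\<^sup>\<alpha>\<close> is the closure of the operator above.\<close>

definition frac_pow_graph :: "'a::banach set \<Rightarrow> ('a \<Rightarrow> 'a) \<Rightarrow> real \<Rightarrow> ('a \<times> 'a) set" where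
  "frac_pow_graph D A \<alpha> = closure ((\<lambda>x. (x, balakrishnan D A \<alpha> x)) ` dom_pow D A (frac_order \<alpha>))"

definition frac_pow_dom :: "'a::banach set \<Rightarrow> ('a \<Rightarrow> 'a) \<Rightarrow> real \<Rightarrow> 'a set" where
  "frac_pow_dom D A \<alpha> = Domain (frac_pow_graph D A \<alpha>)"

definition frac_pow :: "'a::banach set \<Rightarrow> ('a \<Rightarrow> 'a) \<Rightarrow> real \<Rightarrow> 'a \<Rightarrow> 'a" where
  "frac_pow D A \<alpha> x = (THE y. (x, y) \<in> frac_pow_graph D A \<alpha>)"

section \<open>Completely monotone functions\<close>

text \<open>Only the values on \<open>(0,\<infinity>)\<close> matter.\<close>

definition completely_monotone :: "(real \<Rightarrow> real) \<Rightarrow> bool" where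
  "completely_monotone g \<longleftrightarrow>
     (\<forall>k. \<forall>z>0. (deriv ^^ k) g field_differentiable at z \<and> (-1) ^ k * (deriv ^^ k) g z \<ge> 0)"

text \<open>\<open>g\<^sup>(\<^sup>k\<^sup>)(0)\<close> as a right-hand limit, possibly infinite.\<close>

definition deriv_at_0 :: "nat \<Rightarrow> (real \<Rightarrow> real) \<Rightarrow> ereal" where
  "deriv_at_0 k g = Lim (at_right 0) (\<lambda>z. ereal ((deriv ^^ k) g z))"

text \<open>The representing measure of Bernstein's theorem; a Borel measure on \<open>[0,\<infinity>)\<close> is
  encoded as a Borel measure on the real line that does not charge the negative half-line.\<close>

definition bernstein_measure :: "(real \<Rightarrow> real) \<Rightarrow> real measure" where
  "bernstein_measure g = (THE \<nu>. sets \<nu> = sets borel \<and> emeasure \<nu> {..<0} = 0 \<and>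
     (\<forall>z>0. (\<integral>\<^sup>+s. ennreal (exp (- (z * s))) \<partial>\<nu>) = ennreal (g z)))"

section \<open>The Hille--Phillips calculus\<close>

text \<open>The Bochner integral, defined exactly as the library's \<open>has_bochner_integral\<close>, but for
  values in an arbitrary Banach space: the library version is restricted to
  second countable, i.e. separable, ones.\<close>

definition has_strong_integral :: "'s measure \<Rightarrow> ('s \<Rightarrow> 'a::banach) \<Rightarrow> 'a \<Rightarrow> bool" where
  "has_strong_integral M f y \<longleftrightarrow> f \<in> borel_measurable M \<and>
     (\<exists>u. (\<forall>i. Bochner_Integration.simple_bochner_integrable M (u i)) \<and>
          (\<lambda>i. \<integral>\<^sup>+s. ennreal (norm (f s - u i s)) \<partial>M) \<longlonglongrightarrow> 0 \<and>
          (\<lambda>i. Bochner_Integration.simple_bochner_integral M (u i)) \<longlonglongrightarrow> y)"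

definition strong_integral :: "'s measure \<Rightarrow> ('s \<Rightarrow> 'a::banach) \<Rightarrow> 'a" where
  "strong_integral M f = (THE y. has_strong_integral M f y)"

text \<open>\<open>g(A) x = \<integral>\<^bsub>[0,\<infinity>)\<^esub> T(s) x \<nu>(ds)\<close> for bounded completely monotone \<open>g\<close>, where
  \<open>-A\<close> generates \<open>T\<close> and \<open>\<nu>\<close> represents \<open>g\<close>.\<close>

definition hille_phillips ::
    "(real \<Rightarrow> 'a::complex_banach \<Rightarrow> 'a) \<Rightarrow> (real \<Rightarrow> real) \<Rightarrow> 'a \<Rightarrow> 'a" where
  "hille_phillips T g x =
     strong_integral (bernstein_measure g) (\<lambda>s. indicator {0..} s *\<^sub>R T s x)"

end

theory Submission
  imports Defs "HOL-Probability.Probability" "HOL-Real_Asymp.Real_Asymp"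
begin

text \<open>Write \<open>\<Delta>\<close> for the operator \<open>g\<^sub>t\<^sup>n(tA/n) - e\<^sup>-\<^sup>t\<^sup>A\<close>. The function \<open>z \<mapsto> g\<^sub>t(tz/n)\<^sup>n\<close> is the Laplace
  transform of the law \<open>\<nu>\<close> of \<open>t/n\<close> times a sum of \<open>n\<close> independent copies of a random variable
  with law \<open>\<nu>\<^sub>t\<close>, the representing measure of \<open>g\<^sub>t\<close>. The normalisation \<open>g\<^sub>t(0) = 1\<close>, \<open>g\<^sub>t'(0) = -1\<close> says that
  \<open>\<nu>\<^sub>t\<close> is a probability measure with mean \<open>1\<close>, and its second moment is at most \<open>g\<^sub>t''(0)\<close>; so \<open>\<nu>\<close> has mean \<open>t\<close>
  and variance at most \<open>V = (g\<^sub>t''(0) - 1) t\<^sup>2/n\<close> (\<open>approximation_measure\<close>). Then \<open>\<Delta>x\<close> is the expectation of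
  \<open>T(s)x - T(t)x\<close> when \<open>s\<close> has law \<open>\<nu>\<close>, and each estimate is a pointwise bound for the orbit of \<open>x\<close>
  followed by a moment inequality \<open>E|s - t|\<^sup>a \<le> V\<^sup>a\<^sup>/\<^sup>2\<close> with \<open>a \<le> 2\<close>.

  For \<open>x\<close> in the domain of \<open>A\<close> the orbit is Lipschitz with constant \<open>M \<parallel>Ax\<parallel>\<close>. For \<open>x\<close> in the domain of \<open>A\<^sup>2\<close>
  the first order Taylor expansion at \<open>t\<close> has remainder at most \<open>M \<parallel>A\<^sup>2x\<parallel> (s - t)\<^sup>2/2\<close>, and its linear term
  \<open>-(s - t) T(t)Ax\<close> has expectation zero. For fractional powers, the orbit of \<open>x\<close> is Hoelder continuous of order
  \<open>b \<in> (0,1)\<close> with constant at most \<open>4M \<parallel>A\<^sup>bx\<parallel>\<close> (\<open>orbit_Hoelder\<close>), which gives the case \<open>\<alpha> < 1\<close>. For \<open>1 < \<alpha> < 2\<close> the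
  power \<open>A\<^sup>\<alpha>x\<close> is \<open>A\<^sup>\<alpha>\<^sup>-\<^sup>1(Ax)\<close>, so the orbit of \<open>Ax\<close> is Hoelder continuous of order \<open>\<alpha> - 1\<close>; integrating once
  yields a first order Taylor expansion with remainder of order \<open>|s - t|\<^sup>\<alpha>\<close>.

  The Hoelder estimate comes from inverting the fractional power. With \<open>A\<close> replaced by \<open>e + A\<close>, so that
  everything decays exponentially, \<open>\<Gamma>(b) T(r)x = \<integral>\<^sub>r\<^sup>\<infinity> (u - r)\<^sup>b\<^sup>-\<^sup>1 T(u) A\<^sup>bx du\<close> (\<open>fractional_inversion\<close>).
  The difference of two such kernels has \<open>L\<^sup>1\<close> norm \<open>2|r - t|\<^sup>b/b\<close>, whence the constant
  \<open>2M/\<Gamma>(b + 1) \<le> 4M\<close>; finally \<open>e\<close> tends to \<open>0\<close>.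

  The fractional power is defined as a closure. Both sides of the estimates are continuous along the graph, so
  it suffices to prove them on the domain of \<open>A\<close> or \<open>A\<^sup>2\<close>. That the closure is again the graph of a function
  (\<open>frac_pow_eq\<close>) holds because the fractional power becomes a bounded operator after
  composition with an injective power of the resolvent \<open>(1 + A)\<^sup>-\<^sup>1\<close>.

  Estimates of integrals with values in a Banach space are reduced to scalar ones through norming functionals
  (\<open>norming_functional\<close>, the Hahn--Banach theorem). The representing measures exist by Bernstein's theorem,
  which is proved along Feller's lines: the Taylor coefficients of \<open>g\<close> at \<open>a\<close> are the weights of a probability
  distribution on multiples of \<open>1/a\<close>, and a weak limit as \<open>a\<close> grows represents \<open>g\<close>.\<close>

section \<open>Norming functionals\<close>

definition sublinear :: "('a::real_vector \<Rightarrow> real) \<Rightarrow> bool" where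
  "sublinear p \<longleftrightarrow> (\<forall>x y. p (x + y) \<le> p x + p y) \<and> (\<forall>c x. 0 \<le> c \<longrightarrow> p (c *\<^sub>R x) = c * p x)"

lemma sublinear_zero: "sublinear p \<Longrightarrow> p 0 = 0"
  unfolding sublinear_def by (metis mult_zero_left order_refl scaleR_zero_left)

lemma sublinear_minus: "sublinear p \<Longrightarrow> - p (- x) \<le> p x"
proof -
  assume p: "sublinear p"
  then have "p (x + - x) \<le> p x + p (- x)" unfolding sublinear_def by blast
  then show ?thesis using sublinear_zero[OF p] by simp
qed

text \<open>This is the usual perturbation of a sublinear functional in the direction \<open>y\<close>. It lies below \<open>p\<close>, is again
  sublinear, and a minimal \<open>p\<close> must therefore coincide with it.\<close>

definition shifted_inf :: "('a::real_vector \<Rightarrow> real) \<Rightarrow> 'a \<Rightarrow> 'a \<Rightarrow> real" where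
  "shifted_inf p y x = (INF t\<in>{0..}. p (x + t *\<^sub>R y) - t * p y)"

lemma shifted_inf_bdd:
  assumes "sublinear p"
  shows "bdd_below ((\<lambda>t. p (x + t *\<^sub>R y) - t * p y) ` {0..})"
proof (rule bdd_belowI2)
  fix t :: real assume t: "t \<in> {0..}"
  have "t * p y = p (t *\<^sub>R y)" using assms t unfolding sublinear_def by auto
  also have "t *\<^sub>R y = (x + t *\<^sub>R y) + (- x)" by simp
  also have "p \<dots> \<le> p (x + t *\<^sub>R y) + p (- x)" using assms unfolding sublinear_def by blast
  finally show "- p (- x) \<le> p (x + t *\<^sub>R y) - t * p y" by simp
qed

lemma shifted_inf_le: "sublinear p \<Longrightarrow> 0 \<le> t \<Longrightarrow> shifted_inf p y x \<le> p (x + t *\<^sub>R y) - t * p y"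
  unfolding shifted_inf_def using shifted_inf_bdd by (intro cINF_lower) auto

lemma sublinear_shifted_inf:
  assumes p: "sublinear p"
  shows "sublinear (shifted_inf p y)"
  unfolding sublinear_def
proof (intro conjI allI impI)
  let ?q = "shifted_inf p y"
  have hom: "p (c *\<^sub>R x) = c * p x" if "c \<ge> 0" for c x using p that unfolding sublinear_def by blast
  have sub: "p (x + z) \<le> p x + p z" for x z using p unfolding sublinear_def by blast
  {
    fix x z
    have "?q (x + z) - (p (x + s *\<^sub>R y) - s * p y) \<le> p (z + t *\<^sub>R y) - t * p y"
      if "s \<ge> 0" "t \<ge> 0" for s t
      using shifted_inf_le[OF p, of "s + t" y "x + z"] sub[of "x + s *\<^sub>R y" "z + t *\<^sub>R y"] that
      by (simp add: algebra_simps)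
    then have "?q (x + z) - (p (x + s *\<^sub>R y) - s * p y) \<le> ?q z" if "s \<ge> 0" for s
      unfolding shifted_inf_def[of p y z] using that by (intro cINF_greatest) auto
    then have "?q (x + z) - ?q z \<le> p (x + s *\<^sub>R y) - s * p y" if "s \<ge> 0" for s
      using that by (simp add: algebra_simps)
    then have "?q (x + z) - ?q z \<le> ?q x"
      unfolding shifted_inf_def[of p y x] by (intro cINF_greatest) auto
    then show "?q (x + z) \<le> ?q x + ?q z" by simp
  }
  have le: "?q (c *\<^sub>R x) \<le> c * ?q x" if c: "c > 0" for c x
  proof -
    have "?q (c *\<^sub>R x) / c \<le> p (x + t *\<^sub>R y) - t * p y" if "t \<ge> 0" for t
      using shifted_inf_le[OF p, of "c * t" y "c *\<^sub>R x"] hom[of c "x + t *\<^sub>R y"] c that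
      by (simp add: scaleR_add_right field_simps)
    then have "?q (c *\<^sub>R x) / c \<le> ?q x"
      unfolding shifted_inf_def[of p y x] by (intro cINF_greatest) auto
    then show ?thesis using c by (simp add: field_simps)
  qed
  fix c :: real and x assume "0 \<le> c"
  show "?q (c *\<^sub>R x) = c * ?q x"
  proof (cases "c = 0")
    case True
    have "p 0 = 0" by (rule sublinear_zero[OF p])
    have "p (t *\<^sub>R y) - t * p y = 0" if "t \<ge> 0" for t using hom[OF that] by simp
    then have "(\<lambda>t. p (0 + t *\<^sub>R y) - t * p y) ` {0..} = {0}"
      by (auto intro!: image_eqI[of _ _ 0] simp: \<open>p 0 = 0\<close>)
    then show ?thesis using True unfolding shifted_inf_def by simp
  next
    case False
    then have c: "c > 0" using \<open>0 \<le> c\<close> by simp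
    have "?q x = ?q ((1 / c) *\<^sub>R (c *\<^sub>R x))" using c by simp
    also have "\<dots> \<le> (1 / c) * ?q (c *\<^sub>R x)" using c by (intro le) simp
    finally have "c * ?q x \<le> ?q (c *\<^sub>R x)" using c by (simp add: field_simps)
    with le[OF c, of x] show ?thesis by simp
  qed
qed

text \<open>Two members of a chain have a common lower bound in the chain, which makes the pointwise infimum subadditive;
  the bound \<open>- p (- x) \<le> p x\<close> keeps it finite.\<close>

lemma sublinear_Inf_chain:
  assumes ne: "C \<noteq> {}" and sl: "\<And>p. p \<in> C \<Longrightarrow> sublinear p"
    and chain: "\<And>p q. p \<in> C \<Longrightarrow> q \<in> C \<Longrightarrow> p \<le> q \<or> q \<le> p"
  shows "sublinear (\<lambda>x. INF p\<in>C. p x)" and "\<And>p x. p \<in> C \<Longrightarrow> (INF p\<in>C. p x) \<le> p x"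
proof -
  obtain p0 where p0: "p0 \<in> C" using ne by blast
  have bdd: "bdd_below ((\<lambda>p. p x) ` C)" for x
  proof (rule bdd_belowI2)
    fix p assume p: "p \<in> C"
    have "- p (- x) \<le> p x" using sublinear_minus[OF sl[OF p]] .
    moreover have "- p0 (- x) \<le> p0 x" using sublinear_minus[OF sl[OF p0]] .
    ultimately show "min (- p0 (- x)) (p0 x) \<le> p x"
      using chain[OF p p0] unfolding le_fun_def by (smt (verit, best))
  qed
  show low: "(INF p\<in>C. p x) \<le> p x" if "p \<in> C" for p x
    using that bdd by (intro cINF_lower) auto
  show "sublinear (\<lambda>x. INF p\<in>C. p x)"
    unfolding sublinear_def
  proof (intro conjI allI impI)
    fix x y
    have "(INF p\<in>C. p (x + y)) \<le> p x + q y" if p: "p \<in> C" and q: "q \<in> C" for p q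
    proof -
      obtain r where r: "r \<in> C" "r \<le> p" "r \<le> q" using chain[OF p q] p q by blast
      have "(INF p\<in>C. p (x + y)) \<le> r (x + y)" by (rule low[OF r(1)])
      also have "\<dots> \<le> r x + r y" using sl[OF r(1)] unfolding sublinear_def by blast
      also have "\<dots> \<le> p x + q y" using r(2,3) by (intro add_mono) (auto simp: le_fun_def)
      finally show ?thesis .
    qed
    note pq = this
    have "(INF p\<in>C. p (x + y)) - p x \<le> (INF q\<in>C. q y)" if "p \<in> C" for p
      using pq[OF that] by (intro cINF_greatest ne) (simp add: algebra_simps)
    then have "(INF p\<in>C. p (x + y)) - (INF q\<in>C. q y) \<le> (INF p\<in>C. p x)"
      by (intro cINF_greatest ne) (simp add: algebra_simps)
    then show "(INF p\<in>C. p (x + y)) \<le> (INF p\<in>C. p x) + (INF p\<in>C. p y)" by simp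
  next
    fix c :: real and x assume c: "0 \<le> c"
    have "(\<lambda>p. p (c *\<^sub>R x)) ` C = (\<lambda>p. c * p x) ` C"
      using sl c unfolding sublinear_def by (intro image_cong) auto
    then have "(INF p\<in>C. p (c *\<^sub>R x)) = (INF p\<in>C. c * p x)" by simp
    also have "\<dots> = c * (INF p\<in>C. p x)"
    proof (cases "c = 0")
      case False
      then have cp: "c > 0" using c by simp
      show ?thesis
      proof (rule antisym)
        have "(INF p\<in>C. c * p x) \<le> c * p x" if "p \<in> C" for p
          using that bdd[of "c *\<^sub>R x"] \<open>(\<lambda>p. p (c *\<^sub>R x)) ` C = (\<lambda>p. c * p x) ` C\<close>
          by (intro cINF_lower) auto
        then have "(INF p\<in>C. c * p x) / c \<le> (INF p\<in>C. p x)"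
          using cp by (intro cINF_greatest ne) (simp add: field_simps)
        then show "(INF p\<in>C. c * p x) \<le> c * (INF p\<in>C. p x)" using cp by (simp add: field_simps)
        show "c * (INF p\<in>C. p x) \<le> (INF p\<in>C. c * p x)"
          using cp low by (intro cINF_greatest ne mult_left_mono) auto
      qed
    qed (use ne in simp)
    finally show "(INF p\<in>C. p (c *\<^sub>R x)) = c * (INF p\<in>C. p x)" .
  qed
qed

lemma minimal_sublinear_below:
  fixes p0 :: "'a::real_vector \<Rightarrow> real"
  assumes "sublinear p0"
  obtains p where "sublinear p" "p \<le> p0" "\<And>q. sublinear q \<Longrightarrow> q \<le> p \<Longrightarrow> q = p"
proof -
  define S where "S = {p. sublinear p \<and> p \<le> p0}"
  have "\<exists>m\<in>S. \<forall>a\<in>S. a \<le> m \<longrightarrow> a = m"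
  proof (rule predicate_Zorn[where P = "\<lambda>p q. q \<le> p"])
    show "partial_order_on S (relation_of (\<lambda>p q. q \<le> p) S)"
      by (intro partial_order_on_relation_ofI) auto
  next
    fix C assume C: "C \<in> Chains (relation_of (\<lambda>p q. q \<le> p) S)"
    then have CS: "C \<subseteq> S" and ch: "\<And>p q. p \<in> C \<Longrightarrow> q \<in> C \<Longrightarrow> p \<le> q \<or> q \<le> p"
      unfolding Chains_def relation_of_def by blast+
    show "\<exists>u\<in>S. \<forall>a\<in>C. u \<le> a"
    proof (cases "C = {}")
      case True
      then show ?thesis using assms by (auto simp: S_def)
    next
      case False
      have sl: "\<And>p. p \<in> C \<Longrightarrow> sublinear p" using CS by (auto simp: S_def)
      have I: "sublinear (\<lambda>x. INF p\<in>C. p x)" "\<And>p x. p \<in> C \<Longrightarrow> (INF p\<in>C. p x) \<le> p x"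
        using sublinear_Inf_chain[OF False] sl ch by blast+
      obtain p1 where p1: "p1 \<in> C" using False by blast
      then have "p1 \<le> p0" using CS by (auto simp: S_def)
      then have "(\<lambda>x. INF p\<in>C. p x) \<in> S"
        using I(1) I(2)[OF p1] unfolding S_def le_fun_def by (auto intro: order_trans)
      then show ?thesis using I(2) by (intro bexI[of _ "\<lambda>x. INF p\<in>C. p x"]) (auto simp: le_fun_def)
    qed
  qed
  then obtain m where m: "m \<in> S" "\<forall>a\<in>S. a \<le> m \<longrightarrow> a = m" by blast
  show ?thesis
  proof (rule that[of m])
    show "sublinear m" "m \<le> p0" using m(1) by (auto simp: S_def)
    show "q = m" if "sublinear q" "q \<le> m" for q
      using m(2) that order_trans[OF that(2) \<open>m \<le> p0\<close>] by (auto simp: S_def)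
  qed
qed

text \<open>Minimality forces \<open>p\<close> to agree with its perturbation in every direction \<open>y\<close>, that is
  \<open>p x \<le> p (x + y) - p y\<close>; together with subadditivity this is additivity.\<close>

lemma minimal_sublinear_linear:
  assumes p: "sublinear p" and min: "\<And>q. sublinear q \<Longrightarrow> q \<le> p \<Longrightarrow> q = p"
  shows "linear p"
proof -
  have q: "shifted_inf p y = p" for y
  proof (rule min[OF sublinear_shifted_inf[OF p]])
    show "shifted_inf p y \<le> p"
      using shifted_inf_le[OF p, of 0 y] by (simp add: le_fun_def)
  qed
  have add: "p (x + y) = p x + p y" for x y
  proof (rule antisym)
    show "p (x + y) \<le> p x + p y" using p unfolding sublinear_def by blast
    show "p x + p y \<le> p (x + y)" using shifted_inf_le[OF p, of 1 y x] unfolding q by simp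
  qed
  have neg: "p (- x) = - p x" for x
    using add[of x "- x"] sublinear_zero[OF p] by simp
  show ?thesis
  proof (rule linearI)
    show "p (x + y) = p x + p y" for x y by (rule add)
    fix r :: real and b
    show "p (r *\<^sub>R b) = r *\<^sub>R p b"
    proof (cases "r \<ge> 0")
      case True
      then show ?thesis using p unfolding sublinear_def by simp
    next
      case False
      then have "p ((- r) *\<^sub>R b) = (- r) * p b"
        using p unfolding sublinear_def by (meson le_cases neg_0_le_iff_le)
      then show ?thesis using neg[of "r *\<^sub>R b"] by simp
    qed
  qed
qed

text \<open>Apply minimality below the perturbation of the norm in the direction \<open>y\<close>: this perturbation is at most
  \<open>- norm y\<close> at \<open>- y\<close>, so a linear functional below it attains the norm at \<open>y\<close>.\<close>

lemma norming_functional: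
  fixes y :: "'a::real_normed_vector"
  obtains f :: "'a \<Rightarrow> real" where "bounded_linear f" "\<And>x. \<bar>f x\<bar> \<le> norm x" "f y = norm y"
proof -
  have n: "sublinear (norm :: 'a \<Rightarrow> real)"
    unfolding sublinear_def by (simp add: norm_triangle_ineq)
  obtain f where f: "sublinear f" "f \<le> shifted_inf norm y" "\<And>q. sublinear q \<Longrightarrow> q \<le> f \<Longrightarrow> q = f"
  proof (rule minimal_sublinear_below[OF sublinear_shifted_inf[OF n, of y]])
    fix p :: "'a \<Rightarrow> real"
    assume *: "\<And>f. \<lbrakk>sublinear f; f \<le> shifted_inf norm y; \<And>q. \<lbrakk>sublinear q; q \<le> f\<rbrakk> \<Longrightarrow> q = f\<rbrakk> \<Longrightarrow> thesis"
      and p: "sublinear p" "p \<le> shifted_inf norm y" "\<And>q. sublinear q \<Longrightarrow> q \<le> p \<Longrightarrow> q = p"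
    show thesis by (rule *[OF p(1,2)]) (rule p(3))
  qed
  have lin: "linear f" by (rule minimal_sublinear_linear[OF f(1)]) (rule f(3))
  have le: "f x \<le> norm x" for x
    using le_funD[OF f(2), of x] shifted_inf_le[OF n, of 0 y x] by simp
  have ab: "\<bar>f x\<bar> \<le> norm x" for x
    using le[of x] le[of "- x"] linear_neg[OF lin, of x] by simp
  have "f (- y) \<le> norm (- y + 1 *\<^sub>R y) - 1 * norm y"
    using le_funD[OF f(2), of "- y"] shifted_inf_le[OF n, of 1 y "- y"] by linarith
  then have "f y = norm y" using ab[of y] linear_neg[OF lin, of y] by simp
  moreover have "bounded_linear f"
    using lin ab by (intro bounded_linear_intro[where K = 1]) (auto simp: linear_add linear_cmul)
  ultimately show ?thesis by (intro that[of f] ab)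
qed

section \<open>Strong integrals and functionals\<close>

text \<open>A functional of norm at most one maps the approximating simple functions of a strong integral to those of a
  scalar Bochner integral. Estimates of strong integrals are thereby reduced to
  scalar ones.\<close>

lemma has_strong_integral_functional:
  assumes I: "has_strong_integral M f y"
    and l: "bounded_linear l" "\<And>x. \<bar>l x :: real\<bar> \<le> norm x"
  shows "has_bochner_integral M (\<lambda>s. l (f s)) (l y)"
proof -
  from I obtain u where f: "f \<in> borel_measurable M"
    and u: "\<And>i. Bochner_Integration.simple_bochner_integrable M (u i)"
    and lim0: "(\<lambda>i. \<integral>\<^sup>+s. ennreal (norm (f s - u i s)) \<partial>M) \<longlonglongrightarrow> 0"
    and lim: "(\<lambda>i. Bochner_Integration.simple_bochner_integral M (u i)) \<longlonglongrightarrow> y"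
    unfolding has_strong_integral_def by blast
  have lin: "linear l" using l(1) bounded_linear.linear by blast
  show ?thesis
  proof (rule has_bochner_integral.intros[where s = "\<lambda>i s. l (u i s)"])
    have "l \<in> borel_measurable borel"
      using l(1) by (intro borel_measurable_continuous_onI linear_continuous_on)
    then show "(\<lambda>s. l (f s)) \<in> borel_measurable M" using f by measurable
    show "Bochner_Integration.simple_bochner_integrable M (\<lambda>s. l (u i s))" for i
      using simple_bochner_integrable_compose2[of "\<lambda>x _. l x", OF _ u u, of i] linear_0[OF lin] by simp
    show "(\<lambda>i. \<integral>\<^sup>+ s. ennreal (norm (l (f s) - l (u i s))) \<partial>M) \<longlonglongrightarrow> 0"
    proof (rule tendsto_sandwich[OF _ _ tendsto_const lim0])
      show "\<forall>\<^sub>F i in sequentially. (\<integral>\<^sup>+ s. ennreal (norm (l (f s) - l (u i s))) \<partial>M)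
          \<le> (\<integral>\<^sup>+ s. ennreal (norm (f s - u i s)) \<partial>M)"
        using l(2) by (intro always_eventually allI nn_integral_mono ennreal_leI)
          (simp add: linear_diff[OF lin, symmetric])
    qed simp
    have "Bochner_Integration.simple_bochner_integral M (\<lambda>s. l (u i s)) = l (Bochner_Integration.simple_bochner_integral M (u i))" for i
      by (rule simple_bochner_integral_linear[OF lin u])
    then show "(\<lambda>i. Bochner_Integration.simple_bochner_integral M (\<lambda>s. l (u i s))) \<longlonglongrightarrow> l y"
      using bounded_linear.tendsto[OF l(1) lim] by simp
  qed
qed

lemma has_strong_integral_unique:
  assumes "has_strong_integral M f y" "has_strong_integral M f z"
  shows "y = z"
proof -
  obtain l :: "'b \<Rightarrow> real" where l: "bounded_linear l" "\<And>x. \<bar>l x\<bar> \<le> norm x" "l (y - z) = norm (y - z)"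
    using norming_functional[of "y - z"] by metis
  have "l y = l z"
    using assms[THEN has_strong_integral_functional, OF l(1,2)]
    by (rule has_bochner_integral_eq)
  then show ?thesis
    using l(3) linear_diff[OF bounded_linear.linear[OF l(1)], of y z] by simp
qed

lemma strong_integral_functional:
  assumes "has_strong_integral M f y"
    and "bounded_linear l" "\<And>x. \<bar>l x :: real\<bar> \<le> norm x"
  shows "integrable M (\<lambda>s. l (f s))" "l (strong_integral M f) = (\<integral>s. l (f s) \<partial>M)"
proof -
  have "strong_integral M f = y"
    unfolding strong_integral_def
  proof (rule the_equality)
    show "has_strong_integral M f y" by fact
    show "z = y" if "has_strong_integral M f z" for z
      using that assms(1) by (rule has_strong_integral_unique)
  qed
  then show "integrable M (\<lambda>s. l (f s))" "l (strong_integral M f) = (\<integral>s. l (f s) \<partial>M)"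
    using has_strong_integral_functional[OF assms] by (simp_all add: has_bochner_integral_iff)
qed

text \<open>A continuous bounded function on the half-line is approximated by its values on the grid of mesh \<open>1/(i + 1)\<close>,
  truncated at \<open>i + 1\<close>; the distances tend to zero by dominated convergence.\<close>

lemma has_strong_integral_continuous:
  fixes f :: "real \<Rightarrow> 'b::banach"
  assumes M: "finite_measure M" "sets M = sets borel"
    and cont: "continuous_on {0..} f" and bd: "\<And>s. s \<ge> 0 \<Longrightarrow> norm (f s) \<le> C"
  shows "\<exists>y. has_strong_integral M (\<lambda>s. indicator {0..} s *\<^sub>R f s) y"
proof -
  interpret finite_measure M by fact
  note [measurable_cong] = M(2)
  define F where "F s = indicator {0..} s *\<^sub>R f s" for s :: real
  have C0: "0 \<le> C" using bd[of 0] norm_ge_zero order_trans by blast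
  have FC: "norm (F s) \<le> C" for s using bd[of s] C0 by (auto simp: F_def indicator_def)
  have Fm[measurable]: "F \<in> borel_measurable borel"
    unfolding F_def[abs_def] by (intro borel_measurable_continuous_on_indicator cont) auto
  \<comment> \<open>The integer-valued quantiser has finite range. The value \<open>-1\<close> marks the discarded part, where the
    extension of \<open>f\<close> by zero vanishes.\<close>
  define k :: "nat \<Rightarrow> real \<Rightarrow> int" where
    "k i s = (if 0 \<le> s \<and> s < real (Suc i) then \<lfloor>s * real (Suc i)\<rfloor> else -1)" for i s
  define v where "v i j = F (real_of_int j / real (Suc i))" for i :: nat and j
  define u where "u i s = v i (k i s)" for i s
  have km[measurable]: "k i \<in> measurable borel (count_space UNIV)" for i
    unfolding k_def[abs_def] by measurable
  have kfin: "finite (range (k i))" for i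
  proof (rule finite_subset)
    show "range (k i) \<subseteq> {-1..(int (Suc i) * int (Suc i))}"
    proof clarsimp
      fix s
      show "- 1 \<le> k i s \<and> k i s \<le> (1 + int i) * (1 + int i)"
      proof (cases "0 \<le> s \<and> s < real (Suc i)")
        case True
        then have "s * real (Suc i) \<le> real (Suc i) * real (Suc i)" by (intro mult_right_mono) auto
        then have "\<lfloor>s * real (Suc i)\<rfloor> \<le> (1 + int i) * (1 + int i)"
          by (simp add: floor_le_iff algebra_simps)
        moreover have "0 \<le> \<lfloor>s * real (Suc i)\<rfloor>" using True by simp
        moreover have "k i s = \<lfloor>s * real (Suc i)\<rfloor>" using True unfolding k_def by presburger
        ultimately show ?thesis by linarith
      next
        case False
        then have "k i s = -1" unfolding k_def by presburger
        moreover have "0 \<le> (1 + int i) * (1 + int i)" by simp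
        ultimately show ?thesis by linarith
      qed
    qed
  qed simp
  have sf: "simple_function M (u i)" for i
  proof -
    have "simple_function M (k i)"
      unfolding simple_function_def
    proof (intro conjI ballI)
      show "finite (k i ` space M)" by (rule finite_subset[OF _ kfin[of i]]) auto
      show "k i -` {x} \<inter> space M \<in> sets M" for x by measurable
    qed
    then show ?thesis unfolding u_def[abs_def] using simple_function_compose1[of M "k i" "v i"] by simp
  qed
  have uC: "norm (u i s) \<le> C" for i s unfolding u_def v_def by (rule FC)
  have ub: "Bochner_Integration.simple_bochner_integrable M (u i)" for i
  proof (rule simple_bochner_integrable.intros[OF sf])
    show "emeasure M {y \<in> space M. u i y \<noteq> 0} \<noteq> \<infinity>" by simp
  qed
  have lim: "(\<lambda>i. F s - u i s) \<longlonglongrightarrow> 0" for s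
  proof (cases "s \<ge> 0")
    case True
    have *: "\<forall>\<^sub>F i in sequentially. s < real (Suc i)"
      using filterlim_compose[OF filterlim_real_sequentially filterlim_Suc]
      by (auto simp: filterlim_at_top_dense)
    have ev: "\<forall>\<^sub>F i in sequentially. u i s = f (\<lfloor>s * real (Suc i)\<rfloor> / real (Suc i))"
      using * True by (auto elim!: eventually_mono simp: u_def v_def F_def k_def)
    have q: "(\<lambda>i. \<lfloor>s * real (Suc i)\<rfloor> / real (Suc i)) \<longlonglongrightarrow> s"
    proof (rule tendsto_sandwich[of "\<lambda>i. s - 1 / real (Suc i)" _ _ "\<lambda>i. s"])
      have "s - 1 / real (Suc i) \<le> \<lfloor>s * real (Suc i)\<rfloor> / real (Suc i)" for i
      proof -
        have "(s * real (Suc i) - 1) / real (Suc i) \<le> \<lfloor>s * real (Suc i)\<rfloor> / real (Suc i)"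
          by (intro divide_right_mono real_of_int_floor_ge_diff_one) simp
        then show ?thesis by (simp add: diff_divide_distrib del: of_nat_Suc)
      qed
      then show "\<forall>\<^sub>F i in sequentially. s - 1 / real (Suc i) \<le> \<lfloor>s * real (Suc i)\<rfloor> / real (Suc i)" by simp
      have "\<lfloor>s * real (Suc i)\<rfloor> / real (Suc i) \<le> s" for i
        using of_int_floor_le[of "s * real (Suc i)"] by (simp add: field_simps del: of_nat_Suc)
      then show "\<forall>\<^sub>F i in sequentially. \<lfloor>s * real (Suc i)\<rfloor> / real (Suc i) \<le> s" by simp
      show "(\<lambda>i. s - 1 / real (Suc i)) \<longlonglongrightarrow> s"
        using tendsto_diff[OF tendsto_const lim_inverse_n'[THEN LIMSEQ_Suc], of s] by simp
    qed simp
    have "(\<lambda>i. f (\<lfloor>s * real (Suc i)\<rfloor> / real (Suc i))) \<longlonglongrightarrow> f s"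
      by (rule continuous_on_tendsto_compose[OF cont q]) (use True in auto)
    then have "(\<lambda>i. u i s) \<longlonglongrightarrow> F s"
      using ev True by (simp add: F_def tendsto_cong)
    then show ?thesis using tendsto_diff[OF tendsto_const, of "\<lambda>i. u i s" "F s" _ "F s"] by simp
  next
    case False
    then have "u i s = 0" for i by (auto simp: u_def v_def F_def k_def divide_less_0_iff)
    then show ?thesis using False by (simp add: F_def)
  qed
  \<comment> \<open>Differences of measurable functions need not be measurable in a nonseparable space; here the second one
    takes only countably many values.\<close>
  have nm[measurable]: "(\<lambda>s. norm (F s - u i s)) \<in> borel_measurable M" for i
  proof -
    have "(\<lambda>s. (\<lambda>j s. norm (F s - v i j)) (k i s) s) \<in> borel_measurable borel"
    proof (rule measurable_compose_countable)
      show "(\<lambda>s. norm (F s - v i j)) \<in> borel_measurable borel" for j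
      proof -
        have "(\<lambda>x. norm (x - v i j)) \<in> borel_measurable borel"
          by (intro borel_measurable_continuous_onI continuous_intros)
        from measurable_compose[OF Fm this] show ?thesis .
      qed
    qed measurable
    then show ?thesis by (simp add: u_def)
  qed
  have I0: "(\<lambda>i. \<integral>\<^sup>+ s. ennreal (norm (F s - u i s)) \<partial>M) \<longlonglongrightarrow> (\<integral>\<^sup>+ s. 0 \<partial>M)"
  proof (rule nn_integral_dominated_convergence[where w = "\<lambda>_. ennreal (C + C)"])
    show "AE s in M. ennreal (norm (F s - u i s)) \<le> ennreal (C + C)" for i
      using FC uC by (intro AE_I2 ennreal_leI norm_triangle_le_diff add_mono)
    show "(\<integral>\<^sup>+ s. ennreal (C + C) \<partial>M) < \<infinity>"
      by (simp add: ennreal_mult_eq_top_iff less_top[symmetric] del: ennreal_plus)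
    show "AE s in M. (\<lambda>i. ennreal (norm (F s - u i s))) \<longlonglongrightarrow> 0"
      using tendsto_norm_zero[OF lim] by (intro AE_I2) (simp flip: ennreal_0 add: tendsto_ennrealI)
  qed measurable
  define e where "e i = (\<integral>\<^sup>+ s. ennreal (norm (F s - u i s)) \<partial>M)" for i
  have e0: "e \<longlonglongrightarrow> 0" using I0 unfolding e_def by simp
  have dist: "ennreal (norm (Bochner_Integration.simple_bochner_integral M (u i) - Bochner_Integration.simple_bochner_integral M (u j))) \<le> e i + e j" for i j
  proof -
    have "ennreal (norm (Bochner_Integration.simple_bochner_integral M (u i) - Bochner_Integration.simple_bochner_integral M (u j)))
      = ennreal (norm (Bochner_Integration.simple_bochner_integral M (\<lambda>s. u i s - u j s)))"
      by (simp add: simple_bochner_integral_diff ub)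
    also have "\<dots> \<le> ennreal (Bochner_Integration.simple_bochner_integral M (\<lambda>s. norm (u i s - u j s)))"
      using simple_bochner_integrable_compose2[of "\<lambda>x y. x - y", OF _ ub ub]
      by (intro ennreal_leI simple_bochner_integral_norm_bound) simp
    also have "\<dots> = (\<integral>\<^sup>+ s. norm (u i s - u j s) \<partial>M)"
      using simple_bochner_integrable_compose2[of "\<lambda>x y. norm (x - y)", OF _ ub ub]
      by (intro simple_bochner_integral_eq_nn_integral) auto
    also have "\<dots> \<le> (\<integral>\<^sup>+ s. ennreal (norm (F s - u i s)) + ennreal (norm (F s - u j s)) \<partial>M)"
    proof (intro nn_integral_mono)
      fix s
      have "norm (u i s - u j s) \<le> norm (F s - u i s) + norm (F s - u j s)"
        using norm_triangle_ineq4[of "F s - u j s" "F s - u i s"] by (simp add: algebra_simps)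
      then show "ennreal (norm (u i s - u j s)) \<le> ennreal (norm (F s - u i s)) + ennreal (norm (F s - u j s))"
        by (simp flip: ennreal_plus)
    qed
    also have "\<dots> = e i + e j" unfolding e_def by (intro nn_integral_add) measurable
    finally show ?thesis .
  qed
  have "Cauchy (\<lambda>i. Bochner_Integration.simple_bochner_integral M (u i))"
  proof (rule metric_CauchyI)
    fix r :: real assume r: "0 < r"
    have "\<forall>\<^sub>F i in sequentially. e i < ennreal (r / 2)"
      using e0 r by (intro order_tendstoD) auto
    then obtain N where N: "\<And>i. i \<ge> N \<Longrightarrow> e i < ennreal (r / 2)" by (auto simp: eventually_sequentially)
    show "\<exists>N. \<forall>m\<ge>N. \<forall>n\<ge>N. dist (Bochner_Integration.simple_bochner_integral M (u m)) (Bochner_Integration.simple_bochner_integral M (u n)) < r"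
    proof (intro exI[of _ N] allI impI)
      fix m n assume mn: "m \<ge> N" "n \<ge> N"
      have "ennreal (norm (Bochner_Integration.simple_bochner_integral M (u m) - Bochner_Integration.simple_bochner_integral M (u n))) < ennreal (r / 2) + ennreal (r / 2)"
        using dist[of m n] add_strict_mono[OF N[OF mn(1)] N[OF mn(2)]] by (rule le_less_trans)
      also have "\<dots> = ennreal r" using r by (simp flip: ennreal_plus)
      finally show "dist (Bochner_Integration.simple_bochner_integral M (u m)) (Bochner_Integration.simple_bochner_integral M (u n)) < r"
        using r by (simp add: dist_norm ennreal_less_iff)
    qed
  qed
  then obtain y where "(\<lambda>i. Bochner_Integration.simple_bochner_integral M (u i)) \<longlonglongrightarrow> y"
    using Cauchy_convergent_iff convergent_def by blast
  then have "has_strong_integral M F y"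
    unfolding has_strong_integral_def using ub e0 unfolding e_def by (auto intro!: exI[of _ u])
  then show ?thesis unfolding F_def[abs_def] by blast
qed

section \<open>Taylor series of completely monotone functions\<close>

text \<open>Bernstein's theorem on absolutely monotone functions: they are the sum of their Taylor series. For \<open>X < Y\<close>
  the integral remainders of order \<open>p\<close> satisfy \<open>r\<^sub>p(X) \<le> (X/Y)\<^sup>p r\<^sub>p(Y)\<close>, because the \<open>p\<close>-th derivative is
  increasing, and \<open>r\<^sub>p(Y) \<le> f(Y)\<close>, because all Taylor coefficients are nonnegative.\<close>

lemma abs_monotone_Taylor_sums:
  fixes f :: "nat \<Rightarrow> real \<Rightarrow> real"
  assumes D: "\<And>k u. 0 \<le> u \<Longrightarrow> u < c \<Longrightarrow> (f k has_real_derivative f (Suc k) u) (at u)"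
    and nn: "\<And>k u. 0 \<le> u \<Longrightarrow> u < c \<Longrightarrow> 0 \<le> f k u"
    and X: "0 \<le> X" "X < c"
  shows "(\<lambda>k. f k 0 * X ^ k / fact k) sums f 0 X"
proof -
  \<comment> \<open>Any point strictly between \<open>X\<close> and \<open>c\<close> would do.\<close>
  define Y where "Y = (X + c) / 2"
  have Y: "X < Y" "Y < c" "0 < Y" using X by (auto simp: Y_def)
  define r where "r Z p v = ((1 - v) ^ (p - 1) / fact (p - 1)) * (Z ^ p * f p (Z * v))" for Z v :: real and p
  have T: "f 0 Z = (\<Sum>i<p. f i 0 * Z ^ i / fact i) + integral {0..1} (r Z p)"
    and Ti: "r Z p integrable_on {0..1}" if Z: "0 \<le> Z" "Z < c" and p: "p > 0" for Z p
  proof -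
    have der: "((\<lambda>v. Z ^ m * f m (Z * v)) has_vector_derivative Z ^ Suc m * f (Suc m) (Z * v)) (at v within {0..1})"
      if "0 \<le> v" "v \<le> 1" for m v
    proof -
      have "Z * v \<le> Z * 1" using Z that by (intro mult_left_mono) auto
      then have "(f m has_real_derivative f (Suc m) (Z * v)) (at (Z * v))"
        using that Z by (intro D) auto
      then have "((\<lambda>v. f m (Z * v)) has_real_derivative f (Suc m) (Z * v) * Z) (at v within {0..1})"
        by (rule DERIV_chain'[where f = "\<lambda>v. Z * v", rotated, OF DERIV_subset, OF _ subset_UNIV])
          (auto intro!: derivative_eq_intros)
      then have "((\<lambda>v. Z ^ m * f m (Z * v)) has_real_derivative Z ^ Suc m * f (Suc m) (Z * v)) (at v within {0..1})"
        by (auto intro!: derivative_eq_intros)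
      then show ?thesis by (simp add: has_real_derivative_iff_has_vector_derivative)
    qed
    note TT = Taylor_integral[of p "\<lambda>m v. Z ^ m * f m (Z * v)" "\<lambda>v. f 0 (Z * v)" 0 1]
      Taylor_integrable[of p "\<lambda>m v. Z ^ m * f m (Z * v)" "\<lambda>v. f 0 (Z * v)" 0 1]
    have "f 0 (Z * 1) = (\<Sum>i<p. ((1 - 0) ^ i / fact i) *\<^sub>R (Z ^ i * f i (Z * 0))) + integral {0..1} (r Z p)"
      unfolding r_def using TT(1)[OF p] der by (simp add: fun_eq_iff)
    then show "f 0 Z = (\<Sum>i<p. f i 0 * Z ^ i / fact i) + integral {0..1} (r Z p)"
      by (simp add: algebra_simps)
    show "r Z p integrable_on {0..1}"
      unfolding r_def using TT(2)[OF p] der by (simp add: fun_eq_iff)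
  qed
  have mono: "f k u \<le> f k w" if "0 \<le> u" "u \<le> w" "w < c" for k u w
  proof (rule DERIV_nonneg_imp_nondecreasing[OF that(2)])
    fix x assume "u \<le> x" "x \<le> w"
    then show "\<exists>y. (f k has_real_derivative y) (at x) \<and> 0 \<le> y"
      using that by (intro exI[of _ "f (Suc k) x"] conjI D nn) auto
  qed
  have rX: "0 \<le> integral {0..1} (r X p)" "integral {0..1} (r X p) \<le> (X / Y) ^ p * f 0 Y" if p: "p > 0" for p
  proof -
    have le: "X * v < c" "Y * v < c" if "v \<in> {0..1}" for v
    proof -
      have "X * v \<le> X * 1" "Y * v \<le> Y * 1" using that X Y by (intro mult_left_mono; simp)+
      then show "X * v < c" "Y * v < c" using Y X by linarith+
    qed
    show "0 \<le> integral {0..1} (r X p)"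
    proof (rule integral_nonneg[OF Ti[OF X p]])
      fix v :: real assume v: "v \<in> {0..1}"
      then have "0 \<le> f p (X * v)" using X le[OF v] by (intro nn) auto
      then show "0 \<le> r X p v" using v X by (simp add: r_def)
    qed
    have "integral {0..1} (r X p) \<le> integral {0..1} (\<lambda>v. (X / Y) ^ p * r Y p v)"
    proof (rule integral_le)
      show "r X p integrable_on {0..1}" using Ti[OF X p] .
      show "(\<lambda>v. (X / Y) ^ p * r Y p v) integrable_on {0..1}"
        using Ti[OF _ Y(2) p] Y by (intro integrable_on_mult_right) auto
      fix v :: real assume v: "v \<in> {0..1}"
      have "f p (X * v) \<le> f p (Y * v)" using v X Y le[OF v] by (intro mono mult_right_mono) auto
      then have "((1 - v) ^ (p - 1) / fact (p - 1)) * X ^ p * f p (X * v) \<le> ((1 - v) ^ (p - 1) / fact (p - 1)) * X ^ p * f p (Y * v)"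
        using v X by (intro mult_left_mono) auto
      then show "r X p v \<le> (X / Y) ^ p * r Y p v"
        using Y by (simp add: r_def power_divide mult_ac)
    qed
    also have "\<dots> = (X / Y) ^ p * integral {0..1} (r Y p)" by simp
    also have "\<dots> \<le> (X / Y) ^ p * f 0 Y"
    proof (rule mult_left_mono)
      have "0 \<le> (\<Sum>i<p. f i 0 * Y ^ i / fact i)" using Y nn X by (intro sum_nonneg) auto
      then show "integral {0..1} (r Y p) \<le> f 0 Y" using T[OF _ Y(2) p] Y by simp
    qed (use X Y in auto)
    finally show "integral {0..1} (r X p) \<le> (X / Y) ^ p * f 0 Y" .
  qed
  have "(\<lambda>p. integral {0..1} (r X p)) \<longlonglongrightarrow> 0"
  proof (rule tendsto_sandwich)
    show "\<forall>\<^sub>F p in sequentially. 0 \<le> integral {0..1} (r X p)"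
      using eventually_gt_at_top[of 0] by eventually_elim (rule rX)
    show "\<forall>\<^sub>F p in sequentially. integral {0..1} (r X p) \<le> (X / Y) ^ p * f 0 Y"
      using eventually_gt_at_top[of 0] by eventually_elim (rule rX)
    show "(\<lambda>p. (X / Y) ^ p * f 0 Y) \<longlonglongrightarrow> 0"
      using X Y by (intro tendsto_mult_left_zero LIMSEQ_realpow_zero) auto
  qed simp
  then have "(\<lambda>p. f 0 X - integral {0..1} (r X p)) \<longlonglongrightarrow> f 0 X - 0" by (intro tendsto_intros)
  moreover have "\<forall>\<^sub>F p in sequentially. f 0 X - integral {0..1} (r X p) = (\<Sum>i<p. f i 0 * X ^ i / fact i)"
    using eventually_gt_at_top[of 0] by eventually_elim (use T[OF X] in auto)
  ultimately show ?thesis unfolding sums_def by (simp add: tendsto_cong)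
qed

lemma completely_monotone_DERIV:
  assumes "completely_monotone g" "z > 0"
  shows "((deriv ^^ k) g has_real_derivative (deriv ^^ Suc k) g z) (at z)"
    "0 \<le> (-1) ^ k * (deriv ^^ k) g z"
  using assms unfolding completely_monotone_def
  by (simp_all add: DERIV_deriv_iff_field_differentiable)

text \<open>The function \<open>u \<mapsto> g (a - u)\<close> is absolutely monotone on \<open>[0, a)\<close>.\<close>

lemma completely_monotone_Taylor_sums:
  assumes g: "completely_monotone g" and s: "0 \<le> s" "s < 1" and a: "0 < a"
  shows "(\<lambda>k. ((- a) ^ k * (deriv ^^ k) g a / fact k) * s ^ k) sums g (a * (1 - s))"
proof -
  define f where "f k u = (-1) ^ k * (deriv ^^ k) g (a - u)" for k u
  have "(\<lambda>k. f k 0 * (a * s) ^ k / fact k) sums f 0 (a * s)"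
  proof (rule abs_monotone_Taylor_sums[where c = a])
    fix k u assume u: "0 \<le> u" "u < a"
    have "((\<lambda>u. (deriv ^^ k) g (a - u)) has_real_derivative (deriv ^^ Suc k) g (a - u) * (- 1)) (at u)"
      by (rule DERIV_chain'[OF _ completely_monotone_DERIV(1)[OF g]])
        (use u in \<open>auto intro!: derivative_eq_intros\<close>)
    then show "(f k has_real_derivative f (Suc k) u) (at u)"
      unfolding f_def[abs_def] by (auto intro!: derivative_eq_intros)
    show "0 \<le> f k u" unfolding f_def using completely_monotone_DERIV(2)[OF g] u by simp
  qed (use s a in auto)
  then show ?thesis unfolding f_def
    by (simp add: power_mult_distrib power_minus[of a] algebra_simps)
qed

text \<open>Each derivative is monotone, so its one-sided limit at \<open>0\<close> exists in the extended reals and the definition by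
  \<open>Lim\<close> picks it.\<close>

lemma completely_monotone_tendsto_deriv_at_0:
  assumes g: "completely_monotone g"
  shows "((\<lambda>z. ereal ((deriv ^^ k) g z)) \<longlongrightarrow> deriv_at_0 k g) (at_right 0)"
proof -
  define \<phi> where "\<phi> z = ereal (- ((-1) ^ k * (deriv ^^ k) g z))" for z
  have "(\<phi> \<longlongrightarrow> Inf (\<phi> ` ({0<..} \<inter> UNIV))) (at 0 within ({0<..} \<inter> UNIV))"
  proof (rule Lim_right_bound)
    fix a b :: real assume ab: "0 < a" "a \<le> b"
    have "- ((-1) ^ k * (deriv ^^ k) g a) \<le> - ((-1) ^ k * (deriv ^^ k) g b)"
    proof (rule DERIV_nonneg_imp_nondecreasing[OF ab(2)])
      fix x assume "a \<le> x" "x \<le> b"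
      then have x: "0 < x" using ab by simp
      have "((\<lambda>z. - ((-1) ^ k * (deriv ^^ k) g z)) has_real_derivative (-1) ^ Suc k * (deriv ^^ Suc k) g x) (at x)"
        using completely_monotone_DERIV(1)[OF g x, of k] by (auto intro!: derivative_eq_intros)
      then show "\<exists>y. ((\<lambda>z. - ((-1) ^ k * (deriv ^^ k) g z)) has_real_derivative y) (at x) \<and> 0 \<le> y"
        using completely_monotone_DERIV(2)[OF g x, of "Suc k"] by blast
    qed
    then show "\<phi> a \<le> \<phi> b" by (simp add: \<phi>_def)
  next
    show "- \<infinity> \<le> \<phi> a" for a by simp
  qed
  then obtain L where L: "(\<phi> \<longlongrightarrow> L) (at_right 0)" by auto
  have "\<exists>L. ((\<lambda>z. ereal ((deriv ^^ k) g z)) \<longlongrightarrow> L) (at_right 0)"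
  proof (cases "even k")
    case True
    then have "(\<lambda>z. ereal ((deriv ^^ k) g z)) = (\<lambda>z. - \<phi> z)" by (simp add: \<phi>_def)
    then show ?thesis using L by (auto intro!: exI[of _ "- L"] tendsto_uminus_ereal)
  next
    case False
    then have "(\<lambda>z. ereal ((deriv ^^ k) g z)) = \<phi>" by (simp add: \<phi>_def fun_eq_iff)
    then show ?thesis using L by auto
  qed
  then show ?thesis unfolding deriv_at_0_def by (metis tendsto_Lim trivial_limit_at_right_real)
qed

lemma completely_monotone_antimono:
  assumes g: "completely_monotone g" and ab: "0 < a" "a \<le> b"
  shows "g b \<le> g a"
proof (rule DERIV_nonpos_imp_nonincreasing[OF ab(2)])
  fix x assume "a \<le> x" "x \<le> b"
  then show "\<exists>y. (g has_real_derivative y) (at x) \<and> y \<le> 0"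
    using completely_monotone_DERIV(1)[OF g, of x 0] completely_monotone_DERIV(2)[OF g, of x 1] ab
    by (intro exI[of _ "deriv g x"]) auto
qed

lemma completely_monotone_le_limit:
  assumes g: "completely_monotone g" and lim: "(g \<longlongrightarrow> L) (at_right 0)" and z: "0 < z"
  shows "g z \<le> L"
proof (rule tendsto_lowerbound[OF lim])
  show "\<forall>\<^sub>F x in at_right 0. g z \<le> g x"
    unfolding eventually_at_right_field
    using z completely_monotone_antimono[OF g] by (intro exI[of _ z]) auto
qed simp

text \<open>The Taylor coefficients of \<open>g\<close> at \<open>a\<close>, rescaled, are nonnegative, and they sum to \<open>g(0) = 1\<close>. Thus
  \<open>g (a (1 - s))\<close> is the generating function of a probability distribution on the naturals.\<close>

lemma completely_monotone_pmf:
  assumes g: "completely_monotone g" and lim: "(g \<longlongrightarrow> 1) (at_right 0)" and a: "0 < a"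
  obtains p :: "nat pmf" where "\<And>s. 0 \<le> s \<Longrightarrow> s < 1 \<Longrightarrow> (\<integral>k. s ^ k \<partial>measure_pmf p) = g (a * (1 - s))"
proof -
  define q where "q k = (- a) ^ k * (deriv ^^ k) g a / fact k" for k
  have q0: "0 \<le> q k" for k
  proof -
    have "q k = a ^ k * ((-1) ^ k * (deriv ^^ k) g a) / fact k" unfolding q_def by (simp add: power_minus[of a])
    then show ?thesis using completely_monotone_DERIV(2)[OF g a] a by simp
  qed
  have S: "(\<lambda>k. q k * s ^ k) sums g (a * (1 - s))" if "0 \<le> s" "s < 1" for s
    unfolding q_def by (rule completely_monotone_Taylor_sums[OF g that a])
  have part: "(\<Sum>k<n. q k) \<le> 1" for n
  proof (rule tendsto_upperbound)
    show "((\<lambda>s. \<Sum>k<n. q k * s ^ k) \<longlongrightarrow> (\<Sum>k<n. q k)) (at_left 1)"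
      by (auto intro!: tendsto_eq_intros)
    have "(\<Sum>k<n. q k * s ^ k) \<le> 1" if "0 \<le> s" "s < 1" for s
    proof -
      have "(\<Sum>k<n. q k * s ^ k) \<le> g (a * (1 - s))"
        using S[OF that] q0 that by (intro sum_le_suminf[THEN order_trans]) (auto simp: sums_iff)
      also have "\<dots> \<le> 1" using completely_monotone_le_limit[OF g lim] a that by simp
      finally show ?thesis .
    qed
    then show "\<forall>\<^sub>F s in at_left 1. (\<Sum>k<n. q k * s ^ k) \<le> 1"
      unfolding eventually_at_left_field by (intro exI[of _ 0]) auto
  qed simp
  have sq: "summable q" using part q0 by (intro summableI_nonneg_bounded[where x = 1]) auto
  have "suminf q = 1"
  proof (rule antisym)
    show "suminf q \<le> 1" using part by (intro suminf_le_const[OF sq]) auto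
    show "1 \<le> suminf q"
    proof (rule tendsto_upperbound)
      show "((\<lambda>s. g (a * (1 - s))) \<longlongrightarrow> 1) (at_left 1)"
      proof (rule filterlim_compose[OF lim])
        show "filterlim (\<lambda>s. a * (1 - s)) (at_right 0) (at_left 1)"
          unfolding filterlim_at using a
          by (auto intro!: tendsto_eq_intros simp: eventually_at_left_field intro!: exI[of _ 0])
      qed
      have "g (a * (1 - s)) \<le> suminf q" if "0 \<le> s" "s < 1" for s
      proof -
        have "q k * s ^ k \<le> q k" for k
          using q0[of k] that by (simp add: mult_left_le power_le_one)
        moreover have "summable (\<lambda>k. q k * s ^ k)" using S[OF that] by (simp add: sums_iff)
        ultimately have "(\<Sum>k. q k * s ^ k) \<le> suminf q" using sq by (intro suminf_le) auto
        then show ?thesis using S[OF that] by (simp add: sums_iff)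
      qed
      then show "\<forall>\<^sub>F s in at_left 1. g (a * (1 - s)) \<le> suminf q"
        unfolding eventually_at_left_field by (intro exI[of _ 0]) auto
    qed simp
  qed
  then have one: "(\<integral>\<^sup>+ k. ennreal (q k) \<partial>count_space UNIV) = 1"
    by (simp add: nn_integral_count_space_nat suminf_ennreal2[OF q0 sq])
  show ?thesis
  proof (rule that[of "embed_pmf q"])
    fix s :: real assume s: "0 \<le> s" "s < 1"
    have pq: "pmf (embed_pmf q) k = q k" for k by (rule pmf_embed_pmf[OF q0 one])
    have "integrable (measure_pmf (embed_pmf q)) (\<lambda>k. s ^ k)"
      using s by (intro measure_pmf.integrable_const_bound[where B = 1]) (auto simp: power_le_one)
    then have int: "integrable (count_space UNIV) (\<lambda>k. pmf (embed_pmf q) k *\<^sub>R s ^ k)"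
      unfolding measure_pmf_eq_density by (subst (asm) integrable_density) (auto simp: pq q0)
    have "(\<integral>k. s ^ k \<partial>measure_pmf (embed_pmf q)) = (\<integral>k. q k * s ^ k \<partial>count_space UNIV)"
      unfolding measure_pmf_eq_density by (subst integral_density) (auto simp: pq q0)
    also have "\<dots> = (\<Sum>k. q k * s ^ k)"
      using int unfolding pq by (intro integral_count_space_nat) simp
    also have "\<dots> = g (a * (1 - s))" using S[OF s] by (simp add: sums_iff)
    finally show "(\<integral>k. s ^ k \<partial>measure_pmf (embed_pmf q)) = g (a * (1 - s))" .
  qed
qed

section \<open>Bernstein's theorem\<close>

text \<open>With \<open>s = exp (- z/a)\<close> the generating function becomes the Laplace transform
  \<open>g (a (1 - exp (- z/a)))\<close> of a distribution on the multiples of \<open>1/a\<close>, and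
  \<open>a (1 - exp (- z/a))\<close> tends to \<open>z\<close>. Tightness is a Markov inequality for \<open>1 - exp (- s/K)\<close> together with
  \<open>g(0) = 1\<close>. The truncation by \<open>max 0\<close> makes the test function bounded on the whole line.\<close>

lemma bernstein_weak_limit:
  assumes g: "completely_monotone g" and lim: "(g \<longlongrightarrow> 1) (at_right 0)"
  obtains M :: "real measure" where "real_distribution M"
    "\<And>z. z > 0 \<Longrightarrow> (\<integral>s. exp (- (z * max 0 s)) \<partial>M) = g z"
proof -
  define a where "a n = real (Suc n)" for n
  have a0: "0 < a n" for n by (simp add: a_def)
  have "\<exists>p::nat pmf. \<forall>s. 0 \<le> s \<longrightarrow> s < 1 \<longrightarrow> (\<integral>k. s ^ k \<partial>measure_pmf p) = g (a n * (1 - s))" for n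
    using completely_monotone_pmf[OF g lim a0[of n]] by metis
  then obtain p :: "nat \<Rightarrow> nat pmf" where
    p: "\<And>n s. 0 \<le> s \<Longrightarrow> s < 1 \<Longrightarrow> (\<integral>k. s ^ k \<partial>measure_pmf (p n)) = g (a n * (1 - s))" by metis
  define \<mu> where "\<mu> n = distr (measure_pmf (p n)) borel (\<lambda>k. real k / a n)" for n
  have rd: "real_distribution (\<mu> n)" for n
    unfolding \<mu>_def by (intro prob_space.real_distribution_distr measure_pmf.prob_space_axioms) simp
  have Lap: "(\<integral>s. exp (- (z * max 0 s)) \<partial>\<mu> n) = g (a n * (1 - exp (- z / a n)))" if "z > 0" for z n
  proof -
    have "(\<integral>s. exp (- (z * max 0 s)) \<partial>\<mu> n) = (\<integral>k. exp (- (z * max 0 (real k / a n))) \<partial>measure_pmf (p n))"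
      unfolding \<mu>_def by (subst integral_distr) auto
    also have "\<dots> = (\<integral>k. exp (- z / a n) ^ k \<partial>measure_pmf (p n))"
      using a0[of n] by (intro Bochner_Integration.integral_cong refl)
        (simp add: exp_of_nat_mult[symmetric] max_def field_simps)
    also have "\<dots> = g (a n * (1 - exp (- z / a n)))" using that a0[of n] by (intro p) auto
    finally show ?thesis .
  qed
  have "tight \<mu>"
    unfolding tight_def
  proof (intro conjI allI impI rd)
    fix \<epsilon> :: real assume e: "\<epsilon> > 0"
    have "\<forall>\<^sub>F x in at_right 0. 1 - \<epsilon> / 2 < g x" using lim e by (intro order_tendstoD) auto
    then obtain b where b: "b > 0" "\<And>x. 0 < x \<Longrightarrow> x < b \<Longrightarrow> 1 - \<epsilon> / 2 < g x"
      unfolding eventually_at_right_field by auto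
    define K where "K = 2 / b"
    have K: "K > 0" "1 / K < b" using b by (auto simp: K_def)
    show "\<exists>a b. a < b \<and> (\<forall>n. 1 - \<epsilon> < measure (\<mu> n) {a<..b})"
    proof (rule exI[of _ "-1"], rule exI[of _ K], intro conjI allI)
      show "-1 < K" using K by simp
      fix n
      interpret m: real_distribution "\<mu> n" by (rule rd)
      \<comment> \<open>So \<open>1 - exp (- s/K) \<ge> 1/2\<close> for \<open>s > K\<close>.\<close>
      have e2: "exp (- 1) \<le> (1/2 :: real)"
        using exp_ge_add_one_self[of 1] by (simp add: exp_minus field_simps)
      have neg: "measure (\<mu> n) {..-1} = 0"
      proof -
        have "(\<lambda>k. real k / a n) -` {..-1} = {}"
          using a0[of n] by (auto simp: field_simps)
        then show ?thesis unfolding \<mu>_def by (simp add: measure_distr)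
      qed
      have "g (1 / K) \<le> g (a n * (1 - exp (- (1 / K) / a n)))"
      proof (rule completely_monotone_antimono[OF g])
        show "0 < a n * (1 - exp (- (1 / K) / a n))" using a0[of n] K by simp
        have "1 + (- (1 / K) / a n) \<le> exp (- (1 / K) / a n)" by (rule exp_ge_add_one_self)
        then have "a n * (1 - exp (- (1 / K) / a n)) \<le> a n * ((1 / K) / a n)"
          using a0[of n] by (intro mult_left_mono) auto
        then show "a n * (1 - exp (- (1 / K) / a n)) \<le> 1 / K" using a0[of n] by simp
      qed
      then have gK: "1 - \<epsilon> / 2 < (\<integral>s. exp (- (1 / K * max 0 s)) \<partial>\<mu> n)"
        using b(2)[of "1 / K"] K Lap[of "1 / K" n] by simp
      have "(\<integral>s. exp (- (1 / K * max 0 s)) \<partial>\<mu> n) \<le> (\<integral>s. 1 - (1 / 2 :: real) * indicator {K<..} s \<partial>\<mu> n)"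
      proof (rule integral_mono)
        show "integrable (\<mu> n) (\<lambda>s. exp (- (1 / K * max 0 s)))"
          using K by (intro m.integrable_const_bound[where B = 1]) (auto simp: mult_nonneg_nonneg)
        show "integrable (\<mu> n) (\<lambda>s. 1 - (1 / 2 :: real) * indicator {K<..} s)"
          by (intro m.integrable_const_bound[where B = 1]) (auto simp: indicator_def)
        fix s
        have "exp (- (1 / K * max 0 s)) \<le> 1 / 2" if "s > K"
        proof -
          have "1 \<le> 1 / K * max 0 s" using that K by (simp add: field_simps)
          then have "exp (- (1 / K * max 0 s)) \<le> exp (- 1)" by simp
          then show ?thesis using e2 by linarith
        qed
        then show "exp (- (1 / K * max 0 s)) \<le> 1 - (1 / 2 :: real) * indicator {K<..} s"
          using K by (auto simp: indicator_def mult_nonneg_nonneg)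
      qed
      also have "\<dots> = 1 - (1 / 2) * measure (\<mu> n) {K<..}"
      proof -
        have "integrable (\<mu> n) (\<lambda>s. (1 / 2 :: real) * indicator {K<..} s)"
          by (intro m.integrable_const_bound[where B = 1]) (auto simp: indicator_def)
        then show ?thesis using m.prob_space by (subst Bochner_Integration.integral_diff) simp_all
      qed
      finally have "measure (\<mu> n) {K<..} < \<epsilon>" using gK by simp
      moreover have "measure (\<mu> n) ({..-1} \<union> {-1<..K} \<union> {K<..}) \<le> measure (\<mu> n) {..-1} + measure (\<mu> n) {-1<..K} + measure (\<mu> n) {K<..}"
        by (intro order_trans[OF measure_Un_le] add_right_mono measure_Un_le) auto
      moreover have "{..-1} \<union> {-1<..K} \<union> {K<..} = (UNIV :: real set)" using K by auto
      ultimately show "1 - \<epsilon> < measure (\<mu> n) {-1<..K}" using neg m.prob_space m.space_eq_univ by auto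
    qed
  qed
  from tight_imp_convergent_subsubsequence[OF this strict_mono_id]
  obtain r M where r: "strict_mono (r :: nat \<Rightarrow> nat)" and M: "real_distribution M"
    and w: "weak_conv_m (\<mu> \<circ> r) M" by auto
  show ?thesis
  proof (rule that[OF M])
    fix z :: real assume z: "z > 0"
    have "(\<lambda>n. \<integral>s. exp (- (z * max 0 s)) \<partial>(\<mu> \<circ> r) n) \<longlonglongrightarrow> (\<integral>s. exp (- (z * max 0 s)) \<partial>M)"
      using z by (intro weak_conv_imp_integral_bdd_continuous_conv[OF _ M w, where B = 1])
        (auto simp: rd mult_nonneg_nonneg intro!: continuous_intros)
    then have "(\<lambda>n. g (a (r n) * (1 - exp (- z / a (r n))))) \<longlonglongrightarrow> (\<integral>s. exp (- (z * max 0 s)) \<partial>M)"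
      using Lap[OF z] by simp
    moreover have "(\<lambda>n. g (a (r n) * (1 - exp (- z / a (r n))))) \<longlonglongrightarrow> g z"
    proof (rule isCont_tendsto_compose[of z g])
      show "isCont g z" using completely_monotone_DERIV(1)[OF g z, of 0] DERIV_isCont by auto
      have "(\<lambda>n. a n * (1 - exp (- z / a n))) \<longlonglongrightarrow> z" unfolding a_def by real_asymp
      from LIMSEQ_subseq_LIMSEQ[OF this r]
      show "(\<lambda>n. a (r n) * (1 - exp (- z / a (r n)))) \<longlonglongrightarrow> z" by (simp add: comp_def)
    qed
    ultimately show "(\<integral>s. exp (- (z * max 0 s)) \<partial>M) = g z" by (rule LIMSEQ_unique)
  qed
qed

definition laplace_represents :: "real measure \<Rightarrow> (real \<Rightarrow> real) \<Rightarrow> bool" where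
  "laplace_represents \<nu> g \<longleftrightarrow> sets \<nu> = sets borel \<and> emeasure \<nu> {..<0} = 0 \<and>
     (\<forall>z>0. (\<integral>\<^sup>+s. ennreal (exp (- (z * s))) \<partial>\<nu>) = ennreal (g z))"

lemma laplace_represents_AE:
  assumes "laplace_represents \<nu> g"
  shows "AE s in \<nu>. 0 \<le> s"
proof -
  have s: "sets \<nu> = sets borel" "emeasure \<nu> {..<0} = 0" using assms by (auto simp: laplace_represents_def)
  show ?thesis
    by (rule AE_I[of _ _ "{..<0}"]) (use s sets_eq_imp_space_eq[OF s(1)] in auto)
qed

text \<open>The total mass is the limit of the Laplace transform at \<open>0\<close>, by monotone convergence.\<close>

lemma laplace_represents_prob_space:
  assumes R: "laplace_represents \<nu> g" and lim: "(g \<longlongrightarrow> 1) (at_right 0)"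
  shows "prob_space \<nu>"
proof
  have s[measurable_cong]: "sets \<nu> = sets borel" and
    L: "\<And>z. z > 0 \<Longrightarrow> (\<integral>\<^sup>+s. ennreal (exp (- (z * s))) \<partial>\<nu>) = ennreal (g z)"
    using R by (auto simp: laplace_represents_def)
  define e where "e n s = ennreal (exp (- (1 / real (Suc n) * s)))" for n s
  note AE0 = laplace_represents_AE[OF R]
  have inc: "e n s \<le> e m s" if "0 \<le> s" "n \<le> m" for s n m
    using that unfolding e_def by (intro ennreal_leI) (auto simp: field_simps intro!: mult_left_mono)
  have "(\<integral>\<^sup>+s. (SUP n. e n s) \<partial>\<nu>) = (SUP n. \<integral>\<^sup>+s. e n s \<partial>\<nu>)"
  proof (rule nn_integral_monotone_convergence_SUP_AE)
    show "AE s in \<nu>. e n s \<le> e (Suc n) s" for n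
      using AE0 by eventually_elim (rule inc, auto)
  qed (simp add: e_def)
  also have "(\<integral>\<^sup>+s. (SUP n. e n s) \<partial>\<nu>) = (\<integral>\<^sup>+s. 1 \<partial>\<nu>)"
  proof (rule nn_integral_cong_AE, use AE0 in eventually_elim)
    fix s :: real assume "0 \<le> s"
    then have "incseq (\<lambda>n. e n s)" by (intro incseq_SucI inc) auto
    then have "(\<lambda>n. e n s) \<longlonglongrightarrow> (SUP n. e n s)" by (rule LIMSEQ_SUP)
    moreover have "(\<lambda>n. e n s) \<longlonglongrightarrow> ennreal 1"
      unfolding e_def by (intro tendsto_ennrealI) real_asymp
    ultimately show "(SUP n. e n s) = 1" using LIMSEQ_unique by fastforce
  qed
  also have "\<dots> = emeasure \<nu> (space \<nu>)" by simp
  also have "(SUP n. \<integral>\<^sup>+s. e n s \<partial>\<nu>) = 1"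
  proof -
    have i: "(\<integral>\<^sup>+s. e n s \<partial>\<nu>) = ennreal (g (1 / real (Suc n)))" for n
      unfolding e_def by (rule L) simp
    have "incseq (\<lambda>n. \<integral>\<^sup>+s. e n s \<partial>\<nu>)"
      by (intro incseq_SucI nn_integral_mono_AE, use AE0 in eventually_elim) (auto intro: inc)
    then have "(\<lambda>n. \<integral>\<^sup>+s. e n s \<partial>\<nu>) \<longlonglongrightarrow> (SUP n. \<integral>\<^sup>+s. e n s \<partial>\<nu>)" by (rule LIMSEQ_SUP)
    moreover have "(\<lambda>n. \<integral>\<^sup>+s. e n s \<partial>\<nu>) \<longlonglongrightarrow> ennreal 1"
      unfolding i
    proof (intro tendsto_ennrealI filterlim_compose[OF lim])
      show "LIM n sequentially. 1 / real (Suc n) :> at_right 0" by real_asymp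
    qed
    ultimately show ?thesis using LIMSEQ_unique by fastforce
  qed
  finally show "emeasure \<nu> (space \<nu>) = 1" .
qed

lemma laplace_represents_integral:
  assumes R: "laplace_represents \<nu> g" and lim: "(g \<longlongrightarrow> 1) (at_right 0)" and z: "z > 0" "0 \<le> g z"
  shows "integrable \<nu> (\<lambda>s. exp (- (z * s)))" "(\<integral>s. exp (- (z * s)) \<partial>\<nu>) = g z"
proof -
  have s[measurable_cong]: "sets \<nu> = sets borel" and
    L: "(\<integral>\<^sup>+s. ennreal (exp (- (z * s))) \<partial>\<nu>) = ennreal (g z)"
    using R z by (auto simp: laplace_represents_def)
  show "integrable \<nu> (\<lambda>s. exp (- (z * s)))" by (rule integrableI_nonneg) (use L in auto)
  show "(\<integral>s. exp (- (z * s)) \<partial>\<nu>) = g z"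
    by (rule integral_eq_nn_integral[THEN trans]) (use L z in auto)
qed

text \<open>Push the measure forward under \<open>s \<mapsto> exp (- s)\<close>. The result lives on \<open>[0,1]\<close> and its moments are the values
  of \<open>g\<close> at the naturals, so its characteristic function, and hence the measure, is determined.\<close>

lemma laplace_represents_unique:
  assumes R: "laplace_represents \<nu> g" and R': "laplace_represents \<nu>' g"
    and lim: "(g \<longlongrightarrow> 1) (at_right 0)" and nn: "\<And>z. z > 0 \<Longrightarrow> 0 \<le> g z"
  shows "\<nu> = \<nu>'"
proof -
  \<comment> \<open>The moment of order \<open>0\<close> is the limit of \<open>g\<close> at \<open>0\<close>, not its value.\<close>
  define m where "m k = (if k = 0 then 1 else g (real k))" for k :: nat
  define N where "N \<nu> = distr \<nu> borel (\<lambda>s::real. exp (- s))" for \<nu>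
  have rd: "real_distribution (N \<nu>)"
    and ch: "(\<lambda>n. \<Sum>k\<le>n. ((\<i> * t) ^ k / fact k) * m k) \<longlonglongrightarrow> char (N \<nu>) t"
    and recover: "distr (N \<nu>) borel (\<lambda>u. - ln u) = \<nu>"
    if R: "laplace_represents \<nu> g" for \<nu> t
  proof -
    have s[measurable_cong]: "sets \<nu> = sets borel" using R by (auto simp: laplace_represents_def)
    interpret prob_space \<nu> by (rule laplace_represents_prob_space[OF R lim])
    show "real_distribution (N \<nu>)" unfolding N_def by (intro real_distribution_distr) measurable
    then interpret N: real_distribution "N \<nu>" .
    note AE0 = laplace_represents_AE[OF R]
    have AE1: "AE u in N \<nu>. 0 \<le> u \<and> u \<le> 1"
      unfolding N_def by (subst AE_distr_iff) (use AE0 in auto)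
    have int: "integrable (N \<nu>) (\<lambda>x. x ^ k)" for k
    proof (rule N.integrable_const_bound[where B = 1])
      show "AE x in N \<nu>. norm (x ^ k) \<le> 1"
        using AE1 by eventually_elim (simp add: power_le_one power_abs)
    qed simp
    have mom: "N.expectation (\<lambda>x. x ^ k) = m k" for k
    proof (cases "k = 0")
      case True
      then show ?thesis using N.prob_space by (simp add: m_def)
    next
      case False
      have "N.expectation (\<lambda>x. x ^ k) = (\<integral>s. exp (- s) ^ k \<partial>\<nu>)"
        unfolding N_def by (subst integral_distr) auto
      also have "\<dots> = (\<integral>s. exp (- (real k * s)) \<partial>\<nu>)"
        by (simp add: exp_of_nat_mult[symmetric])
      also have "\<dots> = g (real k)" using False nn by (intro laplace_represents_integral[OF R lim]) auto
      finally show ?thesis using False by (simp add: m_def)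
    qed
    have abs1: "N.expectation (\<lambda>x. \<bar>x\<bar> ^ n) \<le> 1" for n
    proof -
      have "N.expectation (\<lambda>x. \<bar>x\<bar> ^ n) \<le> N.expectation (\<lambda>x. 1)"
      proof (rule integral_mono_AE)
        show "integrable (N \<nu>) (\<lambda>x. \<bar>x\<bar> ^ n)"
          using integrable_abs[OF int[of n]] by (simp add: power_abs)
        show "AE x in N \<nu>. \<bar>x\<bar> ^ n \<le> 1"
          using AE1 by eventually_elim (simp add: power_le_one)
      qed simp
      then show ?thesis using N.prob_space by simp
    qed
    show "(\<lambda>n. \<Sum>k\<le>n. ((\<i> * t) ^ k / fact k) * m k) \<longlonglongrightarrow> char (N \<nu>) t"
    proof (rule LIM_zero_cancel, rule tendsto_0_le[where K = 1])
      show "(\<lambda>n. 2 * (\<bar>t\<bar> ^ n / fact n)) \<longlonglongrightarrow> 0"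
        using summable_LIMSEQ_zero[OF summable_exp[of "\<bar>t\<bar>"]]
        by (intro tendsto_mult_right_zero) (simp add: field_simps)
      have "cmod ((\<Sum>k\<le>n. ((\<i> * t) ^ k / fact k) * m k) - char (N \<nu>) t) \<le> 2 * (\<bar>t\<bar> ^ n / fact n)" for n
      proof -
        have "cmod (char (N \<nu>) t - (\<Sum>k\<le>n. ((\<i> * t) ^ k / fact k) * m k))
            \<le> (2 * \<bar>t\<bar> ^ n / fact n) * N.expectation (\<lambda>x. \<bar>x\<bar> ^ n)"
          using N.char_approx1[of n t, OF int] unfolding mom .
        also have "\<dots> \<le> (2 * \<bar>t\<bar> ^ n / fact n) * 1" by (intro mult_left_mono abs1) auto
        finally show ?thesis by (simp add: norm_minus_commute)
      qed
      then show "\<forall>\<^sub>F n in sequentially. norm ((\<Sum>k\<le>n. ((\<i> * t) ^ k / fact k) * m k) - char (N \<nu>) t)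
          \<le> norm (2 * (\<bar>t\<bar> ^ n / fact n)) * 1"
        by (intro always_eventually allI) simp
    qed
    have "distr (N \<nu>) borel (\<lambda>u. - ln u) = distr \<nu> borel (\<lambda>s. s)"
      unfolding N_def by (subst distr_distr) (auto simp: comp_def)
    also have "\<dots> = \<nu>" by (rule distr_id2) (use s in simp)
    finally show "distr (N \<nu>) borel (\<lambda>u. - ln u) = \<nu>" .
  qed
  have "char (N \<nu>) = char (N \<nu>')"
    using LIMSEQ_unique[OF ch[OF R] ch[OF R']] by auto
  then have "N \<nu> = N \<nu>'" using Levy_uniqueness rd R R' by blast
  then show ?thesis using recover[OF R] recover[OF R'] by metis
qed

lemma bernstein_measure_eq:
  assumes R: "laplace_represents \<nu> g"
    and lim: "(g \<longlongrightarrow> 1) (at_right 0)" and nn: "\<And>z. z > 0 \<Longrightarrow> 0 \<le> g z"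
  shows "bernstein_measure g = \<nu>"
  unfolding bernstein_measure_def laplace_represents_def[symmetric]
  using R laplace_represents_unique[OF _ R lim nn] by (rule the_equality)

lemma bernstein_representation:
  assumes g: "completely_monotone g" and lim: "(g \<longlongrightarrow> 1) (at_right 0)"
  obtains \<nu> where "laplace_represents \<nu> g"
proof -
  obtain M where M: "real_distribution M" and L: "\<And>z. z > 0 \<Longrightarrow> (\<integral>s. exp (- (z * max 0 s)) \<partial>M) = g z"
    using bernstein_weak_limit[OF g lim] by metis
  interpret M: real_distribution M by fact
  have "(\<integral>\<^sup>+s. ennreal (exp (- (z * max 0 s))) \<partial>M) = ennreal (g z)" if "z > 0" for z
  proof -
    have "integrable M (\<lambda>s. exp (- (z * max 0 s)))"
      using that by (intro M.integrable_const_bound[where B = 1]) (auto simp: mult_nonneg_nonneg)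
    then show ?thesis using L[OF that] by (subst nn_integral_eq_integral) auto
  qed
  moreover have "(max 0) -` {..<0} = ({} :: real set)" by auto
  ultimately show ?thesis
    by (intro that[of "distr M borel (max 0)"])
      (auto simp: laplace_represents_def nn_integral_distr emeasure_distr)
qed

section \<open>Moments and convolution powers of representing measures\<close>

lemma completely_monotone_deriv2:
  assumes "completely_monotone g"
  shows "completely_monotone ((deriv ^^ 2) g)"
proof -
  have "(deriv ^^ k) ((deriv ^^ 2) g) = (deriv ^^ (k + 2)) g" for k by (simp only: funpow_add comp_apply)
  then show ?thesis
    using assms unfolding completely_monotone_def
    by (metis (no_types, lifting) mult.right_neutral one_power2 power_add power2_minus)
qed

text \<open>Difference quotients of \<open>g\<close> are integrals of functions that converge to \<open>s\<close> and \<open>s\<^sup>2\<close>. The mean value theorem bounds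
  the second ones by \<open>g''(0)\<close>, and Fatou's lemma gives the second moment. It then supplies the
  integrable majorant for the first moment, where the quotients equal \<open>- g'\<close> at points tending to \<open>0\<close>. All
  quotients use arguments \<open>h, 2h, 3h\<close> with \<open>h > 0\<close>, so that only values and derivatives inside the half-line occur.\<close>

lemma laplace_represents_moments:
  assumes g: "completely_monotone g" and d0: "deriv_at_0 0 g = 1" and d1: "deriv_at_0 1 g = -1"
    and d2: "deriv_at_0 2 g < \<infinity>" and R: "laplace_represents \<nu> g"
  shows "integrable \<nu> (\<lambda>s. s\<^sup>2)" "(\<integral>s. s\<^sup>2 \<partial>\<nu>) \<le> real_of_ereal (deriv_at_0 2 g)"
    "integrable \<nu> (\<lambda>s. s)" "(\<integral>s. s \<partial>\<nu>) = 1"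
proof -
  define S where "S = real_of_ereal (deriv_at_0 2 g)"
  have lim0: "(g \<longlongrightarrow> 1) (at_right 0)"
    using completely_monotone_tendsto_deriv_at_0[OF g, of 0] d0 by (simp add: one_ereal_def)
  have lim1: "(deriv g \<longlongrightarrow> -1) (at_right 0)"
    using completely_monotone_tendsto_deriv_at_0[OF g, of 1] d1 by (simp add: one_ereal_def)
  note lim2 = completely_monotone_tendsto_deriv_at_0[OF g, of 2]
  note D = completely_monotone_DERIV(1)[OF g]
  have "0 \<le> deriv_at_0 2 g"
  proof (rule tendsto_lowerbound[OF lim2])
    show "\<forall>\<^sub>F x in at_right 0. 0 \<le> ereal ((deriv ^^ 2) g x)"
      using completely_monotone_DERIV(2)[OF g, of _ 2]
      by (auto simp: eventually_at_right_field intro!: exI[of _ 1])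
  qed simp
  then have S: "deriv_at_0 2 g = ereal S" unfolding S_def using d2 by (cases "deriv_at_0 2 g") auto
  have S0: "0 \<le> S" using \<open>0 \<le> deriv_at_0 2 g\<close> S by simp
  have "((deriv ^^ 2) g \<longlongrightarrow> S) (at_right 0)" using lim2 unfolding S by simp
  then have le_S: "(deriv ^^ 2) g z \<le> S" if "z > 0" for z
    using completely_monotone_le_limit[OF completely_monotone_deriv2[OF g]] that by blast
  interpret prob_space \<nu> by (rule laplace_represents_prob_space[OF R lim0])
  have s[measurable_cong]: "sets \<nu> = sets borel" using R by (auto simp: laplace_represents_def)
  note AE0 = laplace_represents_AE[OF R]
  have nn: "0 \<le> g z" if "z > 0" for z using completely_monotone_DERIV(2)[OF g that, of 0] by simp
  note I = laplace_represents_integral[OF R lim0 _ nn]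
  define h where "h n = 1 / real (Suc n)" for n
  have h0: "0 < h n" for n by (simp add: h_def)
  define f where "f n s = exp (- (h n * s)) * ((1 - exp (- (h n * s))) / h n)\<^sup>2" for n s
  have f_eq: "f n s = (exp (- (h n * s)) - 2 * exp (- (2 * h n * s)) + exp (- (3 * h n * s))) / (h n)\<^sup>2" for n s
  proof -
    define e where "e = exp (- (h n * s))"
    have "exp (- (2 * h n * s)) = e ^ 2" "exp (- (3 * h n * s)) = e ^ 3"
      unfolding e_def by (simp_all add: exp_of_nat_mult[symmetric] mult_ac)
    then show ?thesis unfolding f_def e_def[symmetric]
      by (simp add: power_divide power2_eq_square power3_eq_cube field_simps)
  qed
  have int_f: "integrable \<nu> (f n)" for n
    unfolding f_eq using I(1)[of "h n"] I(1)[of "2 * h n"] I(1)[of "3 * h n"] h0[of n]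
    by (intro integrable_divide Bochner_Integration.integrable_add Bochner_Integration.integrable_diff integrable_mult_right) auto
  have If: "(\<integral>s. f n s \<partial>\<nu>) \<le> S" for n
  proof -
    have "(\<integral>s. f n s \<partial>\<nu>) = (g (h n) - 2 * g (2 * h n) + g (3 * h n)) / (h n)\<^sup>2"
      unfolding f_eq using I[of "h n"] I[of "2 * h n"] I[of "3 * h n"] h0[of n] by simp
    moreover have "g (h n) - 2 * g (2 * h n) + g (3 * h n) \<le> S * (h n)\<^sup>2"
    proof -
      have Dg: "(g has_real_derivative deriv g x) (at x)" "(deriv g has_real_derivative (deriv ^^ 2) g x) (at x)"
        if "x > 0" for x
        using D[OF that, of 0] D[OF that, of 1] by (simp_all add: numeral_2_eq_2)
      \<comment> \<open>A second difference is the first difference of \<open>x \<mapsto> g (x + h) - g x\<close>.\<close>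
      have "\<exists>z>h n. z < 2 * h n \<and> (g (2 * h n + h n) - g (2 * h n)) - (g (h n + h n) - g (h n))
          = (2 * h n - h n) * (deriv g (z + h n) - deriv g z)"
      proof (rule MVT2)
        show "h n < 2 * h n" using h0[of n] by simp
        fix x assume x: "h n \<le> x" "x \<le> 2 * h n"
        then have "x > 0" "x + h n > 0" using h0[of n] by auto
        have "((\<lambda>x. g (x + h n)) has_real_derivative deriv g (x + h n)) (at x)"
          using Dg(1)[OF \<open>x + h n > 0\<close>] by (simp only: DERIV_shift)
        then show "((\<lambda>x. g (x + h n) - g x) has_real_derivative deriv g (x + h n) - deriv g x) (at x)"
          using Dg(1)[OF \<open>x > 0\<close>] by (auto intro!: derivative_eq_intros)
      qed
      then obtain z where z: "z > h n" "(g (2 * h n + h n) - g (2 * h n)) - (g (h n + h n) - g (h n))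
          = h n * (deriv g (z + h n) - deriv g z)" by auto
      have "\<exists>y>z. y < z + h n \<and> deriv g (z + h n) - deriv g z = (z + h n - z) * (deriv ^^ 2) g y"
        using z(1) h0[of n] by (intro MVT2 Dg) auto
      then obtain y where y: "y > z" "deriv g (z + h n) - deriv g z = h n * (deriv ^^ 2) g y" by auto
      have "g (h n) - 2 * g (2 * h n) + g (3 * h n) = (h n)\<^sup>2 * (deriv ^^ 2) g y"
        using z(2) y(2) by (simp add: power2_eq_square algebra_simps)
      also have "\<dots> \<le> (h n)\<^sup>2 * S" using y(1) z(1) h0[of n] by (intro mult_left_mono le_S) auto
      finally show ?thesis by (simp add: mult.commute)
    qed
    ultimately show ?thesis using h0[of n] by (simp add: pos_divide_le_eq)
  qed
  have f0: "0 \<le> f n s" for n s unfolding f_def by simp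
  have nI: "(\<integral>\<^sup>+s. ennreal (s\<^sup>2) \<partial>\<nu>) \<le> ennreal S"
  proof -
    have fl: "(\<lambda>n. f n s) \<longlonglongrightarrow> s\<^sup>2" for s
    proof -
      consider "s = 0" | "s > 0" | "s < 0" by linarith
      then show ?thesis unfolding f_def h_def by cases (simp, real_asymp+)
    qed
    have "(\<integral>\<^sup>+s. ennreal (s\<^sup>2) \<partial>\<nu>) = (\<integral>\<^sup>+s. liminf (\<lambda>n. ennreal (f n s)) \<partial>\<nu>)"
      using lim_imp_Liminf[OF _ tendsto_ennrealI[OF fl]] by simp
    also have "\<dots> \<le> liminf (\<lambda>n. \<integral>\<^sup>+s. ennreal (f n s) \<partial>\<nu>)"
      using int_f by (intro nn_integral_liminf) auto
    also have "\<dots> \<le> liminf (\<lambda>n. ennreal S)"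
      using If by (intro Liminf_mono always_eventually allI)
        (simp add: nn_integral_eq_integral[OF int_f] f0 ennreal_leI)
    also have "\<dots> = ennreal S" by (intro lim_imp_Liminf) auto
    finally show ?thesis .
  qed
  show i2: "integrable \<nu> (\<lambda>s. s\<^sup>2)"
    by (rule integrableI_nonneg) (use nI in \<open>auto simp: less_top[symmetric] top_unique\<close>)
  show "(\<integral>s. s\<^sup>2 \<partial>\<nu>) \<le> real_of_ereal (deriv_at_0 2 g)"
    using nI i2 S0 by (simp add: nn_integral_eq_integral S_def[symmetric])
  show i1: "integrable \<nu> (\<lambda>s. s)"
  proof (rule Bochner_Integration.integrable_bound[where f = "\<lambda>s. 1 + s\<^sup>2"])
    show "integrable \<nu> (\<lambda>s. 1 + s\<^sup>2)" using i2 by simp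
    have "\<bar>s\<bar> \<le> 1 + s\<^sup>2" for s :: real
      using power2_nonneg_ge_1_iff[of "\<bar>s\<bar>"] sum_squares_bound[of 1 "\<bar>s\<bar>"] by (simp add: power2_eq_square)
    then show "AE s in \<nu>. norm s \<le> norm (1 + s\<^sup>2)" by (auto intro!: AE_I2)
  qed simp
  \<comment> \<open>The factor \<open>exp (- (h n * s))\<close> turns the quotient into a difference of \<open>g\<close> at two positive points.\<close>
  define q where "q n s = exp (- (h n * s)) * ((1 - exp (- (h n * s))) / h n)" for n s
  have q_eq: "q n s = (exp (- (h n * s)) - exp (- (2 * h n * s))) / h n" for n s
  proof -
    have "exp (- (2 * h n * s)) = exp (- (h n * s)) ^ 2"
      by (simp add: exp_of_nat_mult[symmetric] mult_ac)
    then show ?thesis unfolding q_def by (simp add: power2_eq_square field_simps)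
  qed
  have Iq: "(\<integral>s. q n s \<partial>\<nu>) = (g (h n) - g (2 * h n)) / h n" for n
    unfolding q_eq using I[of "h n"] I[of "2 * h n"] h0[of n] by simp
  have "(\<lambda>n. \<integral>s. q n s \<partial>\<nu>) \<longlonglongrightarrow> (\<integral>s. s \<partial>\<nu>)"
  proof (rule integral_dominated_convergence[where w = "\<lambda>s. s"])
    show "AE s in \<nu>. (\<lambda>n. q n s) \<longlonglongrightarrow> s"
    proof (intro AE_I2)
      fix s :: real
      consider "s = 0" | "s > 0" | "s < 0" by linarith
      then show "(\<lambda>n. q n s) \<longlonglongrightarrow> s" unfolding q_def h_def by cases (simp, real_asymp+)
    qed
    show "AE s in \<nu>. norm (q n s) \<le> s" for n
      using AE0
    proof eventually_elim
      fix s :: real assume s: "0 \<le> s"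
      have "1 - exp (- (h n * s)) \<le> h n * s" using exp_ge_add_one_self[of "- (h n * s)"] by simp
      then have "(1 - exp (- (h n * s))) / h n \<le> s" using h0[of n] by (simp add: field_simps)
      moreover have "0 \<le> (1 - exp (- (h n * s))) / h n" "exp (- (h n * s)) \<le> 1" using s h0[of n] by auto
      ultimately have ab: "(1 - exp (- (h n * s))) / h n \<le> s" "0 \<le> (1 - exp (- (h n * s))) / h n"
        "exp (- (h n * s)) \<le> 1" by auto
      have "exp (- (h n * s)) * ((1 - exp (- (h n * s))) / h n) \<le> 1 * ((1 - exp (- (h n * s))) / h n)"
        using ab by (intro mult_right_mono) auto
      moreover have "0 \<le> q n s" unfolding q_def using ab by (intro mult_nonneg_nonneg) auto
      ultimately show "norm (q n s) \<le> s" using ab unfolding q_def by simp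
    qed
    show "q n \<in> borel_measurable \<nu>" for n unfolding q_def by measurable
  qed (use i1 in auto)
  moreover have "(\<lambda>n. \<integral>s. q n s \<partial>\<nu>) \<longlonglongrightarrow> 1"
  proof -
    have "\<exists>z. z > h n \<and> z < 2 * h n \<and> g (2 * h n) - g (h n) = (2 * h n - h n) * deriv g z" for n
      using h0[of n] D[of _ 0] by (intro MVT2) auto
    then obtain z where z: "\<And>n. z n > h n" "\<And>n. z n < 2 * h n" "\<And>n. g (2 * h n) - g (h n) = h n * deriv g (z n)"
      by (metis (no_types, lifting) add_diff_cancel_right' mult_2)
    have hl: "h \<longlonglongrightarrow> 0" unfolding h_def by real_asymp
    have "z \<longlonglongrightarrow> 0"
    proof (rule tendsto_sandwich[OF _ _ hl])
      show "(\<lambda>n. 2 * h n) \<longlonglongrightarrow> 0" using tendsto_mult_right_zero[OF hl] .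
    qed (use z in \<open>auto intro!: always_eventually simp: less_imp_le\<close>)
    then have "filterlim z (at_right 0) sequentially"
    proof -
      have "0 < z n" for n using h0[of n] z(1)[of n] by linarith
      then show ?thesis unfolding filterlim_at using \<open>z \<longlonglongrightarrow> 0\<close>
        by (auto intro!: always_eventually simp: less_imp_neq[symmetric])
    qed
    then have "(\<lambda>n. - deriv g (z n)) \<longlonglongrightarrow> - (-1)"
      by (intro tendsto_minus filterlim_compose[OF lim1])
    moreover have "(\<integral>s. q n s \<partial>\<nu>) = - deriv g (z n)" for n
    proof -
      have "g (h n) - g (2 * h n) = h n * (- deriv g (z n))" using z(3)[of n] by simp
      then show ?thesis unfolding Iq using h0[of n] by simp
    qed
    ultimately show ?thesis by simp
  qed
  ultimately show "(\<integral>s. s \<partial>\<nu>) = 1" by (rule LIMSEQ_unique)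
qed

lemma (in pair_sigma_finite) integral_pair_product:
  fixes u v :: "_ \<Rightarrow> real"
  assumes u: "integrable M1 u" and v: "integrable M2 v"
  shows "integrable (M1 \<Otimes>\<^sub>M M2) (\<lambda>(x, y). u x * v y)"
    "(\<integral>p. (case p of (x, y) \<Rightarrow> u x * v y) \<partial>(M1 \<Otimes>\<^sub>M M2)) = (\<integral>x. u x \<partial>M1) * (\<integral>y. v y \<partial>M2)"
proof -
  have [measurable]: "u \<in> borel_measurable M1" "v \<in> borel_measurable M2" using u v by auto
  show i: "integrable (M1 \<Otimes>\<^sub>M M2) (\<lambda>(x, y). u x * v y)"
  proof (rule Fubini_integrable)
    show "integrable M1 (\<lambda>x. \<integral>y. norm (case (x, y) of (x, y) \<Rightarrow> u x * v y) \<partial>M2)"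
      using u v by (simp add: abs_mult)
    show "AE x in M1. integrable M2 (\<lambda>y. case (x, y) of (x, y) \<Rightarrow> u x * v y)"
      using v by simp
  qed measurable
  show "(\<integral>p. (case p of (x, y) \<Rightarrow> u x * v y) \<partial>(M1 \<Otimes>\<^sub>M M2)) = (\<integral>x. u x \<partial>M1) * (\<integral>y. v y \<partial>M2)"
    using integral_fst'[OF i] by simp
qed

text \<open>The law of the sum of two independent variables: Laplace transforms multiply, means and variances add.\<close>

lemma laplace_represents_convolution:
  assumes R: "laplace_represents P \<phi>" "laplace_represents Q \<psi>"
    and pr: "prob_space P" "prob_space Q" and nn: "\<And>z. z > 0 \<Longrightarrow> 0 \<le> \<phi> z" "\<And>z. z > 0 \<Longrightarrow> 0 \<le> \<psi> z"
    and P: "integrable P (\<lambda>s. s)" "(\<integral>s. s \<partial>P) = a" "integrable P (\<lambda>s. (s - a)\<^sup>2)" "(\<integral>s. (s - a)\<^sup>2 \<partial>P) \<le> V"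
    and Q: "integrable Q (\<lambda>s. s)" "(\<integral>s. s \<partial>Q) = b" "integrable Q (\<lambda>s. (s - b)\<^sup>2)" "(\<integral>s. (s - b)\<^sup>2 \<partial>Q) \<le> W"
  shows "\<exists>N. laplace_represents N (\<lambda>z. \<phi> z * \<psi> z) \<and> prob_space N \<and> integrable N (\<lambda>s. s) \<and> (\<integral>s. s \<partial>N) = a + b \<and>
    integrable N (\<lambda>s. (s - (a + b))\<^sup>2) \<and> (\<integral>s. (s - (a + b))\<^sup>2 \<partial>N) \<le> V + W"
proof -
  interpret P: prob_space P by fact
  interpret Q: prob_space Q by fact
  interpret PQ: pair_prob_space P Q by standard
  have s[measurable_cong]: "sets P = sets borel" "sets Q = sets borel"
    using R by (auto simp: laplace_represents_def)
  have sp: "space P = UNIV" "space Q = UNIV" using s[THEN sets_eq_imp_space_eq] by auto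
  have null: "emeasure P {..<0} = 0" "emeasure Q {..<0} = 0"
    using R by (auto simp: laplace_represents_def)
  define N where "N = distr (P \<Otimes>\<^sub>M Q) borel (\<lambda>(x, y). x + y)"
  have m: "(\<lambda>(x, y). x + y) \<in> borel_measurable (P \<Otimes>\<^sub>M Q)" by measurable
  have "emeasure N {..<0} = 0"
  proof -
    have "emeasure N {..<0} = emeasure (P \<Otimes>\<^sub>M Q) ((\<lambda>(x, y). x + y) -` {..<0} \<inter> space (P \<Otimes>\<^sub>M Q))"
      unfolding N_def by (rule emeasure_distr[OF m]) simp
    also have "\<dots> \<le> emeasure (P \<Otimes>\<^sub>M Q) ({..<0} \<times> UNIV \<union> UNIV \<times> {..<0})"
      by (intro emeasure_mono) (auto simp: s)
    also have "\<dots> \<le> emeasure (P \<Otimes>\<^sub>M Q) ({..<0} \<times> UNIV) + emeasure (P \<Otimes>\<^sub>M Q) (UNIV \<times> {..<0})"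
      by (intro emeasure_subadditive) (auto simp: s)
    also have "\<dots> = 0" using null by (subst (1 2) Q.emeasure_pair_measure_Times) (auto simp: s)
    finally show ?thesis by simp
  qed
  moreover have "(\<integral>\<^sup>+s. ennreal (exp (- (z * s))) \<partial>N) = ennreal (\<phi> z * \<psi> z)" if z: "z > 0" for z
  proof -
    have "(\<integral>\<^sup>+s. ennreal (exp (- (z * s))) \<partial>N)
        = (\<integral>\<^sup>+p. (case p of (x, y) \<Rightarrow> ennreal (exp (- (z * x))) * ennreal (exp (- (z * y)))) \<partial>(P \<Otimes>\<^sub>M Q))"
      unfolding N_def using m
      by (subst nn_integral_distr) (auto intro!: nn_integral_cong simp: ennreal_mult[symmetric] exp_add[symmetric] algebra_simps)
    also have "\<dots> = (\<integral>\<^sup>+x. \<integral>\<^sup>+y. ennreal (exp (- (z * x))) * ennreal (exp (- (z * y))) \<partial>Q \<partial>P)"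
    proof -
      have "(\<lambda>(x, y). ennreal (exp (- (z * x))) * ennreal (exp (- (z * y)))) \<in> borel_measurable (P \<Otimes>\<^sub>M Q)"
        by measurable
      from Q.nn_integral_fst[OF this] show ?thesis by simp
    qed
    also have "\<dots> = (\<integral>\<^sup>+x. ennreal (exp (- (z * x))) * ennreal (\<psi> z) \<partial>P)"
      using R(2) z by (simp add: nn_integral_cmult laplace_represents_def)
    also have "\<dots> = ennreal (\<phi> z) * ennreal (\<psi> z)"
      using R(1) z by (simp add: nn_integral_multc laplace_represents_def)
    finally show ?thesis using nn z by (simp add: ennreal_mult)
  qed
  moreover have "prob_space N" unfolding N_def by (rule PQ.prob_space_distr[OF m])
  moreover have "integrable N (\<lambda>s. s)" "(\<integral>s. s \<partial>N) = a + b"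
  proof -
    note 1 = PQ.integral_pair_product[of "\<lambda>s. s" "\<lambda>_. 1"] PQ.integral_pair_product[of "\<lambda>_. 1" "\<lambda>s. s"]
    have e: "(\<lambda>(x, y). x + y) = (\<lambda>p. (case p of (x, y) \<Rightarrow> x * 1) + (case p of (x, y) \<Rightarrow> 1 * (y::real)))" by auto
    have i: "integrable (P \<Otimes>\<^sub>M Q) (\<lambda>(x, y). x * 1)" "integrable (P \<Otimes>\<^sub>M Q) (\<lambda>(x, y). 1 * y)"
      by (rule 1; rule P Q P.integrable_const Q.integrable_const)+
    have "integrable (P \<Otimes>\<^sub>M Q) (\<lambda>(x, y). x + y)"
      unfolding e by (rule Bochner_Integration.integrable_add[OF i])
    then show "integrable N (\<lambda>s. s)" unfolding N_def integrable_distr_eq[OF m measurable_ident_sets[OF refl]] .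
    have "(\<integral>s. s \<partial>N) = (\<integral>p. (case p of (x, y) \<Rightarrow> x + y) \<partial>(P \<Otimes>\<^sub>M Q))"
      unfolding N_def by (rule integral_distr[OF m measurable_ident_sets[OF refl]])
    also have "\<dots> = (\<integral>s. s \<partial>P) * (\<integral>s. 1 \<partial>Q) + (\<integral>s. 1 \<partial>P) * (\<integral>s. s \<partial>Q)"
      unfolding e Bochner_Integration.integral_add[OF i]
      by (intro arg_cong2[where f = "(+)"] 1 P Q P.integrable_const Q.integrable_const)
    also have "\<dots> = a + b" using P(2) Q(2) P.prob_space Q.prob_space by simp
    finally show "(\<integral>s. s \<partial>N) = a + b" .
  qed
  moreover have "integrable N (\<lambda>s. (s - (a + b))\<^sup>2)" "(\<integral>s. (s - (a + b))\<^sup>2 \<partial>N) \<le> V + W"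
  proof -
    note 1 = PQ.integral_pair_product[of "\<lambda>s. (s - a)\<^sup>2" "\<lambda>_. 1"] PQ.integral_pair_product[of "\<lambda>_. 1" "\<lambda>s. (s - b)\<^sup>2"]
      PQ.integral_pair_product[of "\<lambda>s. 2 * (s - a)" "\<lambda>s. s - b"]
    have e: "(\<lambda>p. ((case p of (x, y) \<Rightarrow> x + y) - (a + b))\<^sup>2) = (\<lambda>p. (case p of (x, y) \<Rightarrow> (x - a)\<^sup>2 * 1)
        + (case p of (x, y) \<Rightarrow> 1 * (y - b)\<^sup>2) + (case p of (x, y) \<Rightarrow> (2 * (x - a)) * (y - b)))"
      by (auto simp: fun_eq_iff power2_eq_square algebra_simps)
    have i: "integrable P (\<lambda>s. 2 * (s - a))" "integrable Q (\<lambda>s. s - b)" using P(1) Q(1) by auto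
    have j: "integrable (P \<Otimes>\<^sub>M Q) (\<lambda>(x, y). (x - a)\<^sup>2 * 1)" "integrable (P \<Otimes>\<^sub>M Q) (\<lambda>(x, y). 1 * (y - b)\<^sup>2)"
      "integrable (P \<Otimes>\<^sub>M Q) (\<lambda>(x, y). (2 * (x - a)) * (y - b))"
      by (rule 1; rule P Q i P.integrable_const Q.integrable_const)+
    note j12 = Bochner_Integration.integrable_add[OF j(1,2)]
    have "integrable (P \<Otimes>\<^sub>M Q) (\<lambda>p. ((case p of (x, y) \<Rightarrow> x + y) - (a + b))\<^sup>2)"
      unfolding e by (rule Bochner_Integration.integrable_add[OF j12 j(3)])
    then show "integrable N (\<lambda>s. (s - (a + b))\<^sup>2)"
      unfolding N_def by (subst integrable_distr_eq[OF m, of "\<lambda>s. (s - (a + b))\<^sup>2"]) simp_all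
    have "(\<integral>s. (s - (a + b))\<^sup>2 \<partial>N) = (\<integral>p. ((case p of (x, y) \<Rightarrow> x + y) - (a + b))\<^sup>2 \<partial>(P \<Otimes>\<^sub>M Q))"
      unfolding N_def by (rule integral_distr[OF m]) simp
    also have "\<dots> = (\<integral>s. (s - a)\<^sup>2 \<partial>P) * (\<integral>s. 1 \<partial>Q) + (\<integral>s. 1 \<partial>P) * (\<integral>s. (s - b)\<^sup>2 \<partial>Q)
        + (\<integral>s. 2 * (s - a) \<partial>P) * (\<integral>s. s - b \<partial>Q)"
      unfolding e Bochner_Integration.integral_add[OF j12 j(3)] Bochner_Integration.integral_add[OF j(1,2)]
      by (intro arg_cong2[where f = "(+)"] 1 P Q i P.integrable_const Q.integrable_const)
    also have "(\<integral>s. s - b \<partial>Q) = 0" using Q(1,2) Q.prob_space by simp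
    finally show "(\<integral>s. (s - (a + b))\<^sup>2 \<partial>N) \<le> V + W"
      using P(4) Q(4) P.prob_space Q.prob_space by simp
  qed
  ultimately show ?thesis by (intro exI[of _ N]) (auto simp: laplace_represents_def N_def)
qed

lemma laplace_represents_power:
  assumes R: "laplace_represents \<nu> g" and pr: "prob_space \<nu>" and nn: "\<And>z. z > 0 \<Longrightarrow> 0 \<le> g z"
    and m: "integrable \<nu> (\<lambda>s. s)" "(\<integral>s. s \<partial>\<nu>) = b" "integrable \<nu> (\<lambda>s. (s - b)\<^sup>2)" "(\<integral>s. (s - b)\<^sup>2 \<partial>\<nu>) \<le> V"
  shows "\<exists>N. laplace_represents N (\<lambda>z. g z ^ n) \<and> prob_space N \<and> integrable N (\<lambda>s. s) \<and> (\<integral>s. s \<partial>N) = real n * b \<and>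
    integrable N (\<lambda>s. (s - real n * b)\<^sup>2) \<and> (\<integral>s. (s - real n * b)\<^sup>2 \<partial>N) \<le> real n * V"
proof (induction n)
  case 0
  have "prob_space (return borel (0::real))" by (rule prob_space_return) simp
  then show ?case
    by (intro exI[of _ "return borel 0"])
      (auto simp: laplace_represents_def nn_integral_return integral_return emeasure_return integrable_iff_bounded)
next
  case (Suc n)
  then obtain N where N: "laplace_represents N (\<lambda>z. g z ^ n)" "prob_space N" "integrable N (\<lambda>s. s)" "(\<integral>s. s \<partial>N) = real n * b"
    "integrable N (\<lambda>s. (s - real n * b)\<^sup>2)" "(\<integral>s. (s - real n * b)\<^sup>2 \<partial>N) \<le> real n * V" by blast
  have e: "real (Suc n) * b = b + real n * b" "real (Suc n) * V = V + real n * V"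
    "(\<lambda>z. g z ^ Suc n) = (\<lambda>z. g z * g z ^ n)" by (auto simp: algebra_simps)
  show ?case
    unfolding e by (rule laplace_represents_convolution[OF R N(1) pr N(2) nn _ m N(3-6)]) (use nn in auto)
qed

text \<open>All that the estimates use of the family \<open>g\<close>: the representing measure of \<open>z \<mapsto> g (t z/n)\<^sup>n\<close> is the \<open>n\<close>-fold
  convolution of that of \<open>g\<close>, scaled by \<open>t/n\<close>, hence its variance is at most
  \<open>(t/n)\<^sup>2 \<cdot> n (g''(0) - 1)\<close>.\<close>

lemma approximation_measure:
  assumes g: "completely_monotone g" and d0: "deriv_at_0 0 g = 1" and d1: "deriv_at_0 1 g = -1"
    and d2: "deriv_at_0 2 g < \<infinity>" and n: "n \<ge> 1" and t: "t > (0::real)"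
  defines "P \<equiv> bernstein_measure (\<lambda>z. g (t * z / real n) ^ n)"
  shows "prob_space P" "sets P = sets borel" "AE s in P. 0 \<le> s" "integrable P (\<lambda>s. s)" "(\<integral>s. s \<partial>P) = t"
    "integrable P (\<lambda>s. (s - t)\<^sup>2)"
    "(\<integral>s. (s - t)\<^sup>2 \<partial>P) \<le> (real_of_ereal (deriv_at_0 2 g) - 1) * (t\<^sup>2 / real n)"
proof -
  define S where "S = real_of_ereal (deriv_at_0 2 g)"
  have lim0: "(g \<longlongrightarrow> 1) (at_right 0)"
    using completely_monotone_tendsto_deriv_at_0[OF g, of 0] d0 by (simp add: one_ereal_def)
  have nn: "0 \<le> g z" if "z > 0" for z using completely_monotone_DERIV(2)[OF g that, of 0] by simp
  obtain \<nu> where R: "laplace_represents \<nu> g" using bernstein_representation[OF g lim0] .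
  interpret \<nu>: prob_space \<nu> by (rule laplace_represents_prob_space[OF R lim0])
  note mom = laplace_represents_moments[OF g d0 d1 d2 R]
  have e: "(s - 1)\<^sup>2 = s\<^sup>2 - 2 * s + 1" for s :: real by (simp add: power2_eq_square algebra_simps)
  have "integrable \<nu> (\<lambda>s. (s - 1)\<^sup>2)" "(\<integral>s. (s - 1)\<^sup>2 \<partial>\<nu>) \<le> S - 1"
    unfolding e S_def using mom \<nu>.prob_space by simp_all
  from laplace_represents_power[OF R \<nu>.prob_space_axioms nn mom(3,4) this, of n]
  obtain N where N: "laplace_represents N (\<lambda>z. g z ^ n)" "prob_space N" "integrable N (\<lambda>s. s)" "(\<integral>s. s \<partial>N) = real n"
    "integrable N (\<lambda>s. (s - real n)\<^sup>2)" "(\<integral>s. (s - real n)\<^sup>2 \<partial>N) \<le> real n * (S - 1)" by auto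
  define c where "c = t / real n"
  have c: "c > 0" "c * real n = t" using n t by (auto simp: c_def)
  interpret N: prob_space N by fact
  have s[measurable_cong]: "sets N = sets borel" using N(1) by (auto simp: laplace_represents_def)
  define Q where "Q = distr N borel (\<lambda>s. c * s)"
  have "(\<lambda>s. c * s) -` {..<0} \<inter> space N = {..<0}"
    using c sets_eq_imp_space_eq[OF s] by (auto simp: mult_less_0_iff)
  then have "emeasure Q {..<0} = 0"
    using N(1) unfolding Q_def by (subst emeasure_distr) (auto simp: laplace_represents_def)
  moreover have "(\<integral>\<^sup>+s. ennreal (exp (- (z * s))) \<partial>Q) = ennreal (g (t * z / real n) ^ n)" if z: "z > 0" for z
  proof -
    have "(\<integral>\<^sup>+s. ennreal (exp (- (z * s))) \<partial>Q) = (\<integral>\<^sup>+s. ennreal (exp (- ((c * z) * s))) \<partial>N)"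
      unfolding Q_def by (subst nn_integral_distr) (auto simp: mult_ac)
    also have "\<dots> = ennreal (g (c * z) ^ n)" using N(1) c z by (auto simp: laplace_represents_def)
    finally show ?thesis by (simp add: c_def)
  qed
  ultimately have RQ: "laplace_represents Q (\<lambda>z. g (t * z / real n) ^ n)"
    by (auto simp: laplace_represents_def Q_def)
  have PQ: "P = Q" unfolding P_def
  proof (rule bernstein_measure_eq[OF RQ])
    have "((\<lambda>z. g (t * z / real n)) \<longlongrightarrow> 1) (at_right 0)"
    proof (rule filterlim_compose[OF lim0])
      show "filterlim (\<lambda>z. t * z / real n) (at_right 0) (at_right 0)"
        unfolding filterlim_at using t n
        by (auto intro!: tendsto_eq_intros simp: eventually_at_right_field intro: gt_ex)
    qed
    from tendsto_power[OF this, of n] show "((\<lambda>z. g (t * z / real n) ^ n) \<longlongrightarrow> 1) (at_right 0)" by simp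
    show "0 \<le> g (t * z / real n) ^ n" if "z > 0" for z using that t n nn by simp
  qed
  show "prob_space P" unfolding PQ Q_def by (rule N.prob_space_distr) simp
  show "sets P = sets borel" unfolding PQ Q_def by simp
  show "AE s in P. 0 \<le> s" unfolding PQ by (rule laplace_represents_AE[OF RQ])
  have mc: "(\<lambda>s. c * s) \<in> borel_measurable N" by measurable
  show "integrable P (\<lambda>s. s)"
    unfolding PQ Q_def integrable_distr_eq[OF mc measurable_ident_sets[OF refl]]
    by (rule integrable_mult_right) (use N(3) in simp)
  have "(\<integral>s. s \<partial>Q) = (\<integral>s. c * s \<partial>N)"
    unfolding Q_def by (rule integral_distr[OF mc measurable_ident_sets[OF refl]])
  then show "(\<integral>s. s \<partial>P) = t" using N(4) c unfolding PQ by simp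
  have e2: "(c * s - t)\<^sup>2 = c\<^sup>2 * (s - real n)\<^sup>2" for s
    using c(2) by (simp add: power2_eq_square algebra_simps flip: c(2))
  show "integrable P (\<lambda>s. (s - t)\<^sup>2)" unfolding PQ Q_def using N(5) by (simp add: integrable_distr_eq e2)
  have "(\<integral>s. (s - t)\<^sup>2 \<partial>P) = c\<^sup>2 * (\<integral>s. (s - real n)\<^sup>2 \<partial>N)"
    unfolding PQ Q_def by (subst integral_distr) (auto simp: e2)
  also have "\<dots> \<le> c\<^sup>2 * (real n * (S - 1))" by (intro mult_left_mono N(6)) auto
  also have "\<dots> = (S - 1) * (t\<^sup>2 / real n)" using n by (simp add: c_def power2_eq_square)
  finally show "(\<integral>s. (s - t)\<^sup>2 \<partial>P) \<le> (real_of_ereal (deriv_at_0 2 g) - 1) * (t\<^sup>2 / real n)" unfolding S_def .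
qed

section \<open>Improper integrals in Banach spaces\<close>

text \<open>A function whose increments are dominated by those of a convergent function satisfies the Cauchy criterion.\<close>

lemma tendsto_of_dominated_increments:
  fixes F :: "real \<Rightarrow> 'a::banach" and \<Psi> :: "real \<Rightarrow> real"
  assumes ev: "eventually P K" and K: "K \<noteq> bot"
    and le: "\<And>a b. P a \<Longrightarrow> P b \<Longrightarrow> norm (F b - F a) \<le> \<bar>\<Psi> b - \<Psi> a\<bar>"
    and lim: "(\<Psi> \<longlongrightarrow> p) K"
  obtains L where "(F \<longlongrightarrow> L) K"
proof -
  have "cauchy_filter (filtermap F K)"
    unfolding cauchy_filter_metric_filtermap
  proof (intro allI impI)
    fix e :: real assume e: "e > 0"
    have "\<forall>\<^sub>F x in K. dist (\<Psi> x) p < e / 2" using lim e by (intro tendstoD) auto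
    then have "\<forall>\<^sub>F x in K. P x \<and> dist (\<Psi> x) p < e / 2" using ev by eventually_elim simp
    moreover have "dist (F x) (F y) < e"
      if "P x \<and> dist (\<Psi> x) p < e / 2" "P y \<and> dist (\<Psi> y) p < e / 2" for x y
    proof -
      have "dist (F x) (F y) \<le> \<bar>\<Psi> x - \<Psi> y\<bar>" using le[of y x] that by (simp add: dist_norm)
      moreover have "\<bar>\<Psi> x - \<Psi> y\<bar> < e" using that unfolding dist_real_def by linarith
      ultimately show ?thesis by linarith
    qed
    ultimately show "\<exists>P. eventually P K \<and> (\<forall>x y. P x \<and> P y \<longrightarrow> dist (F x) (F y) < e)" by blast
  qed
  moreover have "filtermap F K \<noteq> bot" using K by (simp add: filtermap_bot_iff)
  ultimately obtain L where "filtermap F K \<le> nhds L"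
    using complete_UNIV[where 'a = 'a] complete_uniform[where S = "UNIV :: 'a set"] by auto
  then show ?thesis by (intro that[of L]) (simp add: filterlim_def)
qed

text \<open>Extended by its limit at \<open>0\<close>, the antiderivative is continuous on every interval \<open>[0,b]\<close> and
  differentiable inside, so the fundamental theorem for the gauge integral applies despite a singularity of \<open>f\<close> at \<open>0\<close>.\<close>

lemma has_integral_improper:
  fixes F :: "real \<Rightarrow> 'a::banach"
  assumes D: "\<And>x. x > 0 \<Longrightarrow> (F has_vector_derivative f x) (at x)"
    and L0: "(F \<longlongrightarrow> L0) (at_right 0)" and L: "(F \<longlongrightarrow> L) at_top"
  shows "(f has_integral L - L0) {0<..}"
proof -
  define G where "G x = (if x \<le> 0 then L0 else F x)" for x
  let ?f = "\<lambda>x. if x \<in> {0<..} then f x else 0"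
  have DG: "(G has_vector_derivative f x) (at x)" if "x > 0" for x
    by (rule has_vector_derivative_transform_within_open[OF D[OF that], of "{0<..}"])
      (use that in \<open>auto simp: G_def\<close>)
  have G0: "(G \<longlongrightarrow> L0) (at_right 0)"
    using L0 by (rule Lim_transform_eventually) (auto simp: G_def eventually_at_right_field intro: gt_ex)
  have pos: "(f has_integral G b - L0) {0..b}" if b: "b \<ge> 0" for b
  proof -
    have "continuous_on {0..b} G"
      unfolding continuous_on_def
    proof
      fix x assume x: "x \<in> {0..b}"
      show "(G \<longlongrightarrow> G x) (at x within {0..b})"
      proof (cases "x = 0")
        case True
        have "at 0 within {0..b} \<le> at_right (0::real)"
          unfolding at_within_def by (intro inf_mono) auto
        from tendsto_mono[OF this G0] show ?thesis using True by (simp add: G_def)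
      next
        case False
        then have "isCont G x" using DG[of x] x has_vector_derivative_continuous by auto
        then show ?thesis unfolding isCont_def by (rule tendsto_within_subset) simp
      qed
    qed
    then have "(f has_integral G b - G 0) {0..b}"
      using b by (intro fundamental_theorem_of_calculus_interior DG) auto
    then show ?thesis by (simp add: G_def)
  qed
  have int: "(?f has_integral G b - L0) {a..b}" if ab: "a \<le> 0" "0 \<le> b" for a b
  proof -
    have "(?f has_integral 0) {a..0}" by (rule has_integral_is_0) auto
    moreover have "(?f has_integral G b - L0) {0..b}"
      by (rule has_integral_spike_finite[OF _ _ pos[OF ab(2)], of "{0}"]) auto
    ultimately have "(?f has_integral 0 + (G b - L0)) {a..b}"
      using ab by (intro has_integral_combine[of a 0 b])
    then show ?thesis by simp
  qed
  show ?thesis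
    unfolding has_integral_alt'
  proof (intro conjI allI impI)
    fix a b :: real
    have "?f integrable_on {min a 0..max b 0}" using int[of "min a 0" "max b 0"] by auto
    then show "?f integrable_on cbox a b" unfolding cbox_interval by (rule integrable_on_subinterval) auto
  next
    fix e :: real assume e: "e > 0"
    have "\<forall>\<^sub>F x in at_top. dist (F x) L < e" using L e by (rule tendstoD)
    then obtain B where B: "\<And>x. x \<ge> B \<Longrightarrow> dist (F x) L < e" by (auto simp: eventually_at_top_linorder)
    show "\<exists>B>0. \<forall>a b. ball 0 B \<subseteq> cbox a b \<longrightarrow> norm (integral (cbox a b) ?f - (L - L0)) < e"
    proof (intro exI[of _ "max B 0 + 1"] conjI allI impI)
      fix a b :: real assume sub: "ball 0 (max B 0 + 1) \<subseteq> cbox a b"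
      have "(0::real) \<in> ball 0 (max B 0 + 1)" by simp
      with sub have "0 \<in> cbox a b" by (rule subsetD)
      then have a: "a \<le> 0" by simp
      have b: "b \<ge> max B 0 + 1/2"
      proof -
        have "max B 0 + 1/2 \<in> ball 0 (max B 0 + 1)" by (auto simp: dist_real_def)
        with sub have "max B 0 + 1/2 \<in> cbox a b" by (rule subsetD)
        then show ?thesis by simp
      qed
      have "integral (cbox a b) ?f = G b - L0" using int[OF a, of b] b by (simp add: integral_unique)
      moreover have "0 < b" using b by linarith
      then have "G b = F b" by (simp add: G_def)
      ultimately show "norm (integral (cbox a b) ?f - (L - L0)) < e"
        using B[of b] b by (simp add: dist_norm)
    qed simp
  qed
qed

lemma antiderivative_on_halfline:
  fixes f :: "real \<Rightarrow> 'a::banach"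
  assumes f: "continuous_on {0<..} f"
  obtains F where "\<And>x. x > 0 \<Longrightarrow> (F has_vector_derivative f x) (at x)"
proof
  define F where "F x = (if x \<ge> 1 then integral {1..x} f else - integral {x..1} f)" for x
  fix x :: real assume x: "x > 0"
  define a where "a = min x 1 / 2"
  define b where "b = max x 1 + 1"
  have ab: "0 < a" "a < x" "x < b" "a < 1" "1 < b" using x by (auto simp: a_def b_def)
  have c: "continuous_on {a..b} f" by (rule continuous_on_subset[OF f]) (use ab in auto)
  then have i: "f integrable_on {a..b}" by (rule integrable_continuous_real)
  have "((\<lambda>u. integral {a..u} f) has_vector_derivative f x) (at x within {a..b})"
    using integral_has_vector_derivative[OF c] ab by simp
  then have "((\<lambda>u. integral {a..u} f) has_vector_derivative f x) (at x)"
    using ab at_within_Icc_at[of a x b] by simp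
  then have d: "((\<lambda>u. integral {a..u} f - integral {a..1} f) has_vector_derivative f x) (at x)"
    by (auto intro!: derivative_eq_intros)
  show "(F has_vector_derivative f x) (at x)"
  proof (rule has_vector_derivative_transform_within_open[OF d, of "{a<..<b}"])
    fix u assume u: "u \<in> {a<..<b}"
    show "integral {a..u} f - integral {a..1} f = F u"
    proof (cases "u \<ge> 1")
      case True
      have "integral {a..1} f + integral {1..u} f = integral {a..u} f"
        by (rule Henstock_Kurzweil_Integration.integral_combine) (use True u ab in \<open>auto intro: integrable_on_subinterval[OF i]\<close>)
      then show ?thesis using True by (simp add: F_def algebra_simps)
    next
      case False
      have "integral {a..u} f + integral {u..1} f = integral {a..1} f"
        by (rule Henstock_Kurzweil_Integration.integral_combine) (use False u ab in \<open>auto intro: integrable_on_subinterval[OF i]\<close>)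
      then show ?thesis using False by (simp add: F_def algebra_simps)
    qed
  qed (use ab in auto)
qed

lemma antiderivative_limits_dominated:
  fixes F :: "real \<Rightarrow> 'a::banach"
  assumes F: "\<And>x. x > 0 \<Longrightarrow> (F has_vector_derivative f x) (at x)"
    and \<Psi>: "\<And>s. s > 0 \<Longrightarrow> (\<Psi> has_real_derivative \<phi> s) (at s)"
    and le: "\<And>s. s > 0 \<Longrightarrow> norm (f s) \<le> \<phi> s"
    and p: "(\<Psi> \<longlongrightarrow> p) (at_right 0)" and q: "(\<Psi> \<longlongrightarrow> q) at_top"
  obtains L0 L where "(F \<longlongrightarrow> L0) (at_right 0)" "(F \<longlongrightarrow> L) at_top"
proof -
  have \<Psi>': "(\<Psi> has_vector_derivative \<phi> s) (at s)" if "s > 0" for s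
    using \<Psi>[OF that] by (simp add: has_real_derivative_iff_has_vector_derivative)
  have cont: "continuous_on {a..b} F" "continuous_on {a..b} \<Psi>" if "0 < a" for a b
    using that by (auto intro!: continuous_at_imp_continuous_on
        has_vector_derivative_continuous[OF F] has_vector_derivative_continuous[OF \<Psi>'])
  have inc: "norm (F b - F a) \<le> \<Psi> b - \<Psi> a" if "0 < a" "a \<le> b" for a b
  proof (cases "a = b")
    case False
    then show ?thesis
      using that by (intro differentiable_bound_general[where f' = f and \<phi>' = \<phi>] cont F \<Psi>' le) auto
  qed simp
  have inc': "norm (F b - F a) \<le> \<bar>\<Psi> b - \<Psi> a\<bar>" if "0 < a" "0 < b" for a b
    using inc[of a b] inc[of b a] that by (cases "a \<le> b") (auto simp: norm_minus_commute)
  obtain L0 where L0: "(F \<longlongrightarrow> L0) (at_right 0)"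
    by (rule tendsto_of_dominated_increments[OF _ _ inc' p, where P = "\<lambda>x. 0 < x"])
      (auto simp: eventually_at_right_field intro: gt_ex)
  obtain L where L: "(F \<longlongrightarrow> L) at_top"
    by (rule tendsto_of_dominated_increments[OF _ _ inc' q, where P = "\<lambda>x. 0 < x"])
      (auto simp: eventually_gt_at_top)
  show ?thesis by (rule that[OF L0 L])
qed

text \<open>A comparison test for values in an arbitrary Banach space. The scalar majorant \<open>\<phi>\<close> is given through an
  antiderivative \<open>\<Psi>\<close>, because then only increments have to be compared.\<close>

lemma improper_integral_dominated:
  fixes f :: "real \<Rightarrow> 'a::banach"
  assumes f: "continuous_on {0<..} f"
    and \<Psi>: "\<And>s. s > 0 \<Longrightarrow> (\<Psi> has_real_derivative \<phi> s) (at s)"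
    and le: "\<And>s. s > 0 \<Longrightarrow> norm (f s) \<le> \<phi> s"
    and p: "(\<Psi> \<longlongrightarrow> p) (at_right 0)" and q: "(\<Psi> \<longlongrightarrow> q) at_top"
  shows "f integrable_on {0<..}" "norm (integral {0<..} f) \<le> q - p"
proof -
  obtain F where F: "\<And>x. x > 0 \<Longrightarrow> (F has_vector_derivative f x) (at x)"
    using antiderivative_on_halfline[OF f] by blast
  obtain L0 L where L: "(F \<longlongrightarrow> L0) (at_right 0)" "(F \<longlongrightarrow> L) at_top"
    using antiderivative_limits_dominated[OF F \<Psi> le p q] .
  have "(f has_integral L - L0) {0<..}" by (rule has_integral_improper[OF F L])
  then show i: "f integrable_on {0<..}" by blast
  have "(\<Psi> has_vector_derivative \<phi> s) (at s)" if "s > 0" for s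
    using \<Psi>[OF that] by (simp add: has_real_derivative_iff_has_vector_derivative)
  then have "(\<phi> has_integral q - p) {0<..}" using p q by (rule has_integral_improper)
  then show "norm (integral {0<..} f) \<le> q - p"
    using integral_norm_bound_integral[OF i, of \<phi>] le by (auto simp: integral_unique has_integral_integrable)
qed

lemma set_integrable_dominated:
  fixes f :: "real \<Rightarrow> real"
  assumes f: "continuous_on {0<..} f"
    and \<Psi>: "\<And>s. s > 0 \<Longrightarrow> (\<Psi> has_real_derivative \<phi> s) (at s)"
    and le: "\<And>s. s > 0 \<Longrightarrow> \<bar>f s\<bar> \<le> \<phi> s"
    and p: "(\<Psi> \<longlongrightarrow> p) (at_right 0)" and q: "(\<Psi> \<longlongrightarrow> q) at_top"
  shows "set_integrable lborel {0<..} f" "(LINT s:{0<..}|lborel. f s) = integral {0<..} f"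
proof -
  have fm: "(\<lambda>s. indicator {0<..} s *\<^sub>R f s) \<in> borel_measurable borel"
    by (rule borel_measurable_continuous_on_indicator[OF _ f]) simp
  have "(\<lambda>s. \<bar>f s\<bar>) integrable_on {0<..}"
    using improper_integral_dominated(1)[OF continuous_on_rabs[OF f] \<Psi> _ p q] le by simp
  then have "((\<lambda>s. \<bar>f s\<bar>) has_integral integral {0<..} (\<lambda>s. \<bar>f s\<bar>)) {0<..}" by (rule integrable_integral)
  from nn_integral_has_integral_lebesgue[OF _ this]
  have "(\<integral>\<^sup>+ s. ennreal (indicator {0<..} s * \<bar>f s\<bar>) \<partial>lborel) < \<infinity>" by simp
  then show si: "set_integrable lborel {0<..} f"
    unfolding set_integrable_def integrable_iff_bounded using fm by (simp add: abs_mult)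
  show "(LINT s:{0<..}|lborel. f s) = integral {0<..} f"
    by (rule set_borel_integral_eq_integral(2)[OF si])
qed

section \<open>Orbits and resolvents of bounded semigroups\<close>

text \<open>As in the notation \<open>e\<^sup>-\<^sup>t\<^sup>A\<close>, the operator \<open>A\<close> is the negative of the generator.\<close>

locale bounded_semigroup =
  fixes T :: "real \<Rightarrow> 'a::banach \<Rightarrow> 'a" and D :: "'a set" and A :: "'a \<Rightarrow> 'a" and M :: real
  assumes lin: "0 \<le> t \<Longrightarrow> bounded_linear (T t)"
    and T_0: "T 0 x = x"
    and T_add: "0 \<le> s \<Longrightarrow> 0 \<le> t \<Longrightarrow> T (s + t) x = T s (T t x)"
    and strong: "((\<lambda>t. T t x) \<longlongrightarrow> x) (at_right 0)"
    and bound: "0 \<le> t \<Longrightarrow> norm (T t x) \<le> M * norm x"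
    and M_nonneg: "0 \<le> M"
    and D_iff: "x \<in> D \<longleftrightarrow> (\<exists>y. ((\<lambda>h. (T h x - x) /\<^sub>R h) \<longlongrightarrow> y) (at_right 0))"
    and A_limit: "x \<in> D \<Longrightarrow> ((\<lambda>h. (T h x - x) /\<^sub>R h) \<longlongrightarrow> - A x) (at_right 0)"
begin

lemma T_diff: "0 \<le> t \<Longrightarrow> T t (x - y) = T t x - T t y"
  using lin by (rule linear_diff[OF bounded_linear.linear])

lemma T_scaleR: "0 \<le> t \<Longrightarrow> T t (c *\<^sub>R x) = c *\<^sub>R T t x"
  using lin by (rule linear_cmul[OF bounded_linear.linear])

lemma T_increment: "0 \<le> s \<Longrightarrow> 0 \<le> h \<Longrightarrow> T (s + h) x - T s x = T s (T h x - x)"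
  by (simp add: T_add T_diff)

lemma continuous_orbit: "continuous_on {0..} (\<lambda>t. T t x)"
  unfolding continuous_on_iff
proof (intro ballI allI impI)
  fix s e :: real assume s: "s \<in> {0..}" and e: "0 < e"
  have "\<forall>\<^sub>F h in at_right 0. dist (T h x) x < e / (M + 1)"
    using strong e M_nonneg by (intro tendstoD) auto
  then obtain d where d: "d > 0" "\<And>h. 0 < h \<Longrightarrow> h < d \<Longrightarrow> dist (T h x) x < e / (M + 1)"
    unfolding eventually_at_right_field by auto
  have inc: "dist (T (a + h) x) (T a x) < e" if "0 \<le> a" "0 \<le> h" "h < d" for a h
  proof (cases "h = 0")
    case False
    have "dist (T (a + h) x) (T a x) \<le> M * norm (T h x - x)"
      using bound that by (simp add: dist_norm T_increment)
    also have "\<dots> \<le> M * (e / (M + 1))"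
      using d(2)[of h] that False M_nonneg by (intro mult_left_mono) (auto simp: dist_norm)
    also have "\<dots> < e" using e M_nonneg by (simp add: field_simps)
    finally show ?thesis .
  qed (use e in simp)
  show "\<exists>d>0. \<forall>r\<in>{0..}. dist r s < d \<longrightarrow> dist (T r x) (T s x) < e"
  proof (intro exI[of _ d] conjI ballI impI d(1))
    fix r assume r: "r \<in> {0..}" "dist r s < d"
    then show "dist (T r x) (T s x) < e"
      using inc[of s "r - s"] inc[of r "s - r"] s
      by (cases "s \<le> r") (auto simp: dist_real_def dist_commute)
  qed
qed

lemma A_eqI: "((\<lambda>h. (T h x - x) /\<^sub>R h) \<longlongrightarrow> y) (at_right 0) \<Longrightarrow> x \<in> D \<and> A x = - y"
  using D_iff A_limit tendsto_unique[OF trivial_limit_at_right_real] by (metis minus_minus)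

text \<open>For \<open>h = |y - u|\<close> and \<open>m = min y u\<close> the increment of the orbit is \<open>\<plusminus> T(m)(T(h)x - x)\<close>. This treats both
  one-sided derivatives at once and uses the definition of the generator only at \<open>0\<close>.\<close>

lemma has_vector_derivative_orbit:
  assumes x: "x \<in> D" and u: "0 < u"
  shows "((\<lambda>t. T t x) has_vector_derivative - T u (A x)) (at u)"
proof -
  define \<psi> where "\<psi> h = norm ((T h x - x) /\<^sub>R h + A x)" for h
  have \<psi>: "(\<psi> \<longlongrightarrow> 0) (at_right 0)"
    using tendsto_norm_zero[OF LIM_zero[OF A_limit[OF x]]] unfolding \<psi>_def by simp
  have b: "norm (T y x - T u x - (y - u) *\<^sub>R (- T u (A x))) / norm (y - u)
      \<le> M * \<psi> \<bar>y - u\<bar> + norm (T (min y u) (A x) - T u (A x))" if y: "0 < y" "y \<noteq> u" for y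
  proof -
    define h where "h = \<bar>y - u\<bar>"
    define m where "m = min y u"
    define w where "w = T h x - x + h *\<^sub>R A x"
    have h: "h > 0" "m \<ge> 0" using y u by (auto simp: h_def m_def)
    have Tw: "T m w = T (m + h) x - T m x + h *\<^sub>R T m (A x)"
      using h unfolding w_def
      by (simp add: T_increment linear_add[OF bounded_linear.linear[OF lin]] T_scaleR)
    have "norm (T y x - T u x - (y - u) *\<^sub>R (- T u (A x))) = norm (T m w - h *\<^sub>R (T m (A x) - T u (A x)))"
    proof (cases "y > u")
      case True
      then have e: "m + h = y" "m = u" "h = y - u" by (auto simp: h_def m_def)
      show ?thesis unfolding Tw e(1) unfolding e(2,3) by (simp add: algebra_simps)
    next
      case False
      then have e: "m + h = u" "m = y" "h = u - y" using y by (auto simp: h_def m_def)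
      have "T m w - h *\<^sub>R (T m (A x) - T u (A x)) = - (T y x - T u x - (y - u) *\<^sub>R (- T u (A x)))"
        unfolding Tw e(1) unfolding e(2,3) by (simp add: algebra_simps)
      then show ?thesis by (metis norm_minus_cancel)
    qed
    also have "\<dots> \<le> M * norm w + h * norm (T m (A x) - T u (A x))"
      using bound[OF h(2), of w] h(1) by (intro order_trans[OF norm_triangle_ineq4] add_mono) auto
    also have "norm w = h * \<psi> h"
    proof -
      have "w = h *\<^sub>R ((T h x - x) /\<^sub>R h + A x)" using h(1) by (simp add: w_def scaleR_add_right)
      then show ?thesis using h(1) unfolding \<psi>_def by simp
    qed
    finally show ?thesis using h(1) unfolding h_def[symmetric] m_def[symmetric]
      by (simp add: field_simps h_def)
  qed
  have "((\<lambda>y. norm (T y x - T u x - (y - u) *\<^sub>R (- T u (A x))) / norm (y - u)) \<longlongrightarrow> 0) (at u)"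
  proof (rule tendsto_sandwich[OF _ _ tendsto_const])
    show "\<forall>\<^sub>F y in at u. norm (T y x - T u x - (y - u) *\<^sub>R (- T u (A x))) / norm (y - u)
      \<le> M * \<psi> \<bar>y - u\<bar> + norm (T (min y u) (A x) - T u (A x))"
      using b u by (auto simp: eventually_at dist_real_def intro!: exI[of _ u])
    have "((\<lambda>y. \<psi> \<bar>y - u\<bar>) \<longlongrightarrow> 0) (at u)"
    proof (rule filterlim_compose[OF \<psi>])
      show "filterlim (\<lambda>y. \<bar>y - u\<bar>) (at_right 0) (at u)"
        unfolding filterlim_at by (auto intro!: tendsto_eq_intros simp: eventually_at_filter)
    qed
    moreover have "((\<lambda>y. T (min y u) (A x)) \<longlongrightarrow> T (min u u) (A x)) (at u)"
    proof (rule continuous_on_tendsto_compose[OF continuous_orbit])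
      show "((\<lambda>y. min y u) \<longlongrightarrow> min u u) (at u)" by (intro tendsto_intros)
      show "\<forall>\<^sub>F y in at u. min y u \<in> {0..}"
        using u by (auto simp: eventually_at dist_real_def intro!: exI[of _ u])
    qed (use u in auto)
    ultimately have "((\<lambda>y. M * \<psi> \<bar>y - u\<bar> + norm (T (min y u) (A x) - T u (A x)))
        \<longlongrightarrow> M * 0 + norm (T (min u u) (A x) - T u (A x))) (at u)"
      by (intro tendsto_intros)
    then show "((\<lambda>y. M * \<psi> \<bar>y - u\<bar> + norm (T (min y u) (A x) - T u (A x))) \<longlongrightarrow> 0) (at u)" by simp
  qed simp
  then show ?thesis
    unfolding has_vector_derivative_def has_derivative_iff_norm
    by (auto intro: bounded_linear_minus bounded_linear_scaleR_left)
qed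

lemma orbit_Lipschitz:
  assumes x: "x \<in> D" and "0 \<le> r" "0 \<le> t"
  shows "norm (T r x - T t x) \<le> M * norm (A x) * \<bar>r - t\<bar>"
proof -
  have *: "norm (T b x - T a x) \<le> M * norm (A x) * b - M * norm (A x) * a" if "0 \<le> a" "a < b" for a b
  proof (rule differentiable_bound_general[OF that(2)])
    show "continuous_on {a..b} (\<lambda>t. T t x)"
      by (rule continuous_on_subset[OF continuous_orbit]) (use that in auto)
    show "((\<lambda>t. T t x) has_vector_derivative - T u (A x)) (at u)" if "a < u" "u < b" for u
      using \<open>0 \<le> a\<close> that by (intro has_vector_derivative_orbit x) auto
    show "((*) (M * norm (A x)) has_vector_derivative M * norm (A x)) (at u)" for u
      by (auto intro!: derivative_eq_intros)
    show "norm (- T u (A x)) \<le> M * norm (A x)" if "a < u" for u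
      using \<open>0 \<le> a\<close> that bound[of u "A x"] by simp
  qed (auto intro!: continuous_intros)
  consider "r = t" | "t < r" | "r < t" by linarith
  then show ?thesis
  proof cases
    case 2
    then show ?thesis using *[of t r] assms by (simp add: algebra_simps)
  next
    case 3
    then show ?thesis using *[of r t] assms by (simp add: algebra_simps norm_minus_commute)
  qed simp
qed

text \<open>The function \<open>u \<mapsto> T(u)x - T(t)x + (u - t) T(t)Ax\<close> vanishes at \<open>t\<close> and has derivative
  \<open>- (T(u)Ax - T(t)Ax)\<close>, so its size follows by integrating the Hoelder bound for the orbit of \<open>Ax\<close>.\<close>

lemma orbit_Taylor_of_Hoelder:
  assumes x: "x \<in> D" and rt: "0 \<le> r" "0 \<le> t" and b: "0 \<le> b"
    and H: "\<And>u. 0 \<le> u \<Longrightarrow> norm (T u (A x) - T t (A x)) \<le> C * \<bar>u - t\<bar> powr b"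
  shows "norm (T r x - T t x + (r - t) *\<^sub>R T t (A x)) \<le> C / (b + 1) * \<bar>r - t\<bar> powr (b + 1)"
proof -
  define \<phi> where "\<phi> u = T u x - T t x + (u - t) *\<^sub>R T t (A x)" for u
  have cont: "continuous_on {a..c} \<phi>" if "0 \<le> a" for a c
    unfolding \<phi>_def by (intro continuous_intros continuous_on_subset[OF continuous_orbit]) (use that in auto)
  have der: "(\<phi> has_vector_derivative - T u (A x) + T t (A x)) (at u)" if "u > 0" for u
    unfolding \<phi>_def using has_vector_derivative_orbit[OF x that]
    by (auto intro!: derivative_eq_intros)
  have nb: "norm (- T u (A x) + T t (A x)) \<le> C * \<bar>u - t\<bar> powr b" if "u > 0" for u
    using H[of u] that by (simp add: norm_minus_commute)
  have \<phi>t: "\<phi> t = 0" by (simp add: \<phi>_def)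
  consider "r = t" | "t < r" | "r < t" by linarith
  then have "norm (\<phi> r) \<le> C / (b + 1) * \<bar>r - t\<bar> powr (b + 1)"
  proof cases
    case 1
    then show ?thesis using \<phi>t by simp
  next
    case 2
    have "norm (\<phi> r - \<phi> t) \<le> C / (b + 1) * (r - t) powr (b + 1) - C / (b + 1) * (t - t) powr (b + 1)"
    proof (rule differentiable_bound_general[OF 2 cont[OF rt(2)]])
      show "continuous_on {t..r} (\<lambda>u. C / (b + 1) * (u - t) powr (b + 1))"
        using b by (intro continuous_intros continuous_on_powr') auto
      show "(\<phi> has_vector_derivative - T u (A x) + T t (A x)) (at u)" if "t < u" for u
        using that rt by (intro der) auto
      show "((\<lambda>u. C / (b + 1) * (u - t) powr (b + 1)) has_vector_derivative C * \<bar>u - t\<bar> powr b) (at u)"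
        if "t < u" for u
      proof -
        have "((\<lambda>u. (u - t) powr (b + 1)) has_real_derivative (b + 1) * (u - t) powr b) (at u)"
          using that by (auto intro!: derivative_eq_intros)
        from DERIV_cmult[OF this, of "C / (b + 1)"] show ?thesis
          unfolding has_real_derivative_iff_has_vector_derivative using that b by simp
      qed
      show "norm (- T u (A x) + T t (A x)) \<le> C * \<bar>u - t\<bar> powr b" if "t < u" for u
        using that rt by (intro nb) auto
    qed
    then show ?thesis using 2 \<phi>t by simp
  next
    case 3
    have "norm (\<phi> t - \<phi> r) \<le> - (C / (b + 1) * (t - t) powr (b + 1)) - (- (C / (b + 1) * (t - r) powr (b + 1)))"
    proof (rule differentiable_bound_general[OF 3 cont[OF rt(1)]])
      show "continuous_on {r..t} (\<lambda>u. - (C / (b + 1) * (t - u) powr (b + 1)))"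
        using b by (intro continuous_intros continuous_on_powr') auto
      show "(\<phi> has_vector_derivative - T u (A x) + T t (A x)) (at u)" if "r < u" for u
        using that rt by (intro der) auto
      show "((\<lambda>u. - (C / (b + 1) * (t - u) powr (b + 1))) has_vector_derivative C * \<bar>u - t\<bar> powr b) (at u)"
        if "r < u" "u < t" for u
      proof -
        have "((\<lambda>u. (t - u) powr (b + 1)) has_real_derivative - ((b + 1) * (t - u) powr b)) (at u)"
          using that by (auto intro!: derivative_eq_intros simp: algebra_simps)
        from DERIV_cmult[OF this, of "- (C / (b + 1))"] show ?thesis
          unfolding has_real_derivative_iff_has_vector_derivative using that b
          by (simp add: abs_if minus_divide_left[symmetric] del: minus_add_distrib)
      qed
      show "norm (- T u (A x) + T t (A x)) \<le> C * \<bar>u - t\<bar> powr b" if "r < u" for u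
        using that rt by (intro nb) auto
    qed
    then show ?thesis using 3 \<phi>t by simp
  qed
  then show ?thesis by (simp add: \<phi>_def)
qed

text \<open>The resolvent \<open>(l + A)\<^sup>-\<^sup>1\<close> as a Laplace transform, for \<open>l > 0\<close>.\<close>

definition R :: "real \<Rightarrow> 'a \<Rightarrow> 'a" where
  "R l x = integral {0<..} (\<lambda>s. exp (- (l * s)) *\<^sub>R T s x)"

lemma laplace_majorant:
  assumes "0 < l"
  shows "((\<lambda>s. - (c / l) * exp (- (l * s))) has_real_derivative c * exp (- (l * s))) (at s)"
    "((\<lambda>s. - (c / l) * exp (- (l * s))) \<longlongrightarrow> - (c / l)) (at_right 0)"
    "((\<lambda>s. - (c / l) * exp (- (l * s))) \<longlongrightarrow> 0) at_top"
proof -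
  show "((\<lambda>s. - (c / l) * exp (- (l * s))) has_real_derivative c * exp (- (l * s))) (at s)"
    using assms by (auto intro!: derivative_eq_intros)
  show "((\<lambda>s. - (c / l) * exp (- (l * s))) \<longlongrightarrow> - (c / l)) (at_right 0)"
    using assms by (auto intro!: tendsto_eq_intros)
  have "((\<lambda>s. exp (- (l * s))) \<longlongrightarrow> 0) at_top" using assms by real_asymp
  from tendsto_mult_left[OF this, of "- (c / l)"]
  show "((\<lambda>s. - (c / l) * exp (- (l * s))) \<longlongrightarrow> 0) at_top" by simp
qed

lemma continuous_laplace_integrand: "continuous_on {0..} (\<lambda>s. exp (- (l * s)) *\<^sub>R T s x)"
  by (intro continuous_intros continuous_orbit)

lemma norm_laplace_integrand: "0 \<le> s \<Longrightarrow> norm (exp (- (l * s)) *\<^sub>R T s x) \<le> (M * norm x) * exp (- (l * s))"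
  using bound[of s x] by (simp add: mult.commute)

lemma R_integrable:
  assumes "0 < l"
  shows "(\<lambda>s. exp (- (l * s)) *\<^sub>R T s x) integrable_on {0<..}" "norm (R l x) \<le> M / l * norm x"
proof -
  show "(\<lambda>s. exp (- (l * s)) *\<^sub>R T s x) integrable_on {0<..}"
    by (rule improper_integral_dominated(1)[OF continuous_on_subset[OF continuous_laplace_integrand]
      laplace_majorant(1)[OF assms] norm_laplace_integrand laplace_majorant(2,3)[OF assms]]) auto
  have "norm (R l x) \<le> 0 - - (M * norm x / l)"
    unfolding R_def
    by (rule improper_integral_dominated(2)[OF continuous_on_subset[OF continuous_laplace_integrand]
      laplace_majorant(1)[OF assms] norm_laplace_integrand laplace_majorant(2,3)[OF assms]]) auto
  then show "norm (R l x) \<le> M / l * norm x" by simp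
qed

lemma bounded_linear_R:
  assumes l: "0 < l"
  shows "bounded_linear (R l)"
proof (rule bounded_linear_intro)
  show "R l (x + y) = R l x + R l y" for x y
  proof -
    have "R l (x + y) = integral {0<..} (\<lambda>s. exp (- (l * s)) *\<^sub>R T s x + exp (- (l * s)) *\<^sub>R T s y)"
      unfolding R_def by (rule integral_cong)
        (simp add: linear_add[OF bounded_linear.linear[OF lin]] scaleR_add_right)
    then show ?thesis
      unfolding R_def by (simp add: integral_add R_integrable(1)[OF l])
  qed
  show "R l (c *\<^sub>R x) = c *\<^sub>R R l x" for c x
  proof -
    have "R l (c *\<^sub>R x) = integral {0<..} (\<lambda>s. c *\<^sub>R (exp (- (l * s)) *\<^sub>R T s x))"
      unfolding R_def by (rule integral_cong) (simp add: T_scaleR mult.commute)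
    then show ?thesis by (simp only: integral_cmul R_def)
  qed
  show "norm (R l x) \<le> norm x * (M / l)" for x
    using R_integrable(2)[OF l, of x] by (simp add: mult.commute)
qed

lemmas R_diff = linear_diff[OF bounded_linear.linear[OF bounded_linear_R]]
  and R_add = linear_add[OF bounded_linear.linear[OF bounded_linear_R]]
  and R_scaleR = linear_cmul[OF bounded_linear.linear[OF bounded_linear_R]]

lemma laplace_orbit_vanishes:
  assumes "0 < l" shows "((\<lambda>s. exp (- (l * s)) *\<^sub>R T s x) \<longlongrightarrow> 0) at_top"
proof (rule Lim_null_comparison)
  show "\<forall>\<^sub>F s in at_top. norm (exp (- (l * s)) *\<^sub>R T s x) \<le> (M * norm x) * exp (- (l * s))"
    using eventually_ge_at_top[of 0] by eventually_elim (rule norm_laplace_integrand)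
  have "((\<lambda>s. exp (- (l * s))) \<longlongrightarrow> 0) at_top" using assms by real_asymp
  from tendsto_mult_left[OF this, of "M * norm x"]
  show "((\<lambda>s. (M * norm x) * exp (- (l * s))) \<longlongrightarrow> 0) at_top" by simp
qed

text \<open>The integrand is the derivative of \<open>- exp (- l s) T(s)x\<close>.\<close>

lemma R_left_inverse:
  assumes l: "0 < l" and x: "x \<in> D"
  shows "R l (l *\<^sub>R x + A x) = x"
proof -
  have "((\<lambda>s. exp (- (l * s)) *\<^sub>R T s (l *\<^sub>R x + A x)) has_integral 0 - - x) {0<..}"
  proof (rule has_integral_improper)
    fix s :: real assume s: "s > 0"
    show "((\<lambda>s. - (exp (- (l * s)) *\<^sub>R T s x)) has_vector_derivative exp (- (l * s)) *\<^sub>R T s (l *\<^sub>R x + A x)) (at s)"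
      using has_vector_derivative_orbit[OF x s] s
      by (auto intro!: derivative_eq_intros has_vector_derivative_minus
          simp: linear_add[OF bounded_linear.linear[OF lin]] T_scaleR algebra_simps)
  next
    show "((\<lambda>s. - (exp (- (l * s)) *\<^sub>R T s x)) \<longlongrightarrow> - x) (at_right 0)"
      using strong[of x] by (auto intro!: tendsto_eq_intros)
    show "((\<lambda>s. - (exp (- (l * s)) *\<^sub>R T s x)) \<longlongrightarrow> 0) at_top"
      using tendsto_minus[OF laplace_orbit_vanishes[OF l, of x]] by simp
  qed
  then show ?thesis unfolding R_def by (simp add: integral_unique)
qed

text \<open>With \<open>F(h) = \<integral>\<^sub>0\<^sup>h exp (- l s) T(s)x ds\<close> and \<open>L = R l x\<close> a shift of the integration variable gives
  \<open>T(h)L = exp (l h) (L - F(h))\<close>, whose difference quotient at \<open>0\<close> tends to \<open>l L - x\<close>.\<close>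

lemma R_right_inverse:
  assumes l: "0 < l"
  shows "R l x \<in> D" "A (R l x) = x - l *\<^sub>R R l x"
proof -
  define f where "f s = exp (- (l * s)) *\<^sub>R T s x" for s
  define F where "F h = integral {0..h} f" for h
  have cf: "continuous_on {0..b} f" for b
    unfolding f_def by (rule continuous_on_subset[OF continuous_laplace_integrand]) auto
  have Fw: "(F has_vector_derivative f s) (at s within {0..b})" if "s \<in> {0..b}" for s b
    unfolding F_def[abs_def] by (rule integral_has_vector_derivative[OF cf that])
  have F: "(F has_vector_derivative f s) (at s)" if "s > 0" for s
    using Fw[of s "s + 1"] at_within_Icc_at[of 0 s "s + 1"] that by simp
  obtain L where L: "(F \<longlongrightarrow> L) at_top"
    by (rule antiderivative_limits_dominated[OF F laplace_majorant(1)[OF l, of "M * norm x"] _ laplace_majorant(2,3)[OF l]])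
      (use norm_laplace_integrand in \<open>auto simp: f_def\<close>)
  have F0: "F 0 = 0" and f0: "f 0 = x" by (simp_all add: F_def f_def T_0)
  have at0: "at 0 within {0..1} = at_right (0::real)" by (rule at_within_Icc_at_right) simp
  have L0: "(F \<longlongrightarrow> 0) (at_right 0)"
    using has_vector_derivative_continuous[OF Fw[of 0 1]] F0 unfolding continuous_within at0 by simp
  have dq: "((\<lambda>h. F h /\<^sub>R h) \<longlongrightarrow> x) (at_right 0)"
  proof (rule LIM_zero_cancel, rule tendsto_norm_zero_cancel)
    have "((\<lambda>y. norm (F y - F 0 - (y - 0) *\<^sub>R f 0) / norm (y - 0)) \<longlongrightarrow> 0) (at_right 0)"
      using Fw[of 0 1] unfolding has_vector_derivative_def has_derivative_iff_norm at0 by simp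
    then show "((\<lambda>h. norm (F h /\<^sub>R h - x)) \<longlongrightarrow> 0) (at_right 0)"
    proof (rule Lim_transform_eventually)
      have "norm (F y - F 0 - (y - 0) *\<^sub>R f 0) / norm (y - 0) = norm (F y /\<^sub>R y - x)" if "y > 0" for y
      proof -
        have "F y /\<^sub>R y - x = (F y - y *\<^sub>R x) /\<^sub>R y" using that by (simp add: scaleR_diff_right)
        then show ?thesis using that by (simp add: F0 f0 divide_inverse mult.commute)
      qed
      then show "\<forall>\<^sub>F y in at_right 0. norm (F y - F 0 - (y - 0) *\<^sub>R f 0) / norm (y - 0) = norm (F y /\<^sub>R y - x)"
        unfolding eventually_at_right_field by (intro exI[of _ 1]) auto
    qed
  qed
  have RL: "R l x = L"
    using has_integral_improper[OF F L0 L] unfolding R_def f_def by (simp add: integral_unique)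
  have TL: "T h L = exp (l * h) *\<^sub>R (L - F h)" if h: "h > 0" for h
  proof -
    have "T h L = integral {0<..} (T h \<circ> (\<lambda>s. exp (- (l * s)) *\<^sub>R T s x))"
      unfolding RL[symmetric] R_def by (rule integral_linear[OF R_integrable(1)[OF l] lin, symmetric]) (use h in simp)
    also have "\<dots> = integral {0<..} (\<lambda>s. exp (l * h) *\<^sub>R f (s + h))"
    proof (rule integral_cong)
      fix s :: real assume "s \<in> {0<..}"
      then have "T h (T s x) = T (s + h) x" using h T_add[of h s x] by (simp add: add.commute)
      then show "(T h \<circ> (\<lambda>s. exp (- (l * s)) *\<^sub>R T s x)) s = exp (l * h) *\<^sub>R f (s + h)"
        using h by (simp add: f_def T_scaleR exp_add[symmetric] algebra_simps)
    qed
    also have "\<dots> = exp (l * h) *\<^sub>R L - exp (l * h) *\<^sub>R F h"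
    proof (rule integral_unique[OF has_integral_improper])
      fix s :: real assume s: "s > 0"
      have "(F \<circ> (\<lambda>s. s + h) has_vector_derivative 1 *\<^sub>R f (s + h)) (at s)"
        by (rule vector_diff_chain_at) (use F[of "s + h"] s h in \<open>auto intro!: derivative_eq_intros\<close>)
      then show "((\<lambda>s. exp (l * h) *\<^sub>R F (s + h)) has_vector_derivative exp (l * h) *\<^sub>R f (s + h)) (at s)"
        by (auto intro!: derivative_eq_intros simp: comp_def)
    next
      have "((\<lambda>s. F (s + h)) \<longlongrightarrow> F (0 + h)) (at_right 0)"
      proof (rule isCont_tendsto_compose[of _ F])
        show "isCont F (0 + h)" using has_vector_derivative_continuous[OF F[OF h]] by simp
      qed (auto intro!: tendsto_eq_intros)
      then show "((\<lambda>s. exp (l * h) *\<^sub>R F (s + h)) \<longlongrightarrow> exp (l * h) *\<^sub>R F h) (at_right 0)"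
        by (auto intro!: tendsto_intros)
      have "((\<lambda>s. F (s + h)) \<longlongrightarrow> L) at_top"
        by (rule filterlim_compose[OF L]) real_asymp
      then show "((\<lambda>s. exp (l * h) *\<^sub>R F (s + h)) \<longlongrightarrow> exp (l * h) *\<^sub>R L) at_top"
        by (auto intro!: tendsto_intros)
    qed
    finally show ?thesis by (simp add: scaleR_diff_right)
  qed
  have "((\<lambda>h. ((exp (l * h) - 1) / h) *\<^sub>R L - exp (l * h) *\<^sub>R (F h /\<^sub>R h)) \<longlongrightarrow> l *\<^sub>R L - exp (l * 0) *\<^sub>R x) (at_right 0)"
  proof (intro tendsto_intros dq)
    show "((\<lambda>h. (exp (l * h) - 1) / h) \<longlongrightarrow> l) (at_right 0)" using l by real_asymp
  qed
  then have "((\<lambda>h. (T h L - L) /\<^sub>R h) \<longlongrightarrow> l *\<^sub>R L - exp (l * 0) *\<^sub>R x) (at_right 0)"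
  proof (rule Lim_transform_eventually)
    have "((exp (l * h) - 1) / h) *\<^sub>R L - exp (l * h) *\<^sub>R (F h /\<^sub>R h) = (T h L - L) /\<^sub>R h" if "h > 0" for h
      unfolding TL[OF that] using that by (simp add: divide_inverse algebra_simps)
    then show "\<forall>\<^sub>F h in at_right 0. ((exp (l * h) - 1) / h) *\<^sub>R L - exp (l * h) *\<^sub>R (F h /\<^sub>R h) = (T h L - L) /\<^sub>R h"
      unfolding eventually_at_right_field by (intro exI[of _ 1]) auto
  qed
  then have "L \<in> D \<and> A L = - (l *\<^sub>R L - exp (l * 0) *\<^sub>R x)" by (rule A_eqI)
  then show "R l x \<in> D" "A (R l x) = x - l *\<^sub>R R l x" unfolding RL by simp_all
qed

end

section \<open>Fractional powers and the Balakrishnan operator\<close>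

context bounded_semigroup
begin

lemma R_inj: "0 < l \<Longrightarrow> R l y = R l z \<Longrightarrow> y = z"
  using R_right_inverse(2)[of l y] R_right_inverse(2)[of l z] by (metis diff_add_cancel)

lemma resolvent_neg_eq: "0 < l \<Longrightarrow> resolvent_neg D A l y = R l y"
proof -
  assume l: "0 < l"
  have "inj_on (\<lambda>x. l *\<^sub>R x + A x) D" using R_left_inverse[OF l] by (intro inj_on_inverseI)
  from inv_into_f_f[OF this R_right_inverse(1)[OF l, of y]] show ?thesis
    unfolding resolvent_neg_def by (simp add: R_right_inverse(2)[OF l])
qed

lemma resolvent_identity:
  assumes l: "0 < l" and m: "0 < m"
  shows "R l x - R m x = (m - l) *\<^sub>R R l (R m x)"
proof -
  have "R m x = R l (l *\<^sub>R R m x + (x - m *\<^sub>R R m x))"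
    using R_left_inverse[OF l R_right_inverse(1)[OF m]] by (simp add: R_right_inverse(2)[OF m])
  also have "\<dots> = R l x - (m - l) *\<^sub>R R l (R m x)"
    by (simp add: R_add[OF l] R_diff[OF l] R_scaleR[OF l] algebra_simps)
  finally show ?thesis by (simp add: algebra_simps)
qed

lemma R_commute:
  assumes l: "0 < l" and m: "0 < m"
  shows "R l (R m x) = R m (R l x)"
proof (cases "l = m")
  case False
  have "(m - l) *\<^sub>R R l (R m x) = - ((l - m) *\<^sub>R R m (R l x))"
    using resolvent_identity[OF l m, of x] resolvent_identity[OF m l, of x] by (metis minus_diff_eq)
  also have "\<dots> = (m - l) *\<^sub>R R m (R l x)" by (simp add: scaleR_left_diff_distrib)
  finally have "(m - l) *\<^sub>R R l (R m x) = (m - l) *\<^sub>R R m (R l x)" .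
  then show ?thesis using False by simp
qed simp

lemma has_vector_derivative_R:
  assumes l: "0 < l"
  shows "((\<lambda>m. R m x) has_vector_derivative - R l (R l x)) (at l)"
proof -
  have lip: "norm (R m y - R l y) \<le> (M * (M * norm y) / (l * l) * 2) * \<bar>m - l\<bar>" if "l / 2 < m" for m y
  proof -
    have m: "0 < m" using that l by linarith
    have e: "norm (R m y - R l y) = \<bar>m - l\<bar> * norm (R m (R l y))"
      unfolding resolvent_identity[OF m l] by (simp add: abs_minus_commute)
    have "norm (R m (R l y)) \<le> M / m * (M / l * norm y)"
      using R_integrable(2)[OF m, of "R l y"] R_integrable(2)[OF l, of y] M_nonneg m
      by (intro order_trans[OF R_integrable(2)[OF m]] mult_left_mono) auto
    also have "\<dots> \<le> M / (l / 2) * (M / l * norm y)"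
      using that l M_nonneg by (intro mult_right_mono divide_left_mono) auto
    also have "\<dots> = M * (M * norm y) / (l * l) * 2" using l by (simp add: field_simps)
    finally have "\<bar>m - l\<bar> * norm (R m (R l y)) \<le> \<bar>m - l\<bar> * (M * (M * norm y) / (l * l) * 2)"
      by (rule mult_left_mono) simp
    then show ?thesis unfolding e by (simp only: mult.commute)
  qed
  have ev: "\<forall>\<^sub>F m in at l. l / 2 < m"
    using l by (intro order_tendstoD(1)[OF tendsto_ident_at]) auto
  have cont: "((\<lambda>m. R m y) \<longlongrightarrow> R l y) (at l)" for y
  proof (rule LIM_zero_cancel, rule Lim_null_comparison)
    show "\<forall>\<^sub>F m in at l. norm (R m y - R l y) \<le> (M * (M * norm y) / (l * l) * 2) * \<bar>m - l\<bar>"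
      using ev by eventually_elim (rule lip)
    show "((\<lambda>m. (M * (M * norm y) / (l * l) * 2) * \<bar>m - l\<bar>) \<longlongrightarrow> 0) (at l)"
      using l by (auto intro!: tendsto_eq_intros)
  qed
  have "((\<lambda>m. norm (R m (R l x) - R l (R l x))) \<longlongrightarrow> 0) (at l)"
    by (rule tendsto_norm_zero[OF LIM_zero[OF cont]])
  then have "((\<lambda>m. norm (R m x - R l x - (m - l) *\<^sub>R (- R l (R l x))) / norm (m - l)) \<longlongrightarrow> 0) (at l)"
  proof (rule Lim_transform_eventually)
    have ne: "\<forall>\<^sub>F m in at l. m \<noteq> l" by (simp add: eventually_at_filter)
    show "\<forall>\<^sub>F m in at l. norm (R m (R l x) - R l (R l x))
        = norm (R m x - R l x - (m - l) *\<^sub>R (- R l (R l x))) / norm (m - l)"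
      using ev ne
    proof eventually_elim
      case (elim m)
      then have m: "0 < m" using l by linarith
      have "R m x - R l x - (m - l) *\<^sub>R (- R l (R l x)) = (l - m) *\<^sub>R (R m (R l x) - R l (R l x))"
        unfolding resolvent_identity[OF m l, of x] by (simp add: algebra_simps)
      then show ?case using elim by (simp add: abs_minus_commute)
    qed
  qed
  then show ?thesis
    unfolding has_vector_derivative_def has_derivative_iff_norm
    by (auto intro: bounded_linear_minus bounded_linear_scaleR_left)
qed

text \<open>The bounded operator \<open>A (l + A)\<^sup>-\<^sup>1\<close>, which is defined on all of the space in this form.\<close>

definition AR :: "real \<Rightarrow> 'a \<Rightarrow> 'a" where
  "AR l x = x - l *\<^sub>R R l x"

lemma A_R: "0 < l \<Longrightarrow> A (R l x) = AR l x"
  by (simp add: AR_def R_right_inverse)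

lemma AR_dom:
  assumes l: "0 < l" and x: "x \<in> D"
  shows "AR l x = R l (A x)"
  using R_left_inverse[OF l x] unfolding AR_def R_add[OF l] R_scaleR[OF l]
  by (metis add_diff_cancel_left')

lemma R_AR: "0 < l \<Longrightarrow> 0 < m \<Longrightarrow> R l (AR m x) = AR m (R l x)"
  by (simp add: AR_def R_diff R_scaleR R_commute[of l m])

lemma has_vector_derivative_AR:
  assumes l: "0 < l"
  shows "((\<lambda>m. AR m x) has_vector_derivative - R l (AR l x)) (at l)"
  unfolding AR_def[abs_def]
  by (auto intro!: derivative_eq_intros has_vector_derivative_R[OF l] simp: R_diff[OF l] R_scaleR[OF l])

lemma continuous_AR: "continuous_on {0<..} (\<lambda>l. AR l x)"
  by (intro continuous_at_imp_continuous_on ballI has_vector_derivative_continuous[OF has_vector_derivative_AR]) auto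

lemma norm_l_R: "0 < l \<Longrightarrow> norm (l *\<^sub>R R l x) \<le> M * norm x"
  using R_integrable(2)[of l x] by (simp add: field_simps)

lemma norm_AR: "0 < l \<Longrightarrow> norm (AR l x) \<le> (1 + M) * norm x"
  unfolding AR_def using norm_l_R[of l x] by (intro order_trans[OF norm_triangle_ineq4]) (simp add: algebra_simps)

text \<open>Both decay regimes in one inequality: bounded for small \<open>l\<close>, and of order \<open>1/l\<close> for large \<open>l\<close>.\<close>

lemma norm_AR_dom: "0 < l \<Longrightarrow> x \<in> D \<Longrightarrow> (1 + l) * norm (AR l x) \<le> (1 + M) * norm x + M * norm (A x)"
  using norm_AR[of l x] norm_l_R[of l "A x"] AR_dom[of l x] by (simp add: algebra_simps)

end

text \<open>The majorant \<open>l\<^sup>b\<^sup>-\<^sup>1 e/(l + e)\<close> behaves like \<open>l\<^sup>b\<^sup>-\<^sup>1\<close> at \<open>0\<close> and like \<open>l\<^sup>b\<^sup>-\<^sup>2\<close> at infinity. The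
  explicit primitive \<open>\<Psi>\<close> below has a derivative with the same behaviour; the general \<open>e\<close> follows by
  scaling. The factor \<open>e\<^sup>b\<close> is what makes the regularisation by \<open>e + A\<close> converge.\<close>

lemma fractional_kernel_integral:
  fixes f :: "real \<Rightarrow> 'a::banach"
  assumes b: "0 < b" "b < 1" and f: "continuous_on {0<..} f" and e: "0 < e" and C: "0 \<le> C"
    and nf: "\<And>l. l > 0 \<Longrightarrow> norm (f l) \<le> C * (l powr (b - 1) * (e / (l + e)))"
  shows "f integrable_on {0<..}" "norm (integral {0<..} f) \<le> C * (4 / b + 4 / (1 - b)) * e powr b"
proof -
  \<comment> \<open>The first summand serves \<open>l \<le> 1\<close>, the second one \<open>l > 1\<close>.\<close>
  define k where "k = 2 / b + 2 / (1 - b)"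
  have k: "k > 0" using b by (simp add: k_def add_pos_pos)
  define \<Psi> where "\<Psi> l = (l / (1 + l)) powr b - (1 + l) powr (b - 1)" for l :: real
  define \<phi> where "\<phi> l = b * l powr (b - 1) * (1 + l) powr (- 1 - b) + (1 - b) * (1 + l) powr (b - 2)" for l :: real
  have D: "(\<Psi> has_real_derivative \<phi> l) (at l)" if l: "l > 0" for l
  proof -
    have e: "(l / (1 + l)) powr (b - 1) * (1 / (1 + l)\<^sup>2) = l powr (b - 1) * (1 + l) powr (- 1 - b)"
    proof -
      have "(1 + l) powr (b - 1) * (1 + l) powr (- 1 - b) = 1 / (1 + l)\<^sup>2"
        using l by (simp add: powr_add[symmetric] powr_minus_divide flip: powr_numeral)
      then have "l powr (b - 1) * (1 + l) powr (- 1 - b) = l powr (b - 1) / (1 + l) powr (b - 1) * (1 / (1 + l)\<^sup>2)"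
        using l by (simp add: field_simps)
      then show ?thesis using l by (simp add: powr_divide)
    qed
    have "((\<lambda>l. l / (1 + l)) has_real_derivative 1 / (1 + l)\<^sup>2) (at l)"
      using l by (auto intro!: derivative_eq_intros simp: power2_eq_square field_simps)
    note 1 = this
    have "0 < l / (1 + l)" using l by simp
    from DERIV_chain2[where f = "\<lambda>z. z powr b", OF has_real_derivative_powr[OF this, of b] 1]
    have "((\<lambda>l. (l / (1 + l)) powr b) has_real_derivative b * ((l / (1 + l)) powr (b - 1) * (1 / (1 + l)\<^sup>2))) (at l)"
      by (simp only: mult.assoc)
    moreover have "((\<lambda>l. (1 + l) powr (b - 1)) has_real_derivative (b - 1) * (1 + l) powr (b - 2)) (at l)"
      using l by (auto intro!: derivative_eq_intros)
    ultimately have "(\<Psi> has_real_derivative b * (l powr (b - 1) * (1 + l) powr (- 1 - b))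
        - (b - 1) * (1 + l) powr (b - 2)) (at l)"
      unfolding \<Psi>_def[abs_def] e by (rule DERIV_diff)
    moreover have "\<phi> l = b * (l powr (b - 1) * (1 + l) powr (- 1 - b)) - (b - 1) * (1 + l) powr (b - 2)"
      by (simp add: \<phi>_def algebra_simps)
    ultimately show ?thesis by simp
  qed
  have le: "l powr (b - 1) / (1 + l) \<le> k * \<phi> l" if l: "l > 0" for l
  proof (cases "l \<le> 1")
    case True
    have "(1 + l) powr b \<le> 2 powr 1"
      using True l b by (intro order_trans[OF powr_mono2[of b "1 + l" 2]] powr_mono) auto
    then have h: "1 / (1 + l) \<le> 2 * (1 + l) powr (- 1 - b)"
    proof -
      have "1 / (1 + l) * 1 \<le> 1 / (1 + l) * (2 / (1 + l) powr b)"
        using l \<open>(1 + l) powr b \<le> 2 powr 1\<close> by (intro mult_left_mono) (auto simp: pos_le_divide_eq)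
      also have "\<dots> = 2 * (1 + l) powr (- 1 - b)" using l by (simp add: powr_diff powr_minus_divide)
      finally show ?thesis by simp
    qed
    have "l powr (b - 1) / (1 + l) \<le> l powr (b - 1) * (2 * (1 + l) powr (- 1 - b))"
      using mult_left_mono[OF h, of "l powr (b - 1)"] by simp
    also have "\<dots> = 2 / b * (b * l powr (b - 1) * (1 + l) powr (- 1 - b))" using b by simp
    also have "\<dots> \<le> k * \<phi> l"
      using b l unfolding k_def \<phi>_def by (intro mult_mono) auto
    finally show ?thesis .
  next
    case False
    have "(1 + l) powr (1 - b) \<le> (2 * l) powr (1 - b)" using False b by (intro powr_mono2) auto
    also have "\<dots> \<le> 2 powr 1 * l powr (1 - b)"
      using l b powr_mono[of "1 - b" 1 "2 :: real"] by (subst powr_mult) (auto intro!: mult_right_mono)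
    finally have "(1 + l) powr (1 - b) \<le> 2 powr 1 * l powr (1 - b)" .
    have "l powr (b - 1) \<le> 2 * (1 + l) powr (b - 1)"
    proof -
      have "l powr (b - 1) = 1 / l powr (1 - b)" "(1 + l) powr (b - 1) = 1 / (1 + l) powr (1 - b)"
        using powr_minus_divide[of l "1 - b"] powr_minus_divide[of "1 + l" "1 - b"] by simp_all
      moreover have "1 / p \<le> 2 * (1 / q)" if "0 < p" "0 < q" "q \<le> 2 * p" for p q :: real
        using that by (simp add: field_simps)
      ultimately show ?thesis
        using \<open>(1 + l) powr (1 - b) \<le> 2 powr 1 * l powr (1 - b)\<close> l by simp
    qed
    then have "l powr (b - 1) / (1 + l) \<le> 2 * (1 + l) powr (b - 1) / (1 + l)"
      using l by (intro divide_right_mono) auto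
    also have "\<dots> = 2 * (1 + l) powr (b - 2)" using l by (simp add: powr_diff power2_eq_square)
    also have "\<dots> = 2 / (1 - b) * ((1 - b) * (1 + l) powr (b - 2))" using b by simp
    also have "\<dots> \<le> k * \<phi> l"
      using b l unfolding k_def \<phi>_def by (intro mult_mono) auto
    finally show ?thesis .
  qed
  have lim0: "(\<Psi> \<longlongrightarrow> - 1) (at_right 0)" unfolding \<Psi>_def using b by real_asymp
  have lim1: "(\<Psi> \<longlongrightarrow> 1) at_top" unfolding \<Psi>_def using b by real_asymp
  define c where "c = C * k * e powr b"
  have D': "((\<lambda>l. c * \<Psi> (l / e)) has_real_derivative c * (\<phi> (l / e) / e)) (at l)" if "l > 0" for l
  proof (rule DERIV_cmult)
    have "((\<lambda>l. l / e) has_real_derivative 1 / e) (at l)" using e by (auto intro!: derivative_eq_intros)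
    from DERIV_chain2[OF D this] show "((\<lambda>l. \<Psi> (l / e)) has_real_derivative \<phi> (l / e) / e) (at l)"
      using that e by simp
  qed
  have le': "norm (f l) \<le> c * (\<phi> (l / e) / e)" if l: "l > 0" for l
  proof -
    have pw: "(l / e) powr (b - 1) = l powr (b - 1) / (e powr b / e)"
      using l e by (simp add: powr_divide powr_diff)
    have fr: "1 / (1 + l / e) = e / (l + e)" using l e by (simp add: field_simps)
    have "(l / e) powr (b - 1) / (1 + l / e) * (e powr b / e)
        = (l / e) powr (b - 1) * (e powr b / e) * (1 / (1 + l / e))" by simp
    also have "\<dots> = l powr (b - 1) * (e / (l + e))" unfolding pw fr using e by simp
    finally have "l powr (b - 1) * (e / (l + e)) = (l / e) powr (b - 1) / (1 + l / e) * (e powr b / e)" ..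
    also have "\<dots> \<le> k * \<phi> (l / e) * (e powr b / e)"
      using e l by (intro mult_right_mono le) auto
    finally have "C * (l powr (b - 1) * (e / (l + e))) \<le> C * (k * \<phi> (l / e) * (e powr b / e))"
      using C by (intro mult_left_mono)
    then show ?thesis using nf[OF l] by (simp add: c_def mult_ac)
  qed
  have e0: "filterlim (\<lambda>l. l / e) (at_right 0) (at_right 0)" using e by real_asymp
  have e1: "filterlim (\<lambda>l. l / e) at_top at_top" using e by real_asymp
  have p: "((\<lambda>l. c * \<Psi> (l / e)) \<longlongrightarrow> c * (- 1)) (at_right 0)"
    by (intro tendsto_mult_left filterlim_compose[OF lim0 e0])
  have q: "((\<lambda>l. c * \<Psi> (l / e)) \<longlongrightarrow> c * 1) at_top"
    by (intro tendsto_mult_left filterlim_compose[OF lim1 e1])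
  show "f integrable_on {0<..}" by (rule improper_integral_dominated[OF f D' le' p q])
  have "norm (integral {0<..} f) \<le> c * 1 - c * (- 1)" by (rule improper_integral_dominated[OF f D' le' p q])
  also have "\<dots> = C * (4 / b + 4 / (1 - b)) * e powr b" by (simp add: c_def k_def algebra_simps)
  finally show "norm (integral {0<..} f) \<le> C * (4 / b + 4 / (1 - b)) * e powr b" .
qed

context bounded_semigroup
begin

text \<open>The Balakrishnan formula of order \<open>b \<in> (0,1)\<close>, meaningful on the domain of \<open>A\<close>.\<close>

definition A_pow :: "real \<Rightarrow> 'a \<Rightarrow> 'a" where
  "A_pow b x = (1 / (Gamma b * Gamma (1 - b))) *\<^sub>R integral {0<..} (\<lambda>l. l powr (b - 1) *\<^sub>R AR l x)"

lemma continuous_A_pow_integrand: "continuous_on {0<..} (\<lambda>l. l powr c *\<^sub>R AR l x)"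
  by (intro continuous_intros continuous_AR) auto

lemma norm_A_pow_integrand:
  assumes x: "x \<in> D" and l: "l > 0"
  shows "norm (l powr (b - 1) *\<^sub>R AR l x) \<le> ((1 + M) * norm x + M * norm (A x)) * (l powr (b - 1) * (1 / (l + 1)))"
proof -
  have "norm (AR l x) \<le> ((1 + M) * norm x + M * norm (A x)) * (1 / (l + 1))"
    using norm_AR_dom[OF l x] l by (simp add: field_simps)
  then have "l powr (b - 1) * norm (AR l x) \<le> l powr (b - 1) * (((1 + M) * norm x + M * norm (A x)) * (1 / (l + 1)))"
    by (intro mult_left_mono) auto
  then show ?thesis by (simp add: mult_ac)
qed

lemma A_pow_integrable:
  assumes b: "0 < b" "b < 1" and x: "x \<in> D"
  shows "(\<lambda>l. l powr (b - 1) *\<^sub>R AR l x) integrable_on {0<..}"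
  by (rule fractional_kernel_integral(1)[OF b continuous_A_pow_integrand zero_less_one _ norm_A_pow_integrand[OF x]])
    (use M_nonneg in simp)

lemma norm_A_pow_le:
  assumes b: "0 < b" "b < 1"
  obtains K where "K \<ge> 0" "\<And>x. x \<in> D \<Longrightarrow> norm (A_pow b x) \<le> K * (norm x + norm (A x))"
proof -
  define g where "g = 1 / (Gamma b * Gamma (1 - b))"
  define k where "k = 4 / b + 4 / (1 - b)"
  have g: "g \<ge> 0" "k \<ge> 0" using b by (simp_all add: g_def k_def Gamma_real_pos less_imp_le)
  show ?thesis
  proof (rule that[of "g * (1 + M) * k"])
    show "0 \<le> g * (1 + M) * k" using g M_nonneg by simp
    fix x assume x: "x \<in> D"
    have "norm (integral {0<..} (\<lambda>l. l powr (b - 1) *\<^sub>R AR l x)) \<le> ((1 + M) * norm x + M * norm (A x)) * k * 1 powr b"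
      unfolding k_def
      by (rule fractional_kernel_integral(2)[OF b continuous_A_pow_integrand zero_less_one _ norm_A_pow_integrand[OF x]])
        (use M_nonneg in simp)
    then have "norm (A_pow b x) \<le> g * (((1 + M) * norm x + M * norm (A x)) * k)"
      unfolding A_pow_def g_def[symmetric] using g by (simp add: mult_left_mono)
    also have "\<dots> \<le> g * (((1 + M) * norm x + (1 + M) * norm (A x)) * k)"
      using g by (intro mult_left_mono mult_right_mono add_left_mono) auto
    finally show "norm (A_pow b x) \<le> g * (1 + M) * k * (norm x + norm (A x))" by (simp add: algebra_simps)
  qed
qed

text \<open>Composition with one resolvent turns the fractional power into a bounded operator.\<close>

lemma bounded_linear_A_pow_R:
  assumes b: "0 < b" "b < 1"
  shows "bounded_linear (\<lambda>x. A_pow b (R 1 x))"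
proof -
  obtain K where K: "K \<ge> 0" "\<And>x. x \<in> D \<Longrightarrow> norm (A_pow b x) \<le> K * (norm x + norm (A x))"
    using norm_A_pow_le[OF b] by metis
  have RD: "R 1 x \<in> D" for x by (rule R_right_inverse) simp
  show ?thesis
  proof (rule bounded_linear_intro)
    fix x y
    have "integral {0<..} (\<lambda>l. l powr (b - 1) *\<^sub>R AR l (R 1 (x + y)))
      = integral {0<..} (\<lambda>l. l powr (b - 1) *\<^sub>R AR l (R 1 x) + l powr (b - 1) *\<^sub>R AR l (R 1 y))"
      by (rule integral_cong) (simp add: AR_def R_add algebra_simps)
    then show "A_pow b (R 1 (x + y)) = A_pow b (R 1 x) + A_pow b (R 1 y)"
      unfolding A_pow_def by (simp add: integral_add[OF A_pow_integrable[OF b RD] A_pow_integrable[OF b RD]] scaleR_add_right)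
  next
    fix c x
    have "integral {0<..} (\<lambda>l. l powr (b - 1) *\<^sub>R AR l (R 1 (c *\<^sub>R x)))
      = integral {0<..} (\<lambda>l. c *\<^sub>R (l powr (b - 1) *\<^sub>R AR l (R 1 x)))"
      by (rule integral_cong) (simp add: AR_def R_scaleR algebra_simps)
    then show "A_pow b (R 1 (c *\<^sub>R x)) = c *\<^sub>R A_pow b (R 1 x)"
      unfolding A_pow_def by (simp only: integral_cmul scaleR_left_commute)
  next
    fix x
    have "norm (A_pow b (R 1 x)) \<le> K * (norm (R 1 x) + norm (AR 1 x))"
      using K(2)[OF RD, of x] by (simp add: A_R)
    also have "\<dots> \<le> K * (M * norm x + (1 + M) * norm x)"
      using K(1) norm_AR[of 1 x] R_integrable(2)[of 1 x] by (intro mult_left_mono add_mono) auto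
    finally show "norm (A_pow b (R 1 x)) \<le> norm x * (K * (1 + 2 * M))" by (simp add: algebra_simps)
  qed
qed

lemma R_A_pow:
  assumes b: "0 < b" "b < 1" and x: "x \<in> D"
  shows "R 1 (A_pow b x) = A_pow b (R 1 x)"
proof -
  from integral_linear[OF A_pow_integrable[OF b x] bounded_linear_R[of 1]]
  have "R 1 (integral {0<..} (\<lambda>l. l powr (b - 1) *\<^sub>R AR l x))
    = integral {0<..} (R 1 \<circ> (\<lambda>l. l powr (b - 1) *\<^sub>R AR l x))" by simp
  also have "\<dots> = integral {0<..} (\<lambda>l. l powr (b - 1) *\<^sub>R AR l (R 1 x))"
    by (rule integral_cong) (simp add: R_scaleR R_AR)
  finally show ?thesis unfolding A_pow_def by (simp add: R_scaleR)
qed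

lemma balakrishnan_lt_1:
  assumes "0 < \<alpha>" "\<alpha> < 1"
  shows "balakrishnan D A \<alpha> x = A_pow \<alpha> x"
proof -
  have o: "frac_order \<alpha> = 1" unfolding frac_order_def using assms by (simp add: floor_eq_iff)
  have "integral {0<..} (\<lambda>l. l powr (\<alpha> - 1) *\<^sub>R A (resolvent_neg D A l x))
    = integral {0<..} (\<lambda>l. l powr (\<alpha> - 1) *\<^sub>R AR l x)"
    by (rule integral_cong) (simp add: resolvent_neg_eq A_R)
  then show ?thesis unfolding balakrishnan_def A_pow_def o by simp
qed

lemma dom_pow_2D:
  assumes "x \<in> dom_pow D A 2" shows "x \<in> D" "A x \<in> D"
  using assms unfolding dom_pow_def by (auto dest: spec[of _ 0] spec[of _ 1])

lemma frac_order_2: "1 \<le> \<alpha> \<Longrightarrow> \<alpha> < 2 \<Longrightarrow> frac_order \<alpha> = 2"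
  using floor_unique[of 1 \<alpha>] by (simp add: frac_order_def)

lemma balakrishnan_order_2:
  assumes "1 \<le> \<alpha>" "\<alpha> < 2"
  shows "balakrishnan D A \<alpha> x = (1 / (Gamma \<alpha> * Gamma (2 - \<alpha>))) *\<^sub>R
    integral {0<..} (\<lambda>l. l powr (\<alpha> - 1) *\<^sub>R AR l (AR l x))"
proof -
  have "integral {0<..} (\<lambda>l. l powr (\<alpha> - 1) *\<^sub>R ((\<lambda>y. A (resolvent_neg D A l y)) ^^ 2) x)
    = integral {0<..} (\<lambda>l. l powr (\<alpha> - 1) *\<^sub>R AR l (AR l x))"
    by (rule integral_cong) (simp add: resolvent_neg_eq A_R numeral_2_eq_2)
  then show ?thesis unfolding balakrishnan_def frac_order_2[OF assms]
    using Gamma_fact[of 1, where 'a = real] by simp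
qed

lemma AR_vanishes_at_top: "x \<in> D \<Longrightarrow> ((\<lambda>l. AR l x) \<longlongrightarrow> 0) at_top"
proof (rule Lim_null_comparison)
  assume x: "x \<in> D"
  show "\<forall>\<^sub>F l in at_top. norm (AR l x) \<le> ((1 + M) * norm x + M * norm (A x)) * (1 / (1 + l))"
    using eventually_gt_at_top[of 0]
  proof eventually_elim
    case (elim l)
    then show ?case using norm_AR_dom[OF elim x] by (simp add: field_simps)
  qed
  have "((\<lambda>l::real. 1 / (1 + l)) \<longlongrightarrow> 0) at_top" by real_asymp
  from tendsto_mult_left[OF this]
  show "((\<lambda>l. ((1 + M) * norm x + M * norm (A x)) * (1 / (1 + l))) \<longlongrightarrow> 0) at_top" by simp
qed

lemma AR_AR: "0 < l \<Longrightarrow> AR l (AR l x) = AR l x - l *\<^sub>R R l (AR l x)"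
  by (simp add: AR_def)

text \<open>Here \<open>(A R\<^sub>l)\<^sup>2 x\<close> is the derivative of \<open>l A R\<^sub>l x\<close>, which runs from \<open>0\<close> to \<open>Ax\<close>.\<close>

lemma balakrishnan_1:
  assumes x: "x \<in> dom_pow D A 2"
  shows "balakrishnan D A 1 x = A x"
proof -
  note xD = dom_pow_2D[OF x]
  have "((\<lambda>l. AR l (AR l x)) has_integral A x - 0) {0<..}"
  proof (rule has_integral_improper)
    fix l :: real assume l: "l > 0"
    show "((\<lambda>l. l *\<^sub>R AR l x) has_vector_derivative AR l (AR l x)) (at l)"
      unfolding AR_AR[OF l]
      by (auto intro!: derivative_eq_intros has_vector_derivative_AR[OF l])
  next
    show "((\<lambda>l. l *\<^sub>R AR l x) \<longlongrightarrow> 0) (at_right 0)"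
    proof (rule Lim_null_comparison)
      show "\<forall>\<^sub>F l in at_right 0. norm (l *\<^sub>R AR l x) \<le> l * ((1 + M) * norm x)"
        unfolding eventually_at_right_field by (auto intro!: exI[of _ 1] mult_left_mono norm_AR)
    qed (auto intro!: tendsto_eq_intros)
    have "((\<lambda>l. A x - AR l (A x)) \<longlongrightarrow> A x) at_top"
      using tendsto_diff[OF tendsto_const AR_vanishes_at_top[OF xD(2)], of "A x"] by simp
    then show "((\<lambda>l. l *\<^sub>R AR l x) \<longlongrightarrow> A x) at_top"
    proof (rule Lim_transform_eventually)
      show "\<forall>\<^sub>F l in at_top. A x - AR l (A x) = l *\<^sub>R AR l x"
        using eventually_gt_at_top[of 0]
        by eventually_elim (simp add: AR_def[of _ "A x"] AR_dom[OF _ xD(1)])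
    qed
  qed
  moreover have "integral {0<..} (\<lambda>l. l powr 0 *\<^sub>R AR l (AR l x)) = integral {0<..} (\<lambda>l. AR l (AR l x))"
    by (rule integral_cong) simp
  ultimately show ?thesis
    using balakrishnan_order_2[of 1 x] by (simp add: integral_unique)
qed

text \<open>Integration by parts. The function \<open>l\<^sup>\<alpha>\<^sup>-\<^sup>1 A R\<^sub>l Ax\<close> vanishes at both ends, and its derivative trades the
  integrand \<open>l\<^sup>\<alpha>\<^sup>-\<^sup>1 (A R\<^sub>l)\<^sup>2 x\<close> for \<open>(\<alpha> - 1) l\<^sup>\<alpha>\<^sup>-\<^sup>2 A R\<^sub>l Ax\<close>; the factor \<open>\<alpha> - 1\<close> turns
  \<open>\<Gamma>(\<alpha>)\<close> into \<open>\<Gamma>(\<alpha> - 1)\<close>.\<close>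

lemma balakrishnan_gt_1:
  assumes \<alpha>: "1 < \<alpha>" "\<alpha> < 2" and x: "x \<in> dom_pow D A 2"
  shows "balakrishnan D A \<alpha> x = A_pow (\<alpha> - 1) (A x)"
proof -
  note xD = dom_pow_2D[OF x]
  have b: "0 < \<alpha> - 1" "\<alpha> - 1 < 1" using \<alpha> by auto
  note i = A_pow_integrable[OF b xD(2)]
  let ?g = "\<lambda>l. l powr (\<alpha> - 1) *\<^sub>R R l (AR l (A x)) - ((\<alpha> - 1) * l powr (\<alpha> - 1 - 1)) *\<^sub>R AR l (A x)"
  define C where "C = (1 + M) * norm (A x) + M * norm (A (A x))"
  have "(?g has_integral 0 - 0) {0<..}"
  proof (rule has_integral_improper)
    fix l :: real assume l: "l > 0"
    have "((\<lambda>l. l powr (\<alpha> - 1)) has_real_derivative (\<alpha> - 1) * l powr (\<alpha> - 1 - 1)) (at l)"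
      using l by (auto intro!: derivative_eq_intros)
    then show "((\<lambda>l. - (l powr (\<alpha> - 1) *\<^sub>R AR l (A x))) has_vector_derivative ?g l) (at l)"
      using l by (auto intro!: derivative_eq_intros has_vector_derivative_AR[OF l])
  next
    show "((\<lambda>l. - (l powr (\<alpha> - 1) *\<^sub>R AR l (A x))) \<longlongrightarrow> 0) (at_right 0)"
    proof (rule Lim_null_comparison)
      show "\<forall>\<^sub>F l in at_right 0. norm (- (l powr (\<alpha> - 1) *\<^sub>R AR l (A x))) \<le> l powr (\<alpha> - 1) * ((1 + M) * norm (A x))"
        unfolding eventually_at_right_field by (auto intro!: exI[of _ 1] mult_left_mono norm_AR)
      have "((\<lambda>l. l powr (\<alpha> - 1)) \<longlongrightarrow> 0) (at_right 0)" using \<alpha> by real_asymp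
      from tendsto_mult_right[OF this]
      show "((\<lambda>l. l powr (\<alpha> - 1) * ((1 + M) * norm (A x))) \<longlongrightarrow> 0) (at_right 0)" by simp
    qed
    show "((\<lambda>l. - (l powr (\<alpha> - 1) *\<^sub>R AR l (A x))) \<longlongrightarrow> 0) at_top"
    proof (rule Lim_null_comparison)
      show "\<forall>\<^sub>F l in at_top. norm (- (l powr (\<alpha> - 1) *\<^sub>R AR l (A x))) \<le> l powr (\<alpha> - 1) / (1 + l) * C"
        using eventually_gt_at_top[of 0]
      proof eventually_elim
        case (elim l)
        have "norm (AR l (A x)) \<le> C / (1 + l)"
          using norm_AR_dom[OF elim xD(2)] elim by (simp add: C_def field_simps)
        then have "l powr (\<alpha> - 1) * norm (AR l (A x)) \<le> l powr (\<alpha> - 1) * (C / (1 + l))"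
          by (intro mult_left_mono) auto
        then show ?case by simp
      qed
      have "((\<lambda>l. l powr (\<alpha> - 1) / (1 + l)) \<longlongrightarrow> 0) at_top" using \<alpha> by real_asymp
      from tendsto_mult_right[OF this]
      show "((\<lambda>l. l powr (\<alpha> - 1) / (1 + l) * C) \<longlongrightarrow> 0) at_top" by simp
    qed
  qed
  from has_integral_add[OF this has_integral_cmul[OF integrable_integral[OF i], of "\<alpha> - 1"]]
  have "integral {0<..} (\<lambda>l. l powr (\<alpha> - 1) *\<^sub>R R l (AR l (A x)))
    = (\<alpha> - 1) *\<^sub>R integral {0<..} (\<lambda>l. l powr (\<alpha> - 1 - 1) *\<^sub>R AR l (A x))"
    by (simp add: integral_unique)
  moreover have "integral {0<..} (\<lambda>l. l powr (\<alpha> - 1) *\<^sub>R AR l (AR l x))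
    = integral {0<..} (\<lambda>l. l powr (\<alpha> - 1) *\<^sub>R R l (AR l (A x)))"
    by (rule integral_cong) (simp add: AR_dom[OF _ xD(1)] R_AR)
  moreover have "Gamma \<alpha> = (\<alpha> - 1) * Gamma (\<alpha> - 1)"
    using Gamma_plus1[of "\<alpha> - 1"] b nonpos_Ints_nonpos[of "\<alpha> - 1"] by force
  ultimately show ?thesis
    unfolding balakrishnan_order_2[OF less_imp_le[OF \<alpha>(1)] \<alpha>(2)] A_pow_def using \<alpha> by simp
qed

end

text \<open>The equation \<open>Q y = L x\<close> is closed, so it persists on the closure of the graph and determines \<open>y\<close>.\<close>

lemma closure_graph_unique:
  fixes Q L :: "'a::real_normed_vector \<Rightarrow> 'a"
  assumes Q: "continuous_on UNIV Q" and L: "continuous_on UNIV L" and inj: "\<And>y z. Q y = Q z \<Longrightarrow> y = z"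
    and eq: "\<And>x. x \<in> S \<Longrightarrow> Q (f x) = L x"
    and yz: "(x, y) \<in> closure ((\<lambda>x. (x, f x)) ` S)" "(x, z) \<in> closure ((\<lambda>x. (x, f x)) ` S)"
  shows "y = z"
proof -
  have "closed {p. Q (snd p) = L (fst p)}"
    by (intro closed_Collect_eq continuous_on_compose2[OF Q] continuous_on_compose2[OF L] continuous_intros) auto
  moreover have "(\<lambda>x. (x, f x)) ` S \<subseteq> {p. Q (snd p) = L (fst p)}" using eq by auto
  ultimately have "closure ((\<lambda>x. (x, f x)) ` S) \<subseteq> {p. Q (snd p) = L (fst p)}" by (rule closure_minimal[rotated])
  from subsetD[OF this yz(1)] subsetD[OF this yz(2)] have "Q y = Q z" by simp
  then show ?thesis by (rule inj)
qed

text \<open>Closability, with \<open>Q = R\<^sub>1\<close> for \<open>\<alpha> \<le> 1\<close> and \<open>Q = R\<^sub>1\<^sup>2\<close> for \<open>\<alpha> > 1\<close>. In the last case one resolvent absorbs the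
  factor \<open>A\<close> in \<open>A\<^sup>\<alpha>\<^sup>-\<^sup>1 A\<close> and the other one the fractional power.\<close>

lemma (in bounded_semigroup) frac_pow_eq:
  assumes \<alpha>: "0 < \<alpha>" "\<alpha> < 2" and xy: "(x, y) \<in> frac_pow_graph D A \<alpha>"
  shows "frac_pow D A \<alpha> x = y"
proof -
  have closable: "frac_pow D A \<alpha> x = y"
    if "continuous_on UNIV Q" "continuous_on UNIV L" "\<And>y z. Q y = Q z \<Longrightarrow> y = z"
      "\<And>x. x \<in> dom_pow D A (frac_order \<alpha>) \<Longrightarrow> Q (balakrishnan D A \<alpha> x) = L x" for Q L :: "'a \<Rightarrow> 'a"
    unfolding frac_pow_def
  proof (rule the_equality[of "\<lambda>y. (x, y) \<in> frac_pow_graph D A \<alpha>"])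
    show "(x, y) \<in> frac_pow_graph D A \<alpha>" by fact
    fix z assume "(x, z) \<in> frac_pow_graph D A \<alpha>"
    with xy have
      "(x, z) \<in> closure ((\<lambda>x. (x, balakrishnan D A \<alpha> x)) ` dom_pow D A (frac_order \<alpha>))"
      "(x, y) \<in> closure ((\<lambda>x. (x, balakrishnan D A \<alpha> x)) ` dom_pow D A (frac_order \<alpha>))"
      unfolding frac_pow_graph_def by auto
    then show "z = y"
      by (rule closure_graph_unique[OF that(1,2), rotated 2]) (erule that(3), erule that(4))
  qed
  have R1: "continuous_on UNIV (R 1)" by (intro linear_continuous_on bounded_linear_R) simp
  have W1: "continuous_on UNIV (AR 1)" unfolding AR_def[abs_def] by (intro continuous_intros R1)
  have R1_inj: "y = z" if "R 1 y = R 1 z" for y z using R_inj[OF _ that] by simp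
  consider "\<alpha> < 1" | "\<alpha> = 1" | "1 < \<alpha>" by linarith
  then show ?thesis
  proof cases
    case 1
    have o: "frac_order \<alpha> = 1" unfolding frac_order_def using \<alpha> 1 by (simp add: floor_eq_iff)
    show ?thesis
    proof (rule closable[OF R1 _ R1_inj])
      show "continuous_on UNIV (\<lambda>x. A_pow \<alpha> (R 1 x))"
        by (rule linear_continuous_on[OF bounded_linear_A_pow_R[OF \<alpha>(1) 1]])
      show "R 1 (balakrishnan D A \<alpha> x) = A_pow \<alpha> (R 1 x)" if "x \<in> dom_pow D A (frac_order \<alpha>)" for x
        using that R_A_pow[OF \<alpha>(1) 1, of x] by (simp add: o dom_pow_def balakrishnan_lt_1[OF \<alpha>(1) 1])
    qed
  next
    case 2
    show ?thesis
    proof (rule closable[OF R1 W1 R1_inj])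
      show "R 1 (balakrishnan D A \<alpha> x) = AR 1 x" if "x \<in> dom_pow D A (frac_order \<alpha>)" for x
        using that dom_pow_2D[of x] 2 by (simp add: frac_order_2 balakrishnan_1 AR_dom)
    qed
  next
    case 3
    have b: "0 < \<alpha> - 1" "\<alpha> - 1 < 1" using \<alpha> 3 by auto
    show ?thesis
    proof (rule closable[of "\<lambda>x. R 1 (R 1 x)" "\<lambda>x. A_pow (\<alpha> - 1) (R 1 (AR 1 x))"])
      show "continuous_on UNIV (\<lambda>x. R 1 (R 1 x))" by (rule continuous_on_compose2[OF R1 R1]) auto
      show "continuous_on UNIV (\<lambda>x. A_pow (\<alpha> - 1) (R 1 (AR 1 x)))"
        by (rule continuous_on_compose2[OF linear_continuous_on[OF bounded_linear_A_pow_R[OF b]] W1]) auto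
      show "y = z" if "R 1 (R 1 y) = R 1 (R 1 z)" for y z by (rule R1_inj[OF R1_inj[OF that]])
      fix x assume "x \<in> dom_pow D A (frac_order \<alpha>)"
      then have x: "x \<in> dom_pow D A 2" using 3 \<alpha> by (simp add: frac_order_2)
      have "R 1 (A_pow (\<alpha> - 1) (A x)) = A_pow (\<alpha> - 1) (AR 1 x)"
        using R_A_pow[OF b, of "A x"] dom_pow_2D[OF x] by (simp add: AR_dom)
      moreover have "AR 1 x \<in> D" using dom_pow_2D[OF x] R_right_inverse(1)[of 1 "A x"] by (simp add: AR_dom)
      ultimately show "R 1 (R 1 (balakrishnan D A \<alpha> x)) = A_pow (\<alpha> - 1) (R 1 (AR 1 x))"
        unfolding balakrishnan_gt_1[OF 3 \<alpha>(2) x] using R_A_pow[OF b] by simp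
    qed
  qed
qed

section \<open>Kernels of Gamma and Beta type\<close>

lemma nn_integral_powr_exp:
  fixes b s :: real
  assumes b: "0 < b" and s: "0 < s"
  shows "(\<integral>\<^sup>+l. ennreal (indicator {0<..} l * l powr (b - 1) * exp (- (l * s))) \<partial>lborel) = ennreal (Gamma b * s powr (- b))"
proof -
  define E where "E l = indicator {0<..} l * l powr (b - 1) * exp (- (l * s))" for l
  define G where "G t = indicator {0..} t * t powr (b - 1) / exp t" for t :: real
  have "ennreal (Gamma b) = (\<integral>\<^sup>+t. ennreal (G t) \<partial>lborel)"
    unfolding G_def by (rule Gamma_conv_nn_integral_real[OF b])
  also have "\<dots> = ennreal s * (\<integral>\<^sup>+l. ennreal (G (0 + s * l)) \<partial>lborel)"
    using s by (subst nn_integral_real_affine[where c = s and t = 0]) (auto simp: G_def)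
  also have "(\<integral>\<^sup>+l. ennreal (G (0 + s * l)) \<partial>lborel)
      = (\<integral>\<^sup>+l. ennreal (s powr (b - 1)) * ennreal (E l) \<partial>lborel)"
  proof (rule nn_integral_cong)
    fix l :: real
    consider "l < 0" | "l = 0" | "l > 0" by linarith
    then have "G (0 + s * l) = s powr (b - 1) * E l"
      using s by cases (auto simp: E_def G_def indicator_def mult_less_0_iff zero_le_mult_iff powr_mult exp_minus field_simps)
    then show "ennreal (G (0 + s * l))
        = ennreal (s powr (b - 1)) * ennreal (E l)"
      by (simp add: ennreal_mult')
  qed
  also have "\<dots> = ennreal (s powr (b - 1)) * (\<integral>\<^sup>+l. ennreal (E l) \<partial>lborel)"
    unfolding E_def by (rule nn_integral_cmult) measurable
  also have "ennreal s * \<dots> = ennreal (s powr b) * (\<integral>\<^sup>+l. ennreal (E l) \<partial>lborel)"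
    using s by (simp add: mult.assoc[symmetric] ennreal_mult'[symmetric] powr_diff)
  finally have e: "ennreal (Gamma b) = ennreal (s powr b) * (\<integral>\<^sup>+l. ennreal (E l) \<partial>lborel)" .
  have "ennreal (s powr (- b)) * ennreal (Gamma b) = ennreal (s powr (- b) * s powr b) *
      (\<integral>\<^sup>+l. ennreal (E l) \<partial>lborel)"
    unfolding e by (simp add: ennreal_mult' mult.assoc)
  also have "s powr (- b) * s powr b = 1" using s by (simp add: powr_minus)
  finally show ?thesis using Gamma_real_pos[OF b] unfolding E_def by (simp add: ennreal_mult'[symmetric] mult.commute)
qed

lemma nn_integral_Beta_kernel:
  fixes b r v :: real
  assumes b: "0 < b" "b < 1" and rv: "r < v"
  shows "(\<integral>\<^sup>+u. ennreal (indicator {r<..<v} u * ((u - r) powr (b - 1) * (v - u) powr (- b))) \<partial>lborel)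
    = ennreal (Gamma b * Gamma (1 - b))"
proof -
  define d where "d = v - r"
  have d: "d > 0" using rv by (simp add: d_def)
  have "((\<lambda>t. t powr (b - 1) * (1 - t) powr (1 - b - 1)) has_integral Beta b (1 - b)) {0..1}"
    using b by (intro has_integral_Beta_real) auto
  from nn_integral_has_integral_lebesgue[OF _ this]
  have B: "(\<integral>\<^sup>+t. ennreal (indicator {0..1} t * (t powr (b - 1) * (1 - t) powr (- b))) \<partial>lborel) = ennreal (Gamma b * Gamma (1 - b))"
    by (simp add: Beta_def)
  have "(\<integral>\<^sup>+u. ennreal (indicator {r<..<v} u * ((u - r) powr (b - 1) * (v - u) powr (- b))) \<partial>lborel)
    = ennreal d * (\<integral>\<^sup>+t. ennreal (indicator {r<..<v} (r + d * t) * ((r + d * t - r) powr (b - 1) * (v - (r + d * t)) powr (- b))) \<partial>lborel)"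
    using d by (subst nn_integral_real_affine[where c = d and t = r]) auto
  also have "\<dots> = (\<integral>\<^sup>+t. ennreal d * ennreal (indicator {r<..<v} (r + d * t) * ((r + d * t - r) powr (b - 1) * (v - (r + d * t)) powr (- b))) \<partial>lborel)"
    by (rule nn_integral_cmult[symmetric]) measurable
  also have "\<dots> = (\<integral>\<^sup>+t. ennreal (indicator {0..1} t * (t powr (b - 1) * (1 - t) powr (- b))) \<partial>lborel)"
  proof (rule nn_integral_cong)
    fix t :: real
    have "d * (indicator {r<..<v} (r + d * t) * ((r + d * t - r) powr (b - 1) * (v - (r + d * t)) powr (- b)))
        = indicator {0..1} t * (t powr (b - 1) * (1 - t) powr (- b))"
    proof (cases "0 < t \<and> t < 1")
      case True
      have vd: "v = r + d" by (simp add: d_def)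
      have "d * t < d" using True d mult_strict_left_mono[of t 1 d] by simp
      then have "r < r + d * t" "r + d * t < v" using True d unfolding vd by auto
      moreover have "v - (r + d * t) = d * (1 - t)" by (simp add: d_def algebra_simps)
      moreover have "d * (d powr (b - 1) * d powr (- b)) = 1"
        using d by (simp add: powr_diff powr_minus)
      moreover have "d * ((d * t) powr (b - 1) * (d * (1 - t)) powr (- b))
          = (d * (d powr (b - 1) * d powr (- b))) * (t powr (b - 1) * (1 - t) powr (- b))"
        using True d by (simp add: powr_mult mult_ac)
      ultimately show ?thesis using True by simp
    next
      case False
      then consider "t \<le> 0" | "t \<ge> 1" by linarith
      then have "indicator {r<..<v} (r + d * t) = (0 :: real)"
      proof cases
        case 1
        then have "d * t \<le> 0" using d by (simp add: mult_nonneg_nonpos)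
        then show ?thesis by simp
      next
        case 2
        then have "d * t \<ge> d" using d by simp
        then show ?thesis by (simp add: d_def)
      qed
      moreover have "indicator {0..1} t * (t powr (b - 1) * (1 - t) powr (- b)) = 0"
        using False by (cases "t = 0 \<or> t = 1") (auto simp: indicator_def)
      ultimately show ?thesis by simp
    qed
    then show "ennreal d * ennreal (indicator {r<..<v} (r + d * t) * ((r + d * t - r) powr (b - 1) * (v - (r + d * t)) powr (- b)))
      = ennreal (indicator {0..1} t * (t powr (b - 1) * (1 - t) powr (- b)))"
      using d by (simp add: ennreal_mult'[symmetric])
  qed
  finally show ?thesis using B by simp
qed

text \<open>The kernel \<open>(u - c)\<^sup>b\<^sup>-\<^sup>1\<close> is decreasing to the right of its singularity. Its mass on \<open>(r,t]\<close> is
  \<open>(t - r)\<^sup>b/b\<close>, and beyond \<open>t\<close> the difference of the shifted kernels telescopes to the same amount.\<close>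

lemma nn_integral_powr_kernel_diff:
  fixes b r t :: real
  assumes b: "0 < b" "b < 1" and rt: "r < t"
  shows "(\<integral>\<^sup>+u. ennreal \<bar>indicator {r<..} u * (u - r) powr (b - 1) - indicator {t<..} u * (u - t) powr (b - 1)\<bar> \<partial>lborel)
    \<le> ennreal (2 / b * (t - r) powr b)"
proof -
  define k where "k c u = indicator {c<..} u * (u - c) powr (b - 1)" for c u :: real
  define d where "d = t - r"
  have d: "d > 0" using rt by (simp add: d_def)
  define p where "p w = indicator {0..d} w * w powr (b - 1)" for w :: real
  define q where "q w = indicator {0<..} w * (w powr (b - 1) - (w + d) powr (b - 1))" for w :: real
  have "((\<lambda>w. w powr (b - 1)) has_integral (d powr (b - 1 + 1) / (b - 1 + 1))) {0..d}"
    using b d by (intro has_integral_powr_from_0) auto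
  from nn_integral_has_integral_lebesgue[OF _ this]
  have P: "(\<integral>\<^sup>+w. ennreal (p w) \<partial>lborel) = ennreal (d powr b / b)" by (simp add: p_def)
  have "((\<lambda>w. w powr (b - 1) - (w + d) powr (b - 1)) has_integral 0 - (- (d powr b / b))) {0<..}"
  proof (rule has_integral_improper)
    fix w :: real assume w: "w > 0"
    have "((\<lambda>w. (w powr b - (w + d) powr b) / b) has_real_derivative (w powr (b - 1) - (w + d) powr (b - 1))) (at w)"
      using w d b by (auto intro!: derivative_eq_intros simp: field_simps)
    then show "((\<lambda>w. (w powr b - (w + d) powr b) / b) has_vector_derivative w powr (b - 1) - (w + d) powr (b - 1)) (at w)"
      by (simp add: has_real_derivative_iff_has_vector_derivative)
  next
    have "((\<lambda>w. w powr b) \<longlongrightarrow> 0) (at_right 0)" using b by real_asymp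
    moreover have "((\<lambda>w. (w + d) powr b) \<longlongrightarrow> (0 + d) powr b) (at_right 0)"
      using d by (intro tendsto_intros) auto
    ultimately have "((\<lambda>w. (w powr b - (w + d) powr b) / b) \<longlongrightarrow> (0 - (0 + d) powr b) / b) (at_right 0)"
      using b by (intro tendsto_divide tendsto_diff tendsto_const) auto
    then show "((\<lambda>w. (w powr b - (w + d) powr b) / b) \<longlongrightarrow> - (d powr b / b)) (at_right 0)" by simp
    have "((\<lambda>w. w powr b - (w + d) powr b) \<longlongrightarrow> 0) at_top" using b d by real_asymp
    from tendsto_divide[OF this tendsto_const, of b]
    show "((\<lambda>w. (w powr b - (w + d) powr b) / b) \<longlongrightarrow> 0) at_top" using b by simp
  qed
  moreover have dec: "(w + d) powr (b - 1) \<le> w powr (b - 1)" if "w > 0" for w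
    using that d b by (intro powr_mono2') auto
  ultimately have Q: "(\<integral>\<^sup>+w. ennreal (q w) \<partial>lborel) = ennreal (d powr b / b)"
    using nn_integral_has_integral_lebesgue[of "{0<..}" "\<lambda>w. w powr (b - 1) - (w + d) powr (b - 1)" "d powr b / b"]
    by (simp add: q_def)
  have m: "p \<in> borel_measurable borel" "q \<in> borel_measurable borel"
    unfolding p_def[abs_def] q_def[abs_def] by measurable
  have "(\<integral>\<^sup>+u. ennreal \<bar>k r u - k t u\<bar> \<partial>lborel)
    \<le> (\<integral>\<^sup>+u. ennreal (p (- r + 1 * u)) + ennreal (q (- t + 1 * u)) \<partial>lborel)"
  proof (rule nn_integral_mono)
    fix u :: real
    consider "u \<le> r" | "r < u" "u \<le> t" | "t < u" by linarith
    then have "\<bar>k r u - k t u\<bar>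
        \<le> p (- r + 1 * u) + q (- t + 1 * u)"
    proof cases
      case 3
      have e: "u - t + d = u - r" by (simp add: d_def)
      show ?thesis using 3 rt dec[of "u - t"] by (simp add: k_def p_def q_def indicator_def e d_def)
    qed (use rt in \<open>auto simp: k_def p_def q_def indicator_def d_def\<close>)
    moreover have "0 \<le> p (- r + 1 * u)" "0 \<le> q (- t + 1 * u)"
      using dec[of "u - t"] by (auto simp: p_def q_def indicator_def)
    ultimately show "ennreal \<bar>k r u - k t u\<bar>
        \<le> ennreal (p (- r + 1 * u)) + ennreal (q (- t + 1 * u))"
      by (simp flip: ennreal_plus add: ennreal_leI)
  qed
  also have "\<dots> = (\<integral>\<^sup>+u. ennreal (p (- r + 1 * u)) \<partial>lborel) + (\<integral>\<^sup>+u. ennreal (q (- t + 1 * u)) \<partial>lborel)"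
    using m by (intro nn_integral_add) auto
  also have "(\<integral>\<^sup>+u. ennreal (p (- r + 1 * u)) \<partial>lborel) = ennreal (d powr b / b)"
    using nn_integral_real_affine[of "\<lambda>w. ennreal (p w)" 1 "- r"] m P by simp
  also have "(\<integral>\<^sup>+u. ennreal (q (- t + 1 * u)) \<partial>lborel) = ennreal (d powr b / b)"
    using nn_integral_real_affine[of "\<lambda>w. ennreal (q w)" 1 "- t"] m Q by simp
  also have "ennreal (d powr b / b) + ennreal (d powr b / b) = ennreal (2 / b * (t - r) powr b)"
    using b by (simp flip: ennreal_plus add: d_def)
  finally show ?thesis unfolding k_def .
qed

text \<open>Fubini's theorem for a kernel with one known marginal: the kernel \<open>K\<close> is nonnegative and its integral \<open>\<kappa>\<close> over the first
  variable is known, so integrability of \<open>\<kappa> f\<close> is absolute integrability of the double integral.\<close>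

lemma weighted_Fubini:
  fixes K :: "real \<Rightarrow> real \<Rightarrow> real" and f \<kappa> :: "real \<Rightarrow> real"
  assumes K[measurable]: "(\<lambda>(l, s). K l s) \<in> borel_measurable (lborel \<Otimes>\<^sub>M lborel)" and nn: "\<And>l s. 0 \<le> K l s"
    and f[measurable]: "f \<in> borel_measurable lborel" and f0: "\<And>s. s \<notin> S \<Longrightarrow> f s = 0"
    and \<kappa>: "\<And>s. s \<in> S \<Longrightarrow> (\<integral>\<^sup>+l. ennreal (K l s) \<partial>lborel) = ennreal (\<kappa> s)" and \<kappa>0: "\<And>s. s \<in> S \<Longrightarrow> 0 \<le> \<kappa> s"
    and int: "integrable lborel (\<lambda>s. \<kappa> s * f s)"
  shows "integrable lborel (\<lambda>l. \<integral>s. K l s * f s \<partial>lborel)"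
    "(\<integral>l. (\<integral>s. K l s * f s \<partial>lborel) \<partial>lborel) = (\<integral>s. \<kappa> s * f s \<partial>lborel)"
proof -
  have Ks: "(\<lambda>l. K l s) \<in> borel_measurable lborel" for s by measurable
  have inner: "(\<integral>\<^sup>+l. ennreal (norm (K l s * f s)) \<partial>lborel) = ennreal (norm (\<kappa> s * f s))" for s
  proof (cases "s \<in> S")
    case True
    have "(\<integral>\<^sup>+l. ennreal (norm (K l s * f s)) \<partial>lborel) = (\<integral>\<^sup>+l. ennreal (K l s) * ennreal \<bar>f s\<bar> \<partial>lborel)"
      using nn by (simp add: abs_mult ennreal_mult')
    also have "\<dots> = ennreal (\<kappa> s) * ennreal \<bar>f s\<bar>" using Ks True by (simp add: nn_integral_multc \<kappa>)
    finally show ?thesis using \<kappa>0[OF True] by (simp add: abs_mult ennreal_mult')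
  qed (simp add: f0)
  have "integrable (lborel \<Otimes>\<^sub>M lborel) (\<lambda>(l, s). K l s * f s)"
    unfolding integrable_iff_bounded
  proof
    have "(\<integral>\<^sup>+p. ennreal (norm (case p of (l, s) \<Rightarrow> K l s * f s)) \<partial>(lborel \<Otimes>\<^sub>M lborel))
      = (\<integral>\<^sup>+s. \<integral>\<^sup>+l. ennreal (norm (K l s * f s)) \<partial>lborel \<partial>lborel)"
      by (subst lborel_pair.nn_integral_snd[symmetric]) auto
    also have "\<dots> < \<infinity>" unfolding inner using int by (simp add: integrable_iff_bounded)
    finally show "(\<integral>\<^sup>+p. ennreal (norm (case p of (l, s) \<Rightarrow> K l s * f s)) \<partial>(lborel \<Otimes>\<^sub>M lborel)) < \<infinity>" .
  qed measurable
  then have I: "integrable (lborel \<Otimes>\<^sub>M lborel) (case_prod (\<lambda>l s. K l s * f s))" by simp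
  show "integrable lborel (\<lambda>l. \<integral>s. K l s * f s \<partial>lborel)" by (rule lborel_pair.integrable_fst[OF I])
  have "(\<integral>l. K l s * f s \<partial>lborel) = \<kappa> s * f s" for s
  proof (cases "s \<in> S")
    case True
    have "(\<integral>l. K l s \<partial>lborel) = \<kappa> s"
      using Ks nn \<kappa>[OF True] \<kappa>0[OF True] by (subst integral_eq_nn_integral) auto
    then show ?thesis by simp
  qed (simp add: f0)
  then show "(\<integral>l. (\<integral>s. K l s * f s \<partial>lborel) \<partial>lborel) = (\<integral>s. \<kappa> s * f s \<partial>lborel)"
    using lborel_pair.Fubini_integral[OF I] by (simp only:)
qed

text \<open>Logarithmic convexity of the Gamma function gives
  \<open>1 = \<Gamma>(2)\<^sup>2 \<le> \<Gamma>(b + 1) \<Gamma>(3 - b)\<close>, and \<open>\<Gamma>(3 - b) = (2 - b) \<Gamma>(2 - b) \<le> 2\<close>.\<close>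

lemma inverse_Gamma_le_2:
  assumes b: "0 < b" "b < (1::real)"
  shows "1 / Gamma (b + 1) \<le> 2"
proof -
  have le: "Gamma (2 - b) \<le> 1"
  proof -
    have "(ln \<circ> Gamma) ((1 - b) *\<^sub>R 2 + b *\<^sub>R 1) \<le> (1 - b) * (ln \<circ> Gamma) (2::real) + b * (ln \<circ> Gamma) 1"
      using b by (intro convex_onD[OF log_convex_Gamma_real]) auto
    moreover have "Gamma (2::real) = 1" using Gamma_fact[of 1, where 'a = real] by simp
    ultimately have "ln (Gamma (2 - b)) \<le> 0" by (simp add: algebra_simps)
    then show ?thesis using Gamma_real_pos[of "2 - b"] b by simp
  qed
  have "Gamma (3 - b) = (2 - b) * Gamma (2 - b)"
    using Gamma_plus1[of "2 - b"] b nonpos_Ints_nonpos[of "2 - b"] by force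
  also have "\<dots> \<le> 2 * 1" using b le Gamma_real_pos[of "2 - b"] by (intro mult_mono) auto
  finally have g3: "Gamma (3 - b) \<le> 2" by simp
  have "(ln \<circ> Gamma) ((1/2) *\<^sub>R (b + 1) + (1/2) *\<^sub>R (3 - b)) \<le> (1/2) * (ln \<circ> Gamma) (b + 1) + (1/2) * (ln \<circ> Gamma) (3 - b)"
    using b convex_onD[OF log_convex_Gamma_real, of "1/2" "b + 1" "3 - b"] by simp
  moreover have "(1/2) *\<^sub>R (b + 1) + (1/2) *\<^sub>R (3 - b) = 2" by (simp add: field_simps)
  moreover have "Gamma (2::real) = 1" using Gamma_fact[of 1, where 'a = real] by simp
  ultimately have "0 \<le> ln (Gamma (b + 1)) + ln (Gamma (3 - b))" by simp
  moreover have pos: "0 < Gamma (b + 1)" "0 < Gamma (3 - b)" using b by (auto intro!: Gamma_real_pos)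
  then have "Gamma (b + 1) \<noteq> 0" "Gamma (3 - b) \<noteq> 0" by linarith+
  then have "ln (Gamma (b + 1) * Gamma (3 - b)) = ln (Gamma (b + 1)) + ln (Gamma (3 - b))"
    by (simp add: ln_mult)
  ultimately have "0 \<le> ln (Gamma (b + 1) * Gamma (3 - b))" by simp
  then have "1 \<le> Gamma (b + 1) * Gamma (3 - b)" using mult_pos_pos[OF pos] by (simp only: ln_ge_zero_iff)
  also have "\<dots> \<le> Gamma (b + 1) * 2" using g3 Gamma_real_pos[of "b + 1"] b by (intro mult_left_mono) auto
  finally show ?thesis using Gamma_real_pos[of "b + 1"] b by (simp add: field_simps)
qed

section \<open>Hoelder regularity of orbits\<close>

context bounded_semigroup
begin

lemma LINT_R:
  assumes e: "0 < e" and m: "bounded_linear (m :: 'a \<Rightarrow> real)"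
  shows "set_integrable lborel {0<..} (\<lambda>s. exp (- (e * s)) * m (T s y))"
    "(LINT s:{0<..}|lborel. exp (- (e * s)) * m (T s y)) = m (R e y)"
proof -
  obtain N where N: "\<And>x. \<bar>m x\<bar> \<le> norm x * N" "N \<ge> 0"
    using bounded_linear.nonneg_bounded[OF m] by auto
  have c: "continuous_on {0<..} (\<lambda>s. exp (- (e * s)) * m (T s y))"
    by (intro continuous_intros bounded_linear.continuous_on[OF m] continuous_on_subset[OF continuous_orbit]) auto
  have b: "\<bar>exp (- (e * s)) * m (T s y)\<bar> \<le> (M * norm y * N) * exp (- (e * s))" if "s > 0" for s
  proof -
    have "\<bar>m (T s y)\<bar> \<le> M * norm y * N"
      using N(1)[of "T s y"] mult_right_mono[OF bound[of s y] N(2)] that by linarith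
    then show ?thesis by (simp add: abs_mult mult.commute)
  qed
  note I = set_integrable_dominated[OF c laplace_majorant(1)[OF e] b laplace_majorant(2,3)[OF e]]
  show "set_integrable lborel {0<..} (\<lambda>s. exp (- (e * s)) * m (T s y))" by (rule I)
  have "(LINT s:{0<..}|lborel. exp (- (e * s)) * m (T s y)) = integral {0<..} (\<lambda>s. exp (- (e * s)) * m (T s y))"
    by (rule I)
  also have "\<dots> = integral {0<..} (m \<circ> (\<lambda>s. exp (- (e * s)) *\<^sub>R T s y))"
    by (simp add: comp_def linear_cmul[OF bounded_linear.linear[OF m]])
  also have "\<dots> = m (R e y)"
    unfolding R_def by (rule integral_linear[OF R_integrable(1)[OF e] m])
  finally show "(LINT s:{0<..}|lborel. exp (- (e * s)) * m (T s y)) = m (R e y)" .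
qed

text \<open>The fractional power \<open>(e + A)\<^sup>b\<close>, because \<open>x - l (l + e + A)\<^sup>-\<^sup>1 x = (e + A)(l + e + A)\<^sup>-\<^sup>1 x\<close>.\<close>

definition A_pow_reg :: "real \<Rightarrow> real \<Rightarrow> 'a \<Rightarrow> 'a" where
  "A_pow_reg b e x = (1 / (Gamma b * Gamma (1 - b))) *\<^sub>R integral {0<..} (\<lambda>l. l powr (b - 1) *\<^sub>R (x - l *\<^sub>R R (l + e) x))"

lemma R_shift:
  assumes x: "x \<in> D" and le: "0 < l" "0 < e"
  shows "x - l *\<^sub>R R (l + e) x = R (l + e) (A x + e *\<^sub>R x)"
proof -
  have le': "0 < l + e" using le by simp
  have "x = R (l + e) ((l + e) *\<^sub>R x + A x)" using R_left_inverse[OF le' x] ..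
  also have "(l + e) *\<^sub>R x + A x = l *\<^sub>R x + (A x + e *\<^sub>R x)" by (simp add: algebra_simps)
  also have "R (l + e) \<dots> = l *\<^sub>R R (l + e) x + R (l + e) (A x + e *\<^sub>R x)"
    by (simp only: R_add[OF le'] R_scaleR[OF le'])
  finally show ?thesis by (metis add_diff_cancel_left')
qed

lemma continuous_R_shift:
  assumes "0 \<le> e" shows "continuous_on {0<..} (\<lambda>l. R (l + e) y)"
proof -
  have "continuous_on {0<..} (\<lambda>l. R l y)"
    by (intro continuous_at_imp_continuous_on ballI has_vector_derivative_continuous[OF has_vector_derivative_R]) auto
  then show ?thesis
    by (rule continuous_on_compose2) (use assms in \<open>auto intro!: continuous_intros\<close>)
qed

text \<open>By the resolvent identity the two integrands differ by \<open>l\<^sup>b\<^sup>-\<^sup>1\<close> times \<open>e \<cdot> l R\<^sub>l R\<^sub>l\<^sub>+\<^sub>e x\<close>, which is at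
  most \<open>M\<^sup>2 \<parallel>x\<parallel> e/(l + e)\<close>; the integral is of order \<open>e\<^sup>b\<close>.\<close>

lemma A_pow_reg_tendsto_A_pow:
  assumes b: "0 < b" "b < 1" and x: "x \<in> D"
  shows "((\<lambda>e. A_pow_reg b e x) \<longlongrightarrow> A_pow b x) (at_right 0)"
    and "\<And>e. 0 < e \<Longrightarrow> (\<lambda>l. l powr (b - 1) *\<^sub>R (x - l *\<^sub>R R (l + e) x)) integrable_on {0<..}"
proof -
  note int_A_pow = A_pow_integrable[OF b x]
  define K where "K = 4 / b + 4 / (1 - b)"
  define w where "w e l = l powr (b - 1) *\<^sub>R (l *\<^sub>R (R l x - R (l + e) x))" for e l
  define g where "g = 1 / (Gamma b * Gamma (1 - b))"
  have g: "g \<ge> 0" using b by (simp add: g_def Gamma_real_pos less_imp_le)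
  have diff: "w e integrable_on {0<..}" "norm (integral {0<..} (w e)) \<le> (M * (M * norm x)) * K * e powr b" if e: "e > 0" for e
  proof -
    have "continuous_on {0<..} (w e)"
      unfolding w_def using continuous_R_shift[of 0 x] continuous_R_shift[of e x] e by (intro continuous_intros) auto
    moreover have "0 \<le> M * (M * norm x)" using M_nonneg by simp
    moreover have "norm (w e l) \<le> M * (M * norm x) * (l powr (b - 1) * (e / (l + e)))" if l: "l > 0" for l
    proof -
      have le: "0 < l + e" using l e by simp
      have "norm (l *\<^sub>R (R l x - R (l + e) x)) = e * norm (l *\<^sub>R R l (R (l + e) x))"
        unfolding resolvent_identity[OF l le] using e l by (simp add: abs_mult)
      also have "\<dots> \<le> e * (M * norm (R (l + e) x))"
        using e norm_l_R[OF l] by (intro mult_left_mono) auto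
      also have "\<dots> \<le> e * (M * (M / (l + e) * norm x))"
        using e M_nonneg R_integrable(2)[OF le] by (intro mult_left_mono) auto
      finally have "norm (l *\<^sub>R (R l x - R (l + e) x)) \<le> (M * (M * norm x)) * (e / (l + e))"
        by (simp add: field_simps)
      then have "l powr (b - 1) * norm (l *\<^sub>R (R l x - R (l + e) x)) \<le> l powr (b - 1) * ((M * (M * norm x)) * (e / (l + e)))"
        by (intro mult_left_mono) auto
      moreover have "norm (l powr (b - 1) *\<^sub>R z) = l powr (b - 1) * norm z" for z :: 'a by simp
      ultimately show ?thesis unfolding w_def by (simp only: mult_ac)
    qed
    ultimately show "w e integrable_on {0<..}" "norm (integral {0<..} (w e)) \<le> (M * (M * norm x)) * K * e powr b"
      unfolding K_def using fractional_kernel_integral[OF b _ e] by blast+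
  qed
  have sum: "l powr (b - 1) *\<^sub>R AR l x + w e l = l powr (b - 1) *\<^sub>R (x - l *\<^sub>R R (l + e) x)" for l e
    by (simp add: w_def AR_def algebra_simps)
  show "(\<lambda>l. l powr (b - 1) *\<^sub>R (x - l *\<^sub>R R (l + e) x)) integrable_on {0<..}" if "0 < e" for e
    using integrable_add[OF int_A_pow diff(1)[OF that]] by (simp only: sum)
  have eq: "A_pow_reg b e x - A_pow b x = g *\<^sub>R integral {0<..} (w e)" if "0 < e" for e
    using integral_add[OF int_A_pow diff(1)[OF that]] unfolding sum A_pow_reg_def A_pow_def g_def
    by (simp add: scaleR_add_right)
  show "((\<lambda>e. A_pow_reg b e x) \<longlongrightarrow> A_pow b x) (at_right 0)"
  proof (rule LIM_zero_cancel, rule Lim_null_comparison)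
    have "norm (A_pow_reg b e x - A_pow b x) \<le> g * ((M * (M * norm x)) * K) * e powr b" if e: "e > 0" for e
    proof -
      have "norm (A_pow_reg b e x - A_pow b x) \<le> g * ((M * (M * norm x)) * K * e powr b)"
        unfolding eq[OF e] using diff(2)[OF e] g by (simp add: mult_left_mono)
      then show ?thesis by (simp add: mult_ac)
    qed
    then show "\<forall>\<^sub>F e in at_right 0. norm (A_pow_reg b e x - A_pow b x) \<le> g * ((M * (M * norm x)) * K) * e powr b"
      unfolding eventually_at_right_field by (intro exI[of _ 1]) auto
    have "((\<lambda>e. e powr b) \<longlongrightarrow> 0) (at_right 0)" using b by real_asymp
    from tendsto_mult_left[OF this]
    show "((\<lambda>e. g * ((M * (M * norm x)) * K) * e powr b) \<longlongrightarrow> 0) (at_right 0)" by simp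
  qed
qed

text \<open>For \<open>B = (e + A)x\<close> the integrand of the regularised power is \<open>l\<^sup>b\<^sup>-\<^sup>1 R\<^sub>l\<^sub>+\<^sub>e B\<close>. Inserting the Laplace integral
  of the resolvent and integrating over \<open>l\<close> first produces
  \<open>\<Gamma>(b) s\<^sup>-\<^sup>b\<close>, so \<open>(e + A)\<^sup>b x = \<Gamma>(1 - b)\<^sup>-\<^sup>1 \<integral>\<^sub>0\<^sup>\<infinity> s\<^sup>-\<^sup>b exp (- e s) T(s)B ds\<close>.\<close>

lemma A_pow_reg_functional:
  assumes b: "0 < b" "b < 1" and x: "x \<in> D" and e: "0 < e" and m: "bounded_linear (m :: 'a \<Rightarrow> real)"
  defines "f \<equiv> \<lambda>s. indicator {0<..} s * (exp (- (e * s)) * m (T s (A x + e *\<^sub>R x)))"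
  shows "integrable lborel (\<lambda>s. s powr (- b) * f s)"
    "m (A_pow_reg b e x) = (1 / Gamma (1 - b)) * (\<integral>s. s powr (- b) * f s \<partial>lborel)"
proof -
  define B where "B = A x + e *\<^sub>R x"
  obtain N where N: "\<And>x. \<bar>m x\<bar> \<le> norm x * N" "N \<ge> 0"
    using bounded_linear.nonneg_bounded[OF m] by auto
  define C where "C = M * norm B * N"
  have C: "0 \<le> C" using M_nonneg N by (simp add: C_def)
  have fb: "\<bar>f s\<bar> \<le> C * (indicator {0<..} s * exp (- (s * e)))" for s
  proof (cases "s > 0")
    case True
    have "\<bar>m (T s B)\<bar> \<le> C"
      using N(1)[of "T s B"] mult_right_mono[OF bound[of s B] N(2)] True unfolding C_def by linarith
    then show ?thesis using True by (simp add: f_def B_def[symmetric] abs_mult mult.commute)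
  qed (simp add: f_def)
  have fm: "f \<in> borel_measurable lborel"
    using LINT_R(1)[OF e m, of B] unfolding set_integrable_def f_def B_def by (auto dest: borel_measurable_integrable)
  have int0: "integrable lborel (\<lambda>s. indicator {0<..} s * s powr (- b) * exp (- (s * e)))"
  proof (rule integrableI_nonneg)
    show "(\<integral>\<^sup>+s. ennreal (indicator {0<..} s * s powr (- b) * exp (- (s * e))) \<partial>lborel) < \<infinity>"
      using nn_integral_powr_exp[of "1 - b" e] b e by simp
  qed (auto intro!: AE_I2)
  show int: "integrable lborel (\<lambda>s. s powr (- b) * f s)"
  proof (rule Bochner_Integration.integrable_bound[OF integrable_mult_right[OF int0, of C]])
    show "AE s in lborel. norm (s powr (- b) * f s) \<le> norm (C * (indicator {0<..} s * s powr (- b) * exp (- (s * e))))"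
    proof (rule AE_I2)
      fix s
      have "s powr (- b) * \<bar>f s\<bar> \<le> s powr (- b) * (C * (indicator {0<..} s * exp (- (s * e))))"
        by (intro mult_left_mono fb) auto
      then show "norm (s powr (- b) * f s) \<le> norm (C * (indicator {0<..} s * s powr (- b) * exp (- (s * e))))"
        using C by (simp add: abs_mult mult_ac)
    qed
  qed (use fm in measurable)
  define K where "K l s = indicator {0<..} l * l powr (b - 1) * exp (- (l * s))" for l s :: real
  have Fub: "integrable lborel (\<lambda>l. \<integral>s. K l s * f s \<partial>lborel)"
    "(\<integral>l. (\<integral>s. K l s * f s \<partial>lborel) \<partial>lborel) = (\<integral>s. (Gamma b * s powr (- b)) * f s \<partial>lborel)"
  proof -
    have Km: "(\<lambda>(l, s). K l s) \<in> borel_measurable (lborel \<Otimes>\<^sub>M lborel)"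
      unfolding K_def[abs_def] by measurable
    have i: "integrable lborel (\<lambda>s. (Gamma b * s powr (- b)) * f s)"
      using integrable_mult_right[OF int, of "Gamma b"] by (simp add: mult.assoc)
    have k: "(\<integral>\<^sup>+l. ennreal (K l s) \<partial>lborel) = ennreal (Gamma b * s powr (- b))" if "s \<in> {0<..}" for s
      unfolding K_def using that b by (intro nn_integral_powr_exp) auto
    note F = weighted_Fubini[where S = "{0<..}", OF Km _ fm _ _ _ i]
    have nn: "0 \<le> Gamma b * s powr (- b)" for s using Gamma_real_pos[OF b(1)] by simp
    show "integrable lborel (\<lambda>l. \<integral>s. K l s * f s \<partial>lborel)"
      by (rule F(1)) (use nn k in \<open>auto simp: K_def f_def\<close>)
    show "(\<integral>l. (\<integral>s. K l s * f s \<partial>lborel) \<partial>lborel) = (\<integral>s. (Gamma b * s powr (- b)) * f s \<partial>lborel)"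
      by (rule F(2)) (use nn k in \<open>auto simp: K_def f_def\<close>)
  qed
  have inner: "(\<integral>s. K l s * f s \<partial>lborel) = indicator {0<..} l * (l powr (b - 1) * m (R (l + e) B))" for l
  proof (cases "l > 0")
    case True
    have "(\<integral>s. K l s * f s \<partial>lborel) = (\<integral>s. l powr (b - 1) * (indicator {0<..} s *\<^sub>R (exp (- ((l + e) * s)) * m (T s B))) \<partial>lborel)"
    proof (rule Bochner_Integration.integral_cong[OF refl])
      fix s :: real
      have "exp (- (l * s)) * exp (- (e * s)) = exp (- ((l + e) * s))"
        by (simp add: exp_add[symmetric] algebra_simps)
      then show "K l s * f s = l powr (b - 1) * (indicator {0<..} s *\<^sub>R (exp (- ((l + e) * s)) * m (T s B)))"
        using True by (simp add: K_def f_def B_def indicator_def)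
    qed
    also have "\<dots> = l powr (b - 1) * (LINT s:{0<..}|lborel. exp (- ((l + e) * s)) * m (T s B))"
      unfolding set_lebesgue_integral_def by simp
    also have "\<dots> = l powr (b - 1) * m (R (l + e) B)" using LINT_R(2)[of "l + e" m B] True e m by simp
    finally show ?thesis using True by simp
  qed (simp add: K_def)
  have sI: "set_integrable lborel {0<..} (\<lambda>l. l powr (b - 1) * m (R (l + e) B))"
    using Fub(1) unfolding inner set_integrable_def by simp
  have "m (integral {0<..} (\<lambda>l. l powr (b - 1) *\<^sub>R (x - l *\<^sub>R R (l + e) x)))
      = integral {0<..} (m \<circ> (\<lambda>l. l powr (b - 1) *\<^sub>R (x - l *\<^sub>R R (l + e) x)))"
    by (rule integral_linear[OF A_pow_reg_tendsto_A_pow(2)[OF b x e] m, symmetric])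
  also have "\<dots> = integral {0<..} (\<lambda>l. l powr (b - 1) * m (R (l + e) B))"
    by (rule integral_cong) (use R_shift[OF x _ e] in \<open>simp add: linear_cmul[OF bounded_linear.linear[OF m]] B_def\<close>)
  also have "\<dots> = (LINT l:{0<..}|lborel. l powr (b - 1) * m (R (l + e) B))"
    by (rule set_borel_integral_eq_integral(2)[OF sI, symmetric])
  also have "\<dots> = Gamma b * (\<integral>s. s powr (- b) * f s \<partial>lborel)"
    using Fub(2) unfolding inner set_lebesgue_integral_def by (simp add: mult.assoc)
  finally show "m (A_pow_reg b e x) = (1 / Gamma (1 - b)) * (\<integral>s. s powr (- b) * f s \<partial>lborel)"
    unfolding A_pow_reg_def using less_imp_neq[OF Gamma_real_pos[OF b(1)]]
    by (simp add: linear_cmul[OF bounded_linear.linear[OF m]])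
qed

text \<open>Insert the formula for the regularised power into the integral of \<open>k\<close>. After the substitution \<open>v = u + s\<close> the
  integral over \<open>u\<close> of \<open>(u - r)\<^sup>b\<^sup>-\<^sup>1 (v - u)\<^sup>-\<^sup>b\<close> is the Beta integral \<open>\<Gamma>(b) \<Gamma>(1 - b)\<close>, independent of \<open>v\<close>,
  and what remains is \<open>\<integral>\<^sub>r\<^sup>\<infinity> exp (- e v) T(v)(e + A)x dv = exp (- e r) T(r)x\<close>.\<close>

lemma fractional_inversion:
  assumes b: "0 < b" "b < 1" and x: "x \<in> D" and e: "0 < e" and r: "0 \<le> r" and m: "bounded_linear (m :: 'a \<Rightarrow> real)"
  defines "k \<equiv> \<lambda>u. indicator {r<..} u * (u - r) powr (b - 1) * (exp (- (e * u)) * m (T u (A_pow_reg b e x)))"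
  shows "integrable lborel k" "(\<integral>u. k u \<partial>lborel) = Gamma b * (exp (- (e * r)) * m (T r x))"
proof -
  define B where "B = A x + e *\<^sub>R x"
  have mT: "bounded_linear (\<lambda>y. m (T u y))" if "0 \<le> u" for u
    by (rule bounded_linear_compose[OF m lin[OF that]])
  define h where "h v = indicator {r<..} v * (exp (- (e * v)) * m (T v B))" for v
  \<comment> \<open>Shifting by \<open>r\<close> reduces the integral of \<open>h\<close> to the Laplace integral of \<open>m \<circ> T r\<close>.\<close>
  have h_shift: "h (r + 1 * s) = exp (- (e * r)) * (indicator {0<..} s *\<^sub>R (exp (- (e * s)) * m (T r (T s B))))" for s
  proof -
    have "exp (- (e * (r + s))) = exp (- (e * r)) * exp (- (e * s))"
      by (simp add: exp_add[symmetric] distrib_left)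
    then show ?thesis using r T_add[of r s B] by (simp add: h_def indicator_def)
  qed
  have LR: "set_integrable lborel {0<..} (\<lambda>s. exp (- (e * s)) * m (T r (T s B)))"
    "(LINT s:{0<..}|lborel. exp (- (e * s)) * m (T r (T s B))) = m (T r (R e B))"
    by (rule LINT_R[OF e mT[OF r]])+
  have "integrable lborel (\<lambda>s. h (r + 1 * s))"
    unfolding h_shift using LR(1) unfolding set_integrable_def by (intro integrable_mult_right)
  then have hi: "integrable lborel h"
    using lborel_integrable_real_affine_iff[of 1 h r] by simp
  have hI: "(\<integral>v. h v \<partial>lborel) = exp (- (e * r)) * m (T r x)"
  proof -
    have "(\<integral>v. h v \<partial>lborel) = (\<integral>s. h (r + 1 * s) \<partial>lborel)"
      using lborel_integral_real_affine[of 1 h r] by simp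
    also have "\<dots> = exp (- (e * r)) * m (T r (R e B))"
      unfolding h_shift using LR(2) unfolding set_lebesgue_integral_def by simp
    also have "R e B = x" unfolding B_def using R_left_inverse[OF e x] by (simp add: add.commute)
    finally show ?thesis .
  qed
  define K where "K u v = indicator {r<..} u * indicator {u<..} v * ((u - r) powr (b - 1) * (v - u) powr (- b))" for u v :: real
  have Km: "(\<lambda>(u, v). K u v) \<in> borel_measurable (lborel \<Otimes>\<^sub>M lborel)"
  proof -
    have "(\<lambda>(u, v). K u v) = (\<lambda>p. if r < fst p \<and> fst p < snd p then (fst p - r) powr (b - 1) * (snd p - fst p) powr (- b) else 0)"
      by (auto simp: fun_eq_iff K_def)
    then show ?thesis by simp
  qed
  have Kk: "(\<integral>\<^sup>+u. ennreal (K u v) \<partial>lborel) = ennreal (Gamma b * Gamma (1 - b))" if "v \<in> {r<..}" for v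
  proof -
    have "K u v = indicator {r<..<v} u * ((u - r) powr (b - 1) * (v - u) powr (- b))" for u
      by (auto simp: K_def indicator_def)
    then show ?thesis using nn_integral_Beta_kernel[OF b, of r v] that by simp
  qed
  have c0: "0 \<le> Gamma b * Gamma (1 - b)" using b by (intro mult_nonneg_nonneg less_imp_le Gamma_real_pos) auto
  note F = weighted_Fubini[where S = "{r<..}", OF Km _ borel_measurable_integrable[OF hi] _ _ _ integrable_mult_right[OF hi, of "Gamma b * Gamma (1 - b)"]]
  have Fub: "integrable lborel (\<lambda>u. \<integral>v. K u v * h v \<partial>lborel)"
    "(\<integral>u. (\<integral>v. K u v * h v \<partial>lborel) \<partial>lborel) = (\<integral>v. Gamma b * Gamma (1 - b) * h v \<partial>lborel)"
    by (rule F; use Kk c0 in \<open>auto simp: K_def h_def\<close>)+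
  have "0 < Gamma (1 - b)" by (rule Gamma_real_pos) (use b in simp)
  then have g: "Gamma (1 - b) \<noteq> 0" by linarith
  have inner: "(\<integral>v. K u v * h v \<partial>lborel) = Gamma (1 - b) * k u" for u
  proof (cases "r < u")
    case True
    then have u: "0 \<le> u" using r by simp
    define f where "f s = indicator {0<..} s * (exp (- (e * s)) * m (T u (T s B)))" for s
    have mY: "m (T u (A_pow_reg b e x)) = (1 / Gamma (1 - b)) * (\<integral>s. s powr (- b) * f s \<partial>lborel)"
      unfolding f_def B_def by (rule A_pow_reg_functional(2)[OF b x e mT[OF u]])
    have "(\<integral>v. K u v * h v \<partial>lborel) = (\<integral>s. K u (u + 1 * s) * h (u + 1 * s) \<partial>lborel)"
      using lborel_integral_real_affine[of 1 "\<lambda>v. K u v * h v" u] by simp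
    also have "\<dots> = (\<integral>s. ((u - r) powr (b - 1) * exp (- (e * u))) * (s powr (- b) * f s) \<partial>lborel)"
    proof (rule Bochner_Integration.integral_cong[OF refl])
      fix s
      show "K u (u + 1 * s) * h (u + 1 * s) = ((u - r) powr (b - 1) * exp (- (e * u))) * (s powr (- b) * f s)"
      proof -
        have "exp (- (e * (u + s))) = exp (- (e * u)) * exp (- (e * s))"
          by (simp add: exp_add[symmetric] distrib_left)
        then show ?thesis using True u T_add[of u s B] by (simp add: K_def h_def f_def indicator_def)
      qed
    qed
    also have "\<dots> = ((u - r) powr (b - 1) * exp (- (e * u))) * (\<integral>s. s powr (- b) * f s \<partial>lborel)" by simp
    also have "\<dots> = Gamma (1 - b) * k u"
      using True g by (simp add: k_def mY)
    finally show ?thesis .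
  qed (simp add: K_def k_def)
  show "integrable lborel k"
    using integrable_mult_right[OF Fub(1)[unfolded inner], of "1 / Gamma (1 - b)"] g by simp
  have "Gamma (1 - b) * (\<integral>u. k u \<partial>lborel) = Gamma b * Gamma (1 - b) * (\<integral>v. h v \<partial>lborel)"
    using Fub(2) unfolding inner by simp
  then show "(\<integral>u. k u \<partial>lborel) = Gamma b * (exp (- (e * r)) * m (T r x))" using g hI by simp
qed

text \<open>Subtracting the inversion formulas at \<open>r\<close> and \<open>t\<close> bounds the increment of the regularised orbit by the \<open>L\<^sup>1\<close> norm
  of the difference of the kernels. The bound \<open>M\<close> enters only once, since a single functional is applied to the
  whole integral.\<close>

lemma orbit_Hoelder:
  assumes b: "0 < b" "b < 1" and x: "x \<in> D" and "0 \<le> r" "0 \<le> t"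
  shows "norm (T r x - T t x) \<le> 4 * M * norm (A_pow b x) * \<bar>r - t\<bar> powr b"
proof -
  have *: "norm (T r x - T t x) \<le> 4 * M * norm (A_pow b x) * (t - r) powr b" if rt: "0 \<le> r" "r < t" for r t
  proof -
    obtain m :: "'a \<Rightarrow> real" where m: "bounded_linear m" "\<And>y. \<bar>m y\<bar> \<le> norm y" "m (T r x - T t x) = norm (T r x - T t x)"
      using norming_functional[of "T r x - T t x"] by metis
    have t: "0 \<le> t" using rt by simp
    have est: "Gamma b * \<bar>exp (- (e * r)) * m (T r x) - exp (- (e * t)) * m (T t x)\<bar>
        \<le> M * norm (A_pow_reg b e x) * (2 / b * (t - r) powr b)" if e: "0 < e" for e
    proof -
      define h where "h u = exp (- (e * u)) * m (T u (A_pow_reg b e x))" for u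
      define kr where "kr u = indicator {r<..} u * (u - r) powr (b - 1)" for u
      define kt where "kt u = indicator {t<..} u * (u - t) powr (b - 1)" for u
      define C where "C = M * norm (A_pow_reg b e x)"
      have C: "0 \<le> C" using M_nonneg by (simp add: C_def)
      have hb: "\<bar>h u\<bar> \<le> C" if "0 \<le> u" for u
      proof -
        have "\<bar>m (T u (A_pow_reg b e x))\<bar> \<le> C" using m(2) bound[OF that] unfolding C_def by (rule order_trans)
        moreover have "exp (- (e * u)) \<le> 1" using e that by simp
        ultimately have "exp (- (e * u)) * \<bar>m (T u (A_pow_reg b e x))\<bar> \<le> 1 * C" by (intro mult_mono) auto
        then show ?thesis by (simp add: h_def abs_mult)
      qed
      note Ir = fractional_inversion[OF b x e rt(1) m(1), folded h_def kr_def]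
      note It = fractional_inversion[OF b x e t m(1), folded h_def kt_def]
      have "Gamma b * (exp (- (e * r)) * m (T r x) - exp (- (e * t)) * m (T t x)) = (\<integral>u. kr u * h u - kt u * h u \<partial>lborel)"
        using Ir It by (simp add: Bochner_Integration.integral_diff right_diff_distrib)
      then have "ennreal (Gamma b * \<bar>exp (- (e * r)) * m (T r x) - exp (- (e * t)) * m (T t x)\<bar>)
          = ennreal (norm (\<integral>u. kr u * h u - kt u * h u \<partial>lborel))"
        using Gamma_real_pos[OF b(1)] by (metis abs_mult abs_of_pos real_norm_def)
      also have "\<dots> \<le> (\<integral>\<^sup>+u. ennreal (norm (kr u * h u - kt u * h u)) \<partial>lborel)"
        using Ir(1) It(1) by (intro integral_norm_bound_ennreal) auto
      also have "\<dots> \<le> (\<integral>\<^sup>+u. ennreal C * ennreal \<bar>kr u - kt u\<bar> \<partial>lborel)"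
      proof (rule nn_integral_mono)
        fix u
        have "\<bar>kr u - kt u\<bar> * \<bar>h u\<bar> \<le> \<bar>kr u - kt u\<bar> * C"
        proof (cases "0 \<le> u")
          case True
          then show ?thesis by (intro mult_left_mono hb) auto
        next
          case False
          then show ?thesis using rt by (simp add: kr_def kt_def)
        qed
        then have "norm (kr u * h u - kt u * h u) \<le> C * \<bar>kr u - kt u\<bar>"
          unfolding left_diff_distrib[symmetric] real_norm_def abs_mult by (simp only: mult.commute)
        then show "ennreal (norm (kr u * h u - kt u * h u)) \<le> ennreal C * ennreal \<bar>kr u - kt u\<bar>"
          using C by (simp add: ennreal_mult'[symmetric] ennreal_leI)
      qed
      also have "\<dots> = ennreal C * (\<integral>\<^sup>+u. ennreal \<bar>kr u - kt u\<bar> \<partial>lborel)"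
        by (rule nn_integral_cmult) (simp add: kr_def kt_def)
      also have "\<dots> \<le> ennreal C * ennreal (2 / b * (t - r) powr b)"
        unfolding kr_def kt_def by (intro mult_left_mono nn_integral_powr_kernel_diff[OF b rt(2)]) auto
      also have "\<dots> = ennreal (C * (2 / b * (t - r) powr b))" by (rule ennreal_mult'[OF C, symmetric])
      finally show ?thesis using C b by (simp add: C_def)
    qed
    have "Gamma b * \<bar>exp (- (0 * r)) * m (T r x) - exp (- (0 * t)) * m (T t x)\<bar> \<le> M * norm (A_pow b x) * (2 / b * (t - r) powr b)"
    proof (rule tendsto_le)
      show "((\<lambda>e. Gamma b * \<bar>exp (- (e * r)) * m (T r x) - exp (- (e * t)) * m (T t x)\<bar>)
        \<longlongrightarrow> Gamma b * \<bar>exp (- (0 * r)) * m (T r x) - exp (- (0 * t)) * m (T t x)\<bar>) (at_right 0)"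
        by (intro tendsto_intros)
      show "((\<lambda>e. M * norm (A_pow_reg b e x) * (2 / b * (t - r) powr b)) \<longlongrightarrow> M * norm (A_pow b x) * (2 / b * (t - r) powr b)) (at_right 0)"
        by (intro tendsto_intros A_pow_reg_tendsto_A_pow b x)
      show "\<forall>\<^sub>F e in at_right 0. Gamma b * \<bar>exp (- (e * r)) * m (T r x) - exp (- (e * t)) * m (T t x)\<bar>
          \<le> M * norm (A_pow_reg b e x) * (2 / b * (t - r) powr b)"
        unfolding eventually_at_right_field using est by (intro exI[of _ 1]) auto
    qed simp
    then have "Gamma b * norm (T r x - T t x) \<le> M * norm (A_pow b x) * (2 / b * (t - r) powr b)"
      using m(3) by (simp add: linear_diff[OF bounded_linear.linear[OF m(1)]])
    moreover have Gp: "Gamma (b + 1) = b * Gamma b"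
      using Gamma_plus1[of b] b nonpos_Ints_nonpos[of b] by force
    have pos: "0 < Gamma b" using b by (simp add: Gamma_real_pos)
    ultimately have "norm (T r x - T t x) \<le> M * norm (A_pow b x) * (2 / b * (t - r) powr b) / Gamma b"
      by (simp only: pos_le_divide_eq mult.commute)
    also have "\<dots> = 2 * (M * norm (A_pow b x) * (t - r) powr b) * (1 / Gamma (b + 1))"
      unfolding Gp by simp
    also have "\<dots> \<le> 2 * (M * norm (A_pow b x) * (t - r) powr b) * 2"
      using M_nonneg by (intro mult_left_mono inverse_Gamma_le_2 b) auto
    finally show ?thesis by simp
  qed
  consider "r = t" | "r < t" | "t < r" by linarith
  then show ?thesis
    using *[of r t] *[of t r] assms(4,5) by cases (auto simp: norm_minus_commute)
qed

end

section \<open>The approximation estimates\<close>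

text \<open>Young's inequality \<open>w\<^sup>1\<^sup>-\<^sup>a\<^sup>/\<^sup>2 |d|\<^sup>a \<le> (a/2) d\<^sup>2 + (1 - a/2) w\<close> with \<open>w = V\<close>. For \<open>V = 0\<close> the variable
  vanishes almost surely, in agreement with \<open>0 powr (a/2) = 0\<close>.\<close>

lemma (in prob_space) expectation_powr_le:
  fixes X :: "'a \<Rightarrow> real"
  assumes i: "integrable M (\<lambda>s. (X s)\<^sup>2)" and X: "random_variable borel X"
    and V: "expectation (\<lambda>s. (X s)\<^sup>2) \<le> V" and a: "0 < a" "a \<le> 2"
  shows "integrable M (\<lambda>s. \<bar>X s\<bar> powr a)" "expectation (\<lambda>s. \<bar>X s\<bar> powr a) \<le> V powr (a / 2)"
proof -
  note [measurable] = X
  have V0: "0 \<le> V" by (rule order_trans[OF integral_nonneg_AE V]) simp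
  have Young: "w powr (1 - a / 2) * \<bar>d\<bar> powr a \<le> a / 2 * d\<^sup>2 + (1 - a / 2) * w" if w: "w > 0" for w d :: real
  proof (cases "d = 0")
    case True
    then show ?thesis using w a by simp
  next
    case False
    have "\<bar>d\<bar> powr a = (d\<^sup>2) powr (a / 2)"
    proof -
      have "d\<^sup>2 = \<bar>d\<bar> powr 2" using False by simp
      then show ?thesis by (simp only: powr_powr) simp
    qed
    then show ?thesis using Youngs_inequality_0[of "a / 2" "1 - a / 2" "d\<^sup>2" w] w a False
      by (simp add: mult.commute)
  qed
  show ia: "integrable M (\<lambda>s. \<bar>X s\<bar> powr a)"
  proof (rule Bochner_Integration.integrable_bound[where f = "\<lambda>s. a / 2 * (X s)\<^sup>2 + (1 - a / 2) * 1"])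
    show "integrable M (\<lambda>s. a / 2 * (X s)\<^sup>2 + (1 - a / 2) * 1)" using i by simp
    have "norm (\<bar>X s\<bar> powr a) \<le> norm (a / 2 * (X s)\<^sup>2 + (1 - a / 2) * 1)" for s
      using Young[of 1 "X s"] by simp
    then show "AE s in M. norm (\<bar>X s\<bar> powr a) \<le> norm (a / 2 * (X s)\<^sup>2 + (1 - a / 2) * 1)" by simp
  qed measurable
  show "expectation (\<lambda>s. \<bar>X s\<bar> powr a) \<le> V powr (a / 2)"
  proof (cases "V = 0")
    case True
    then have "expectation (\<lambda>s. (X s)\<^sup>2) = 0" using V by (intro antisym) auto
    then have "AE s in M. (X s)\<^sup>2 = 0" using integral_nonneg_eq_0_iff_AE[OF i] by simp
    then have "AE s in M. \<bar>X s\<bar> powr a = 0" by eventually_elim simp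
    then have "expectation (\<lambda>s. \<bar>X s\<bar> powr a) = 0" by (rule integral_eq_zero_AE)
    then show ?thesis by simp
  next
    case False
    then have Vp: "V > 0" using V0 by simp
    have "V powr (1 - a / 2) * expectation (\<lambda>s. \<bar>X s\<bar> powr a) = expectation (\<lambda>s. V powr (1 - a / 2) * \<bar>X s\<bar> powr a)"
      by simp
    also have "\<dots> \<le> expectation (\<lambda>s. a / 2 * (X s)\<^sup>2 + (1 - a / 2) * V)"
      using i ia Young[OF Vp] by (intro integral_mono) auto
    also have "\<dots> = a / 2 * expectation (\<lambda>s. (X s)\<^sup>2) + (1 - a / 2) * V" using i prob_space by simp
    also have "\<dots> \<le> a / 2 * V + (1 - a / 2) * V" using V a by (intro add_right_mono mult_left_mono) auto
    also have "\<dots> = V powr (1 - a / 2) * V powr (a / 2)" using Vp by (simp add: powr_add[symmetric] algebra_simps)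
    finally show ?thesis using Vp by simp
  qed
qed

context
  fixes T :: "real \<Rightarrow> 'a::complex_banach \<Rightarrow> 'a" and D A M and h :: "real \<Rightarrow> real" and P :: "real measure"
  assumes sg: "bounded_semigroup T D A M" and P: "bernstein_measure h = P"
    and prob: "prob_space P" and sets_P: "sets P = sets borel" and nonneg_P: "AE s in P. 0 \<le> s"
begin

interpretation bounded_semigroup T D A M by (rule sg)
interpretation P: prob_space P by (rule prob)

lemma hille_phillips_functional:
  assumes "bounded_linear l" "\<And>x. \<bar>l x :: real\<bar> \<le> norm x"
  shows "integrable P (\<lambda>s. l (indicator {0..} s *\<^sub>R T s x))"
    "l (hille_phillips T h x) = P.expectation (\<lambda>s. l (indicator {0..} s *\<^sub>R T s x))"
proof -
  obtain y where y: "has_strong_integral P (\<lambda>s. indicator {0..} s *\<^sub>R T s x) y"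
    using has_strong_integral_continuous[OF P.finite_measure_axioms sets_P continuous_orbit bound] by blast
  show "integrable P (\<lambda>s. l (indicator {0..} s *\<^sub>R T s x))"
    "l (hille_phillips T h x) = P.expectation (\<lambda>s. l (indicator {0..} s *\<^sub>R T s x))"
    unfolding hille_phillips_def P by (rule strong_integral_functional[OF y assms])+
qed

text \<open>The linear correction \<open>(s - t) v\<close> integrates to zero because \<open>t\<close> is the mean; it is what makes second order
  estimates possible.\<close>

lemma norm_hille_phillips_diff_le:
  assumes mean: "integrable P (\<lambda>s. s)" "P.expectation (\<lambda>s. s) = t"
    and \<phi>: "integrable P \<phi>"
    and le: "\<And>s. 0 \<le> s \<Longrightarrow> norm (T s x - T t x + (s - t) *\<^sub>R v) \<le> \<phi> s"
  shows "norm (hille_phillips T h x - T t x) \<le> P.expectation \<phi>"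
proof -
  obtain l :: "'a \<Rightarrow> real" where l: "bounded_linear l" "\<And>y. \<bar>l y\<bar> \<le> norm y"
    "l (hille_phillips T h x - T t x) = norm (hille_phillips T h x - T t x)"
    using norming_functional[of "hille_phillips T h x - T t x"] by metis
  note lin_l = bounded_linear.linear[OF l(1)]
  note H = hille_phillips_functional[OF l(1,2), of x]
  have i: "integrable P (\<lambda>s. l (indicator {0..} s *\<^sub>R T s x) - l (T t x) + (s - t) * l v)"
    using H(1) mean(1) by auto
  have "norm (hille_phillips T h x - T t x)
      = P.expectation (\<lambda>s. l (indicator {0..} s *\<^sub>R T s x) - l (T t x) + (s - t) * l v)"
    using H mean P.prob_space l(3) by (simp add: linear_diff[OF lin_l])
  also have "\<dots> \<le> P.expectation \<phi>"
  proof (rule integral_mono_AE[OF i \<phi>])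
    show "AE s in P. l (indicator {0..} s *\<^sub>R T s x) - l (T t x) + (s - t) * l v \<le> \<phi> s"
      using nonneg_P
    proof eventually_elim
      case (elim s)
      have "l (T s x - T t x + (s - t) *\<^sub>R v) \<le> norm (T s x - T t x + (s - t) *\<^sub>R v)"
        using l(2) abs_le_D1 by blast
      also have "\<dots> \<le> \<phi> s" by (rule le[OF elim])
      finally show ?case
        using elim by (simp add: linear_add[OF lin_l] linear_diff[OF lin_l] linear_cmul[OF lin_l])
    qed
  qed
  finally show ?thesis .
qed

lemma hille_phillips_Lipschitz: "norm (hille_phillips T h x - hille_phillips T h y) \<le> M * norm (x - y)"
proof -
  obtain l :: "'a \<Rightarrow> real" where l: "bounded_linear l" "\<And>y. \<bar>l y\<bar> \<le> norm y"
    "l (hille_phillips T h x - hille_phillips T h y) = norm (hille_phillips T h x - hille_phillips T h y)"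
    using norming_functional[of "hille_phillips T h x - hille_phillips T h y"] by metis
  note lin_l = bounded_linear.linear[OF l(1)]
  note H = hille_phillips_functional[OF l(1,2)]
  have "norm (hille_phillips T h x - hille_phillips T h y)
      = P.expectation (\<lambda>s. l (indicator {0..} s *\<^sub>R T s x) - l (indicator {0..} s *\<^sub>R T s y))"
    using H l(3) by (simp add: linear_diff[OF lin_l])
  also have "\<dots> \<le> P.expectation (\<lambda>s. M * norm (x - y))"
  proof (rule integral_mono_AE)
    show "AE s in P. l (indicator {0..} s *\<^sub>R T s x) - l (indicator {0..} s *\<^sub>R T s y) \<le> M * norm (x - y)"
      using nonneg_P
    proof eventually_elim
      case (elim s)
      have "l (T s (x - y)) \<le> norm (T s (x - y))" using l(2) abs_le_D1 by blast
      also have "\<dots> \<le> M * norm (x - y)" by (rule bound[OF elim])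
      finally show ?case using elim by (simp add: T_diff linear_diff[OF lin_l])
    qed
  qed (use H(1) in auto)
  also have "\<dots> = M * norm (x - y)" using P.prob_space by simp
  finally show ?thesis .
qed

lemma hille_phillips_bound_closure:
  fixes f :: "'a \<Rightarrow> 'a"
  assumes t: "0 \<le> t" and S: "\<And>x. x \<in> S \<Longrightarrow> norm (hille_phillips T h x - T t x) \<le> c * norm (f x)"
    and xy: "(x, y) \<in> closure ((\<lambda>x. (x, f x)) ` S)"
  shows "norm (hille_phillips T h x - T t x) \<le> c * norm y"
proof -
  have "continuous_on UNIV (hille_phillips T h)"
  proof (rule lipschitz_on_continuous_on)
    show "M-lipschitz_on UNIV (hille_phillips T h)"
      using hille_phillips_Lipschitz M_nonneg by (intro lipschitz_onI) (auto simp: dist_norm)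
  qed
  then have "continuous_on UNIV (\<lambda>p :: 'a \<times> 'a. hille_phillips T h (fst p))"
    by (rule continuous_on_compose2) (auto intro: continuous_intros)
  moreover have "continuous_on UNIV (\<lambda>p :: 'a \<times> 'a. T t (fst p))"
    by (intro bounded_linear.continuous_on[OF lin[OF t]] continuous_intros)
  ultimately have "closed {p :: 'a \<times> 'a. norm (hille_phillips T h (fst p) - T t (fst p)) \<le> c * norm (snd p)}"
    by (intro closed_Collect_le continuous_on_norm continuous_on_diff continuous_on_mult
        continuous_on_const continuous_on_snd continuous_on_id) assumption+
  moreover have "(\<lambda>x. (x, f x)) ` S \<subseteq> {p :: 'a \<times> 'a. norm (hille_phillips T h (fst p) - T t (fst p)) \<le> c * norm (snd p)}"
    using S by auto
  ultimately have "closure ((\<lambda>x. (x, f x)) ` S) \<subseteq> {p :: 'a \<times> 'a. norm (hille_phillips T h (fst p) - T t (fst p)) \<le> c * norm (snd p)}"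
    by (rule closure_minimal[rotated])
  from subsetD[OF this xy] show ?thesis by simp
qed

context
  fixes t V :: real
  assumes t: "0 \<le> t" and mean: "integrable P (\<lambda>s. s)" "P.expectation (\<lambda>s. s) = t"
    and var: "integrable P (\<lambda>s. (s - t)\<^sup>2)" "P.expectation (\<lambda>s. (s - t)\<^sup>2) \<le> V"
begin

lemma hille_phillips_moment_bound:
  assumes a: "0 < a" "a \<le> 2" and C: "0 \<le> C"
    and le: "\<And>s. 0 \<le> s \<Longrightarrow> norm (T s x - T t x + (s - t) *\<^sub>R v) \<le> C * \<bar>s - t\<bar> powr a"
  shows "norm (hille_phillips T h x - T t x) \<le> C * V powr (a / 2)"
proof -
  have X: "(\<lambda>s. s - t) \<in> borel_measurable P"
    using borel_measurable_integrable[OF mean(1)] by measurable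
  note E = P.expectation_powr_le[OF var(1) X var(2) a]
  have "norm (hille_phillips T h x - T t x) \<le> P.expectation (\<lambda>s. C * \<bar>s - t\<bar> powr a)"
    by (rule norm_hille_phillips_diff_le[OF mean _ le]) (use E(1) in auto)
  also have "\<dots> \<le> C * V powr (a / 2)" using E(2) C by (simp add: mult_left_mono)
  finally show ?thesis .
qed

lemma hille_phillips_bound_dom_A:
  assumes x: "x \<in> D"
  shows "norm (hille_phillips T h x - T t x) \<le> M * norm (A x) * V powr (1 / 2)"
proof (rule hille_phillips_moment_bound[where v = 0])
  show "norm (T s x - T t x + (s - t) *\<^sub>R 0) \<le> M * norm (A x) * \<bar>s - t\<bar> powr 1" if "0 \<le> s" for s
    using orbit_Lipschitz[OF x that t] by simp
qed (use M_nonneg in auto)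

lemma hille_phillips_bound_Hoelder:
  assumes x: "x \<in> D" and b: "0 < b" "b \<le> 1" and C: "0 \<le> C"
    and H: "\<And>u. 0 \<le> u \<Longrightarrow> norm (T u (A x) - T t (A x)) \<le> C * \<bar>u - t\<bar> powr b"
  shows "norm (hille_phillips T h x - T t x) \<le> C / (b + 1) * V powr ((b + 1) / 2)"
  by (rule hille_phillips_moment_bound[where v = "T t (A x)"])
    (use b C orbit_Taylor_of_Hoelder[OF x _ t less_imp_le[OF b(1)] H] in auto)

lemma hille_phillips_bound_dom_A2:
  assumes x: "x \<in> dom_pow D A 2" and V: "0 \<le> V"
  shows "norm (hille_phillips T h x - T t x) \<le> M * norm (A (A x)) / 2 * V"
proof -
  note xD = dom_pow_2D[OF x]
  have "norm (hille_phillips T h x - T t x) \<le> M * norm (A (A x)) / (1 + 1) * V powr ((1 + 1) / 2)"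
    by (rule hille_phillips_bound_Hoelder[OF xD(1)])
      (use orbit_Lipschitz[OF xD(2) _ t] M_nonneg in auto)
  then show ?thesis using V by simp
qed

text \<open>On the core the three cases use the Hoelder bound of order \<open>\<alpha>\<close>, the Lipschitz bound, and the Taylor expansion with the
  Hoelder bound of order \<open>\<alpha> - 1\<close> for the orbit of \<open>Ax\<close>; the closure then gives all of the domain.\<close>

lemma hille_phillips_bound_frac_pow:
  assumes \<alpha>: "0 < \<alpha>" "\<alpha> < 2" and x: "x \<in> frac_pow_dom D A \<alpha>"
  shows "norm (hille_phillips T h x - T t x) \<le> 4 * M * V powr (\<alpha> / 2) * norm (frac_pow D A \<alpha> x)"
proof -
  have core: "norm (hille_phillips T h x - T t x) \<le> 4 * M * V powr (\<alpha> / 2) * norm (balakrishnan D A \<alpha> x)"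
    if x: "x \<in> dom_pow D A (frac_order \<alpha>)" for x
  proof -
    consider "\<alpha> < 1" | "\<alpha> = 1" | "1 < \<alpha>" by linarith
    then show ?thesis
    proof cases
      case 1
      have "frac_order \<alpha> = 1" unfolding frac_order_def using \<alpha> 1 by (simp add: floor_eq_iff)
      then have xD: "x \<in> D" using x by (simp add: dom_pow_def)
      have "norm (hille_phillips T h x - T t x) \<le> 4 * M * norm (A_pow \<alpha> x) * V powr (\<alpha> / 2)"
      proof (rule hille_phillips_moment_bound[where v = 0])
        show "norm (T s x - T t x + (s - t) *\<^sub>R 0) \<le> 4 * M * norm (A_pow \<alpha> x) * \<bar>s - t\<bar> powr \<alpha>" if "0 \<le> s" for s
          using orbit_Hoelder[OF \<alpha>(1) 1 xD that t] by simp
      qed (use \<alpha> M_nonneg in auto)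
      then show ?thesis by (simp add: balakrishnan_lt_1[OF \<alpha>(1) 1] mult_ac)
    next
      case 2
      then have x2: "x \<in> dom_pow D A 2" using x by (simp add: frac_order_2)
      have "norm (hille_phillips T h x - T t x) \<le> 1 * (M * norm (A x) * V powr (1 / 2))"
        using hille_phillips_bound_dom_A dom_pow_2D[OF x2] by simp
      also have "\<dots> \<le> 4 * (M * norm (A x) * V powr (1 / 2))"
        using M_nonneg by (intro mult_right_mono) auto
      finally show ?thesis unfolding 2 balakrishnan_1[OF x2] by (simp add: mult_ac)
    next
      case 3
      then have x2: "x \<in> dom_pow D A 2" using x \<alpha> by (simp add: frac_order_2)
      have b: "0 < \<alpha> - 1" "\<alpha> - 1 < 1" using \<alpha> 3 by auto
      define C where "C = 4 * M * norm (A_pow (\<alpha> - 1) (A x))"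
      have C: "0 \<le> C" using M_nonneg by (simp add: C_def)
      have "norm (hille_phillips T h x - T t x) \<le> C / (\<alpha> - 1 + 1) * V powr ((\<alpha> - 1 + 1) / 2)"
        unfolding C_def using dom_pow_2D[OF x2] b M_nonneg
        by (intro hille_phillips_bound_Hoelder orbit_Hoelder t) auto
      also have "\<dots> \<le> C / 1 * V powr (\<alpha> / 2)"
        using C 3 by (intro mult_mono divide_left_mono) auto
      finally show ?thesis unfolding balakrishnan_gt_1[OF 3 \<alpha>(2) x2] C_def by (simp add: mult_ac)
    qed
  qed
  obtain y where y: "(x, y) \<in> frac_pow_graph D A \<alpha>" using x unfolding frac_pow_dom_def by auto
  have "norm (hille_phillips T h x - T t x) \<le> 4 * M * V powr (\<alpha> / 2) * norm y"
    using y unfolding frac_pow_graph_def by (rule hille_phillips_bound_closure[OF t, rotated]) (rule core)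
  then show ?thesis using frac_pow_eq[OF \<alpha> y] by simp
qed

end
end

lemma bounded_semigroup_of_generator:
  fixes T :: "real \<Rightarrow> 'a::complex_banach \<Rightarrow> 'a"
  assumes T: "bounded_C0_semigroup T" and gen: "is_generator T D (\<lambda>x. - A x)"
  shows "bounded_semigroup T D A (SUP t\<in>{0..}. onorm (T t))"
proof (rule bounded_semigroup.intro)
  let ?M = "SUP t\<in>{0..}. onorm (T t)"
  have C0: "C0_semigroup T" and bdd: "bdd_above ((\<lambda>t. onorm (T t)) ` {0..})"
    using T by (auto simp: bounded_C0_semigroup_def)
  have on: "onorm (T t) \<le> ?M" if "0 \<le> t" for t using that bdd by (intro cSUP_upper) auto
  show lin: "bounded_linear (T t)" if "0 \<le> t" for t using C0 that by (auto simp: C0_semigroup_def)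
  show "norm (T t x) \<le> ?M * norm x" if "0 \<le> t" for t x
    using onorm[OF lin[OF that], of x] mult_right_mono[OF on[OF that], of "norm x"] by simp
  show "0 \<le> ?M" using onorm_pos_le[OF lin[of 0]] on[of 0] by simp
  show "x \<in> D \<longleftrightarrow> (\<exists>y. ((\<lambda>h. (T h x - x) /\<^sub>R h) \<longlongrightarrow> y) (at_right 0))" for x
    using gen by (auto simp: is_generator_def)
  show "((\<lambda>h. (T h x - x) /\<^sub>R h) \<longlongrightarrow> - A x) (at_right 0)" if "x \<in> D" for x
    using gen that by (auto simp: is_generator_def)
qed (use T in \<open>auto simp: bounded_C0_semigroup_def C0_semigroup_def\<close>)

theorem theorem1p1:
  fixes T :: "real \<Rightarrow> 'a::complex_banach \<Rightarrow> 'a"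
    and D :: "'a set" and A :: "'a \<Rightarrow> 'a"
    and g :: "real \<Rightarrow> real \<Rightarrow> real" and M :: real
  assumes "bounded_C0_semigroup T"
    and "is_generator T D (\<lambda>x. - A x)"
    and "\<And>t. t > 0 \<Longrightarrow> completely_monotone (g t)"
    and "\<And>t. t > 0 \<Longrightarrow> deriv_at_0 0 (g t) = 1"
    and "\<And>t. t > 0 \<Longrightarrow> deriv_at_0 1 (g t) = -1"
    and "\<And>t. t > 0 \<Longrightarrow> deriv_at_0 2 (g t) < \<infinity>"
    and "M = (SUP t\<in>{0..}. onorm (T t))"
  shows "\<forall>n::nat. \<forall>t::real. n \<ge> 1 \<longrightarrow> t > 0 \<longrightarrow>
    (\<forall>x\<in>dom_pow D A 2.
       norm (hille_phillips T (\<lambda>z. g t (t * z / real n) ^ n) x - T t x)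
       \<le> M * ((real_of_ereal (deriv_at_0 2 (g t)) - 1) / 2) * (t\<^sup>2 / real n) * norm ((A ^^ 2) x)) \<and>
    (\<forall>x\<in>D.
       norm (hille_phillips T (\<lambda>z. g t (t * z / real n) ^ n) x - T t x)
       \<le> M * sqrt (real_of_ereal (deriv_at_0 2 (g t)) - 1) * (t / sqrt (real n)) * norm (A x)) \<and>
    (\<forall>\<alpha>::real. 0 < \<alpha> \<and> \<alpha> < 2 \<longrightarrow>
      (\<forall>x\<in>frac_pow_dom D A \<alpha>.
         norm (hille_phillips T (\<lambda>z. g t (t * z / real n) ^ n) x - T t x)
         \<le> 4 * M * ((real_of_ereal (deriv_at_0 2 (g t)) - 1) * (t\<^sup>2 / real n)) powr (\<alpha> / 2)
             * norm (frac_pow D A \<alpha> x)))"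
proof (intro allI impI)
  fix n :: nat and t :: real assume n: "n \<ge> 1" and t: "t > 0"
  let ?h = "\<lambda>z. g t (t * z / real n) ^ n"
  define S where "S = real_of_ereal (deriv_at_0 2 (g t))"
  define V where "V = (S - 1) * (t\<^sup>2 / real n)"
  have sg: "bounded_semigroup T D A M" using bounded_semigroup_of_generator[OF assms(1,2)] assms(7) by simp
  note P = approximation_measure[OF assms(3)[OF t] assms(4)[OF t] assms(5)[OF t] assms(6)[OF t] n t,
      folded S_def, folded V_def]
  note 1 = sg refl P(1-3) less_imp_le[OF t] P(4-7)
  have "0 \<le> V" by (rule order_trans[OF integral_nonneg_AE P(7)]) simp
  have "0 < t\<^sup>2 / real n" using n t by simp
  then have S1: "0 \<le> S - 1" using \<open>0 \<le> V\<close> mult_neg_pos[of "S - 1" "t\<^sup>2 / real n"] unfolding V_def by linarith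
  have root: "V powr (1 / 2) = sqrt (S - 1) * (t / sqrt (real n))"
    using \<open>0 \<le> V\<close> S1 t unfolding V_def by (simp add: powr_half_sqrt real_sqrt_mult real_sqrt_divide)
  show "(\<forall>x\<in>dom_pow D A 2.
       norm (hille_phillips T ?h x - T t x)
       \<le> M * ((real_of_ereal (deriv_at_0 2 (g t)) - 1) / 2) * (t\<^sup>2 / real n) * norm ((A ^^ 2) x)) \<and>
    (\<forall>x\<in>D.
       norm (hille_phillips T ?h x - T t x)
       \<le> M * sqrt (real_of_ereal (deriv_at_0 2 (g t)) - 1) * (t / sqrt (real n)) * norm (A x)) \<and>
    (\<forall>\<alpha>::real. 0 < \<alpha> \<and> \<alpha> < 2 \<longrightarrow>
      (\<forall>x\<in>frac_pow_dom D A \<alpha>.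
         norm (hille_phillips T ?h x - T t x)
         \<le> 4 * M * ((real_of_ereal (deriv_at_0 2 (g t)) - 1) * (t\<^sup>2 / real n)) powr (\<alpha> / 2)
             * norm (frac_pow D A \<alpha> x)))"
    unfolding S_def[symmetric] V_def[symmetric]
  proof (intro conjI ballI allI impI)
    fix x assume "x \<in> dom_pow D A 2"
    from hille_phillips_bound_dom_A2[OF 1 this \<open>0 \<le> V\<close>]
    show "norm (hille_phillips T ?h x - T t x) \<le> M * ((S - 1) / 2) * (t\<^sup>2 / real n) * norm ((A ^^ 2) x)"
      by (simp add: V_def numeral_2_eq_2 mult_ac)
  next
    fix x assume "x \<in> D"
    from hille_phillips_bound_dom_A[OF 1 this]
    show "norm (hille_phillips T ?h x - T t x) \<le> M * sqrt (S - 1) * (t / sqrt (real n)) * norm (A x)"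
      unfolding root by (simp add: mult_ac)
  next
    fix \<alpha> :: real and x assume "0 < \<alpha> \<and> \<alpha> < 2" "x \<in> frac_pow_dom D A \<alpha>"
    then show "norm (hille_phillips T ?h x - T t x) \<le> 4 * M * V powr (\<alpha> / 2) * norm (frac_pow D A \<alpha> x)"
      by (intro hille_phillips_bound_frac_pow[OF 1]) auto
  qed
qed

end
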